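(* Let $a,b,c\in\mathbb{C}$ be such that $a^2,b^2,c^2$ are pairwise distinct and the plane quartic $$X_{a,b,c}:\ x^4+y^4+z^4+ax^2y^2+bx^2z^2+cy^2z^2=0$$ is smooth. If the field of moduli of $X_{a,b,c}$ relative to the extension $\mathbb{C}/\mathbb{R}$ is $\mathbb{R}$, then $\mathbb{R}$ is a field of definition for $X_{a,b,c}$.
   Context: The field of moduli of a curve $X$ over $F$ relative to an extension $F/L$ is the fixed field of $\{\sigma\in\operatorname{Aut}(F/L): X\cong X^\sigma \text{ over } F\}$, where $X^\sigma$ is obtained by applying $\sigma$ to the coefficients of the equations of $X$. A subfield $N\subseteq F$ is a field of definition of $X$ if there is a curve defined over $N$ that is isomorphic to $X$ over $F$. *)

theory Defs
  imports
    Complex_Main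
    "HOL-Library.Poly_Mapping"
    "HOL-Library.Function_Algebras"
    "HOL-Computational_Algebra.Fundamental_Theorem_Algebra"
begin

section \<open>Multivariate polynomials\<close>

text \<open>The exponent vector \<open>m\<close> stands for the monomial \<open>\<Prod>i. X\<^sub>i ^ lookup m i\<close>.\<close>

type_synonym 'a mpoly = "(nat \<Rightarrow>\<^sub>0 nat) \<Rightarrow>\<^sub>0 'a"

definition Var :: "nat \<Rightarrow> 'a::comm_semiring_1 mpoly" where
  "Var i = Poly_Mapping.single (Poly_Mapping.single i 1) 1"

definition Const :: "'a::zero \<Rightarrow> 'a mpoly" where
  "Const a = Poly_Mapping.single 0 a"

definition mpoly_eval :: "'a::comm_semiring_1 mpoly \<Rightarrow> (nat \<Rightarrow> 'a) \<Rightarrow> 'a" where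
  "mpoly_eval f x = (\<Sum>m\<in>Poly_Mapping.keys f. Poly_Mapping.lookup f m *
     (\<Prod>i\<in>Poly_Mapping.keys m. x i ^ Poly_Mapping.lookup m i))"

text \<open>If \<open>m\<close> does not involve the variable \<open>i\<close>, then the truncated exponent
  is irrelevant because the coefficient is \<open>0\<close>.\<close>

definition mpoly_pderiv :: "nat \<Rightarrow> 'a::comm_semiring_1 mpoly \<Rightarrow> 'a mpoly" where
  "mpoly_pderiv i f = (\<Sum>m\<in>Poly_Mapping.keys f.
     Poly_Mapping.single (m - Poly_Mapping.single i 1)
       (of_nat (Poly_Mapping.lookup m i) * Poly_Mapping.lookup f m))"

text \<open>Homogeneous of degree \<open>d\<close> in the variables \<open>X\<^sub>0, \<dots>, X\<^sub>n\<close>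
  (the zero polynomial is a form of every degree).\<close>

definition is_form :: "nat \<Rightarrow> nat \<Rightarrow> 'a::zero mpoly \<Rightarrow> bool" where
  "is_form n d f \<longleftrightarrow> (\<forall>m\<in>Poly_Mapping.keys f. Poly_Mapping.keys m \<subseteq> {..n} \<and>
     (\<Sum>i\<in>Poly_Mapping.keys m. Poly_Mapping.lookup m i) = d)"


section \<open>Projective curves over an algebraically closed field of characteristic 0\<close>

text \<open>A vector of the \<open>n + 1\<close> homogeneous coordinates of projective \<open>n\<close>-space is
  extended by \<open>0\<close>; a point is the set of all its vectors of homogeneous coordinates.
  A projective algebraic set is given by \<open>n\<close> and a set \<open>S\<close> of forms in \<open>X\<^sub>0, \<dots>, X\<^sub>n\<close>.\<close>

definition coord_vectors :: "nat \<Rightarrow> (nat \<Rightarrow> 'a::zero) set" where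
  "coord_vectors n = {x. \<forall>i>n. x i = 0}"

definition proj_point :: "(nat \<Rightarrow> 'a::field) \<Rightarrow> (nat \<Rightarrow> 'a) set" where
  "proj_point x = {\<lambda>i. t * x i | t. t \<noteq> 0}"

definition common_zeros :: "nat \<Rightarrow> 'a::field mpoly set \<Rightarrow> (nat \<Rightarrow> 'a) set" where
  "common_zeros n S = {x \<in> coord_vectors n. x \<noteq> (\<lambda>_. 0) \<and> (\<forall>f\<in>S. mpoly_eval f x = 0)}"

definition proj_set :: "nat \<Rightarrow> 'a::field mpoly set \<Rightarrow> (nat \<Rightarrow> 'a) set set" where
  "proj_set n S = proj_point ` common_zeros n S"

text \<open>Jacobian criterion: at every point the Jacobian matrix of the equations has rank
  \<open>n - 1\<close>, i.e. its kernel (the tangent space of the affine cone) has dimension \<open>2\<close>.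
  Hence the scheme with equations \<open>S\<close> is smooth, in particular reduced, of pure dimension
  \<open>1\<close>. For a single nonzero equation in the projective plane this says that the gradient
  has no zero on the curve. Connectedness is not part of the definition; smooth plane
  curves are connected, and connectedness is invariant under isomorphism.\<close>

definition tangent_cone :: "nat \<Rightarrow> 'a::field mpoly set \<Rightarrow> (nat \<Rightarrow> 'a) \<Rightarrow> (nat \<Rightarrow> 'a) set" where
  "tangent_cone n S x =
     {v \<in> coord_vectors n. \<forall>f\<in>S. (\<Sum>i\<le>n. mpoly_eval (mpoly_pderiv i f) x * v i) = 0}"

definition smooth_curve :: "nat \<Rightarrow> 'a::{alg_closed_field,field_char_0} mpoly set \<Rightarrow> bool" where
  "smooth_curve n S \<longleftrightarrow> finite S \<and> (\<forall>f\<in>S. \<exists>d. is_form n d f) \<and>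
     (\<forall>x\<in>common_zeros n S.
        vector_space.dim (\<lambda>t v i. t * v i) (tangent_cone n S x) = 2)"

text \<open>Regular maps: near every point \<open>P\<close>, namely wherever the \<open>g j\<close> do not vanish
  simultaneously, the map is given by \<open>m + 1\<close> forms \<open>g 0, \<dots>, g m\<close> of equal degree.\<close>

definition regular_map ::
  "nat \<Rightarrow> 'a::{alg_closed_field,field_char_0} mpoly set \<Rightarrow> nat \<Rightarrow> 'a mpoly set \<Rightarrow>
   ((nat \<Rightarrow> 'a) set \<Rightarrow> (nat \<Rightarrow> 'a) set) \<Rightarrow> bool" where
  "regular_map n S m T \<phi> \<longleftrightarrow> \<phi> ` proj_set n S \<subseteq> proj_set m T \<and>
     (\<forall>P\<in>proj_set n S. \<exists>d g. (\<forall>j\<le>m. is_form n d (g j)) \<and>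
        (\<exists>x\<in>P. \<exists>j\<le>m. mpoly_eval (g j) x \<noteq> 0) \<and>
        (\<forall>Q\<in>proj_set n S. \<forall>x\<in>Q. (\<exists>j\<le>m. mpoly_eval (g j) x \<noteq> 0) \<longrightarrow>
           \<phi> Q = proj_point (\<lambda>j. if j \<le> m then mpoly_eval (g j) x else 0)))"

definition isomorphic_curves ::
  "nat \<Rightarrow> 'a::{alg_closed_field,field_char_0} mpoly set \<Rightarrow> nat \<Rightarrow> 'a mpoly set \<Rightarrow> bool" where
  "isomorphic_curves n S m T \<longleftrightarrow>
     (\<exists>\<phi> \<psi>. regular_map n S m T \<phi> \<and> regular_map m T n S \<psi> \<and>
       (\<forall>P\<in>proj_set n S. \<psi> (\<phi> P) = P) \<and> (\<forall>Q\<in>proj_set m T. \<phi> (\<psi> Q) = Q))"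


section \<open>Field of moduli and fields of definition\<close>

definition is_subfield :: "'a::field set \<Rightarrow> bool" where
  "is_subfield N \<longleftrightarrow> 0 \<in> N \<and> 1 \<in> N \<and>
     (\<forall>x\<in>N. \<forall>y\<in>N. x + y \<in> N \<and> x * y \<in> N) \<and> (\<forall>x\<in>N. - x \<in> N \<and> inverse x \<in> N)"

definition field_automorphisms :: "'a::field set \<Rightarrow> ('a \<Rightarrow> 'a) set" where
  "field_automorphisms L = {\<sigma>. bij \<sigma> \<and> \<sigma> 1 = 1 \<and>
     (\<forall>x y. \<sigma> (x + y) = \<sigma> x + \<sigma> y \<and> \<sigma> (x * y) = \<sigma> x * \<sigma> y) \<and> (\<forall>x\<in>L. \<sigma> x = x)}"

definition conjugate_curve :: "('a \<Rightarrow> 'a) \<Rightarrow> 'a::field mpoly set \<Rightarrow> 'a mpoly set" where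
  "conjugate_curve \<sigma> S = Poly_Mapping.map \<sigma> ` S"

definition field_of_moduli ::
  "'a::{alg_closed_field,field_char_0} set \<Rightarrow> nat \<Rightarrow> 'a mpoly set \<Rightarrow> 'a set" where
  "field_of_moduli L n S =
     {x. \<forall>\<sigma>\<in>field_automorphisms L.
           isomorphic_curves n S n (conjugate_curve \<sigma> S) \<longrightarrow> \<sigma> x = x}"

definition field_of_definition ::
  "'a::{alg_closed_field,field_char_0} set \<Rightarrow> nat \<Rightarrow> 'a mpoly set \<Rightarrow> bool" where
  "field_of_definition N n S \<longleftrightarrow> is_subfield N \<and>
     (\<exists>m T. smooth_curve m T \<and> (\<forall>f\<in>T. \<forall>k. Poly_Mapping.lookup f k \<in> N) \<and>
        isomorphic_curves n S m T)"


section \<open>The quartics\<close>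

text \<open>\<open>x, y, z\<close> are \<open>X\<^sub>0, X\<^sub>1, X\<^sub>2\<close>.\<close>

definition quartic :: "'a::comm_ring_1 \<Rightarrow> 'a \<Rightarrow> 'a \<Rightarrow> 'a mpoly" where
  "quartic a b c = Var 0 ^ 4 + Var 1 ^ 4 + Var 2 ^ 4
     + Const a * Var 0 ^ 2 * Var 1 ^ 2
     + Const b * Var 0 ^ 2 * Var 2 ^ 2
     + Const c * Var 1 ^ 2 * Var 2 ^ 2"

end

(* Complex conjugation forces X = X_{a,b,c} to be isomorphic to its conjugate Y.  An isomorphism of
   smooth plane quartics pulls the regular differentials, i.e. the linear forms times the residue
   form, back to regular differentials, so it is induced by a linear map A once every regular section
   of O(1) on X is known to be linear.  To see the latter, split the section into characters of the
   sign changes of the coordinates: each piece divided by its monomial is a bounded holomorphic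
   function on the conic in x^2, y^2, z^2, hence constant by Liouville's theorem.

   Let V be the group of sign changes.  As a^2, b^2, c^2 are pairwise distinct, each involution in V
   has centralizer V among the linear automorphisms of the quartic.  For s in V and t in A^-1 V A the
   product st has order at most 4: its eigenvalues are restricted because an eigenvector lies off the
   curve or its gradient is a left eigenvector, and a transvection would force a singular point.  If
   the order is odd, s and t are conjugate; if it is even, a power of st commutes with both; in either
   case V and A^-1 V A are conjugate, so A may be taken monomial.  Then (cnj a, cnj b, cnj c) is a
   permutation of (a, b, c) up to signs with product 1, and an explicit linear change of coordinates
   produces a real quartic. *)
theory Submission
  imports Defs "HOL-Complex_Analysis.Complex_Analysis"
begin

text \<open>An isomorphism is given only by local families of forms, of varying degree and with
  common zeros, so differentials are handled through velocities of holomorphic curves on the affine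
  cone. For a tangent vector \<open>v\<close> at \<open>x\<close> the vector
  \<open>cross x v\<close> is orthogonal to \<open>x\<close> and \<open>v\<close>, as is the
  gradient, so the two are proportional; the factor is the value of the residue form. Degree 4
  enters through weights: the gradient has weight 3 and the cross product weight 2, and the
  difference 1 is why differentials are sections of O(1). Curves come from a rational
  parametrization of the conic, lifted by square roots. Holomorphic lifts exist where no coordinate
  vanishes, so statements are proved at such generic points and extended by limits. The order of st
  is read off one number, the product of the two mutual pairings of the reflections, which behaves
  like cos^2 of the angle between mirrors: 1/4 means order 3, 1/2 means order 4. Distinct squares
  are used once more at the end: since conjugation is an involution, they exclude that it permutes
  a, b, c cyclically.\<close>

no_notation fps_nth (infixl \<open>$\<close> 75)

section \<open>Polynomial functions and holomorphic curves\<close>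

inductive_set polyfun :: "(complex^3 \<Rightarrow> complex) set" where
  const: "(\<lambda>_. c) \<in> polyfun"
| coord: "(\<lambda>x. x $ i) \<in> polyfun"
| add: "f \<in> polyfun \<Longrightarrow> g \<in> polyfun \<Longrightarrow> (\<lambda>x. f x + g x) \<in> polyfun"
| mult: "f \<in> polyfun \<Longrightarrow> g \<in> polyfun \<Longrightarrow> (\<lambda>x. f x * g x) \<in> polyfun"

lemma polyfun_minus: "f \<in> polyfun \<Longrightarrow> (\<lambda>x. - f x) \<in> polyfun"
  using polyfun.mult[OF polyfun.const[of "-1"]] by simp

lemma polyfun_diff: "f \<in> polyfun \<Longrightarrow> g \<in> polyfun \<Longrightarrow> (\<lambda>x. f x - g x) \<in> polyfun"
  using polyfun.add[OF _ polyfun_minus] by fastforce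

lemma polyfun_power: "f \<in> polyfun \<Longrightarrow> (\<lambda>x. f x ^ n) \<in> polyfun"
  by (induction n) (auto intro: polyfun.intros)

lemma polyfun_sum: "(\<And>i. i \<in> I \<Longrightarrow> f i \<in> polyfun) \<Longrightarrow> (\<lambda>x. \<Sum>i\<in>I. f i x) \<in> polyfun"
  by (induction I rule: infinite_finite_induct) (auto intro: polyfun.intros)

lemma polyfun_prod: "(\<And>i. i \<in> I \<Longrightarrow> f i \<in> polyfun) \<Longrightarrow> (\<lambda>x. \<Prod>i\<in>I. f i x) \<in> polyfun"
  by (induction I rule: infinite_finite_induct) (auto intro: polyfun.intros)

lemmas polyfun_intros =
  polyfun.intros polyfun_minus polyfun_diff polyfun_power polyfun_sum polyfun_prod

lemma continuous_polyfun: "f \<in> polyfun \<Longrightarrow> continuous_on UNIV f"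
  by (induction rule: polyfun.induct) (auto intro!: continuous_intros)

lemma tendsto_polyfun:
  assumes "f \<in> polyfun" "(p \<longlongrightarrow> P) F"
  shows "((\<lambda>t. f (p t)) \<longlongrightarrow> f P) F"
  using continuous_polyfun[OF assms(1)] assms(2) by (auto simp: continuous_on_tendsto_compose)

section \<open>Derivatives along holomorphic curves\<close>

definition curve_deriv :: "(complex \<Rightarrow> complex^3) \<Rightarrow> complex^3 \<Rightarrow> complex \<Rightarrow> bool" where
  "curve_deriv p v t \<longleftrightarrow> (\<forall>i. ((\<lambda>s. p s $ i) has_field_derivative v $ i) (at t))"

text \<open>Only the chain rule along curves is demanded of a gradient; partial derivatives are
  never formed. The entries have to be polynomial because Jacobian entries later become numerators
  of rational functions.\<close>

definition is_gradient :: "(complex^3 \<Rightarrow> complex) \<Rightarrow> (complex^3 \<Rightarrow> complex^3) \<Rightarrow> bool" where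
  "is_gradient f D \<longleftrightarrow> (\<forall>i. (\<lambda>x. D x $ i) \<in> polyfun) \<and>
    (\<forall>p v t. curve_deriv p v t \<longrightarrow>
      ((\<lambda>s. f (p s)) has_field_derivative (\<Sum>i\<in>UNIV. D (p t) $ i * v $ i)) (at t))"

lemma exists_gradient:
  assumes "f \<in> polyfun"
  shows "\<exists>D. is_gradient f D"
  using assms
proof (induction rule: polyfun.induct)
  case (const c)
  have "is_gradient (\<lambda>_. c) (\<lambda>_. 0)" by (auto simp: is_gradient_def intro: polyfun.const)
  then show ?case by blast
next
  case (coord i)
  have "(\<lambda>x. axis i 1 $ j) \<in> polyfun" for j by (rule polyfun.const)
  then have "is_gradient (\<lambda>x. x $ i) (\<lambda>_. axis i 1)"
    by (auto simp: is_gradient_def curve_deriv_def axis_def if_distrib[of "\<lambda>x. x * _"] cong: if_cong)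
  then show ?case by blast
next
  case (add f g)
  then obtain D E where "is_gradient f D" "is_gradient g E" by blast
  then have "is_gradient (\<lambda>x. f x + g x) (\<lambda>x. D x + E x)"
    unfolding is_gradient_def
    by (auto intro!: polyfun.add derivative_eq_intros simp: sum.distrib algebra_simps)
  then show ?case by blast
next
  case (mult f g)
  then obtain D E where D: "is_gradient f D" and E: "is_gradient g E" by blast
  have "is_gradient (\<lambda>x. f x * g x) (\<lambda>x. f x *s E x + g x *s D x)"
    unfolding is_gradient_def
  proof (intro conjI allI impI)
    show "(\<lambda>x. (f x *s E x + g x *s D x) $ i) \<in> polyfun" for i
      using D E by (auto intro!: polyfun.intros mult.hyps simp: is_gradient_def)
    fix p v t assume "curve_deriv p v t"
    then have "((\<lambda>s. f (p s)) has_field_derivative (\<Sum>i\<in>UNIV. D (p t) $ i * v $ i)) (at t)"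
      "((\<lambda>s. g (p s)) has_field_derivative (\<Sum>i\<in>UNIV. E (p t) $ i * v $ i)) (at t)"
      using D E unfolding is_gradient_def by blast+
    from DERIV_mult[OF this]
    show "((\<lambda>s. f (p s) * g (p s)) has_field_derivative
      (\<Sum>i\<in>UNIV. (f (p t) *s E (p t) + g (p t) *s D (p t)) $ i * v $ i)) (at t)"
      by (simp add: sum_distrib_left sum_distrib_right sum.distrib algebra_simps)
  qed
  then show ?case by blast
qed

lemma polyfun_deriv:
  assumes "f \<in> polyfun" "curve_deriv p v t"
  shows "\<exists>d. ((\<lambda>s. f (p s)) has_field_derivative d) (at t)"
  using exists_gradient[OF assms(1)] assms(2) unfolding is_gradient_def by blast

definition polymap :: "(complex^3 \<Rightarrow> complex^3) \<Rightarrow> bool" where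
  "polymap g \<longleftrightarrow> (\<forall>k. (\<lambda>x. g x $ k) \<in> polyfun)"

text \<open>The choice is made once per row and not per point, so the entries stay polynomial in
  \<open>x\<close>.\<close>

definition pjac :: "(complex^3 \<Rightarrow> complex^3) \<Rightarrow> complex^3 \<Rightarrow> complex^3^3" where
  "pjac g x = (\<chi> k. (SOME D. is_gradient (\<lambda>x. g x $ k) D) x)"

lemma pjac:
  assumes "polymap g"
  shows "(\<lambda>x. pjac g x $ i $ j) \<in> polyfun"
    and "curve_deriv p v t \<Longrightarrow> curve_deriv (\<lambda>s. g (p s)) (pjac g (p t) *v v) t"
proof -
  have "is_gradient (\<lambda>x. g x $ k) (\<lambda>x. pjac g x $ k)" for k
    using someI_ex[OF exists_gradient[of "\<lambda>x. g x $ k"]] assms by (simp add: pjac_def polymap_def)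
  then show "(\<lambda>x. pjac g x $ i $ j) \<in> polyfun"
    "curve_deriv p v t \<Longrightarrow> curve_deriv (\<lambda>s. g (p s)) (pjac g (p t) *v v) t"
    unfolding is_gradient_def curve_deriv_def[of "\<lambda>s. g (p s)"] by (auto simp: matrix_vector_mult_def)
qed

definition homogeneous :: "nat \<Rightarrow> (complex^3 \<Rightarrow> complex^3) \<Rightarrow> bool" where
  "homogeneous d g \<longleftrightarrow> (\<forall>x t. g (t *s x) = t ^ d *s g x)"

lemma curve_deriv_unique: "curve_deriv p v t \<Longrightarrow> curve_deriv p w t \<Longrightarrow> v = w"
  unfolding curve_deriv_def vec_eq_iff using DERIV_unique by blast

lemma curve_deriv_cong:
  assumes "curve_deriv p v t" "\<forall>\<^sub>F s in nhds t. p s = q s"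
  shows "curve_deriv q v t"
  unfolding curve_deriv_def
proof
  fix i
  have "\<forall>\<^sub>F s in nhds t. p s $ i = q s $ i"
    using assms(2) by eventually_elim simp
  from DERIV_cong_ev[OF refl this refl] assms(1)
  show "((\<lambda>s. q s $ i) has_field_derivative v $ i) (at t)"
    unfolding curve_deriv_def by blast
qed

lemma curve_deriv_line: "curve_deriv (\<lambda>s. x + s *s v) v t"
  by (auto simp: curve_deriv_def intro!: derivative_eq_intros)

lemma curve_deriv_scaled:
  assumes "curve_deriv p v t" "(c has_field_derivative d) (at t)"
  shows "curve_deriv (\<lambda>s. c s *s p s) (d *s p t + c t *s v) t"
  using assms by (auto simp: curve_deriv_def intro!: derivative_eq_intros)

lemma curve_deriv_tendsto: 
  assumes "curve_deriv p v t"
  shows "(p \<longlongrightarrow> p t) (nhds t)"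
proof (rule vec_tendstoI)
  fix i
  have "isCont (\<lambda>s. p s $ i) t"
    using assms DERIV_isCont unfolding curve_deriv_def by blast
  then show "((\<lambda>s. p s $ i) \<longlongrightarrow> p t $ i) (nhds t)"
    by (simp add: tendsto_nhds_iff isCont_def)
qed

text \<open>Differentiate \<open>g (s *s x) = s ^ d *s g x\<close> in \<open>s\<close> at 1.\<close>

lemma euler:
  assumes "polymap g" "homogeneous d g"
  shows "pjac g x *v x = of_nat d *s g x"
proof -
  have "curve_deriv (\<lambda>s. 0 + s *s x) x 1" by (rule curve_deriv_line)
  from pjac(2)[OF assms(1) this]
  have 1: "curve_deriv (\<lambda>s. g (s *s x)) (pjac g x *v x) 1" by simp
  have "curve_deriv (\<lambda>s. s ^ d *s g x) (of_nat d *s g x) 1"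
    by (auto simp: curve_deriv_def intro!: derivative_eq_intros)
  then have 2: "curve_deriv (\<lambda>s. g (s *s x)) (of_nat d *s g x) 1"
    using assms(2) by (simp add: homogeneous_def)
  from 1 2 show ?thesis by (rule curve_deriv_unique)
qed

lemma pjac_homogeneous:
  assumes "polymap g" "homogeneous d g"
  shows "pjac g (c *s x) *v (c *s v) = c ^ d *s (pjac g x *v v)"
proof -
  have "curve_deriv (\<lambda>s. c *s x + s *s (c *s v)) (c *s v) 0" by (rule curve_deriv_line)
  from pjac(2)[OF assms(1) this]
  have 1: "curve_deriv (\<lambda>s. g (c *s x + s *s (c *s v))) (pjac g (c *s x) *v (c *s v)) 0" by simp
  have "curve_deriv (\<lambda>s. x + s *s v) v 0" by (rule curve_deriv_line)
  from pjac(2)[OF assms(1) this]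
  have "curve_deriv (\<lambda>s. c ^ d *s g (x + s *s v)) (c ^ d *s (pjac g x *v v)) 0"
    by (auto simp: curve_deriv_def intro!: derivative_eq_intros)
  moreover have "c ^ d *s g (x + s *s v) = g (c *s x + s *s (c *s v))" for s
  proof -
    have "c ^ d *s g (x + s *s v) = g (c *s (x + s *s v))"
      using assms(2) unfolding homogeneous_def by metis
    also have "c *s (x + s *s v) = c *s x + s *s (c *s v)"
      by (simp add: vec_eq_iff algebra_simps)
    finally show ?thesis .
  qed
  ultimately have 2: "curve_deriv (\<lambda>s. g (c *s x + s *s (c *s v))) (c ^ d *s (pjac g x *v v)) 0"
    by (simp only: ext)
  from 1 2 show ?thesis by (rule curve_deriv_unique)
qed

definition flip :: "3 \<Rightarrow> complex^3 \<Rightarrow> complex^3" where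
  "flip i x = (\<chi> j. if j = i then - x $ j else x $ j)"

lemma polyfun_flip:
  assumes "f \<in> polyfun" shows "(\<lambda>x. f (flip i x)) \<in> polyfun"
  using assms
proof (induction rule: polyfun.induct)
  case (coord j)
  show ?case by (cases "j = i") (auto simp: flip_def intro!: polyfun_intros)
qed (auto intro: polyfun.intros)

text \<open>The difference is odd in \<open>x $ i\<close>, hence divisible by it; products follow
  from the discrete product rule. This later removes the denominator \<open>x $ i\<close> on the
  line where it vanishes.\<close>

lemma polyfun_flip_diff:
  assumes "f \<in> polyfun"
  shows "\<exists>E\<in>polyfun. \<forall>x. f x - f (flip i x) = x $ i * E x"
  using assms
proof (induction rule: polyfun.induct)
  case (const c)
  then show ?case by (intro bexI[of _ "\<lambda>_. 0"]) (auto intro: polyfun.intros)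
next
  case (coord j)
  show ?case
    by (intro bexI[of _ "\<lambda>_. if j = i then 2 else 0"]) (auto simp: flip_def intro: polyfun.intros)
next
  case (add f g)
  then obtain D E where D: "D \<in> polyfun" "\<And>x. f x - f (flip i x) = x $ i * D x"
    and E: "E \<in> polyfun" "\<And>x. g x - g (flip i x) = x $ i * E x" by blast
  have "f x + g x - (f (flip i x) + g (flip i x)) = x $ i * (D x + E x)" for x
    using D(2)[of x] E(2)[of x] by algebra
  with D(1) E(1) show ?case
    by (intro bexI[of _ "\<lambda>x. D x + E x"]) (auto intro!: polyfun.intros)
next
  case (mult f g)
  then obtain D E where D: "D \<in> polyfun" "\<And>x. f x - f (flip i x) = x $ i * D x"
    and E: "E \<in> polyfun" "\<And>x. g x - g (flip i x) = x $ i * E x" by blast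
  have "f x * g x - f (flip i x) * g (flip i x) = x $ i * (D x * g x + f (flip i x) * E x)" for x
    using D(2)[of x] E(2)[of x] by algebra
  then show ?case
    by (intro bexI[of _ "\<lambda>x. D x * g x + f (flip i x) * E x"])
      (auto intro!: polyfun.intros polyfun_flip D E mult.hyps)
qed

section \<open>The quartic and its conic of squares\<close>

definition dot :: "complex^3 \<Rightarrow> complex^3 \<Rightarrow> complex" where
  "dot x y = x $ 1 * y $ 1 + x $ 2 * y $ 2 + x $ 3 * y $ 3"

definition cross :: "complex^3 \<Rightarrow> complex^3 \<Rightarrow> complex^3" where
  "cross x y = vector [x $ 2 * y $ 3 - x $ 3 * y $ 2, x $ 3 * y $ 1 - x $ 1 * y $ 3,
     x $ 1 * y $ 2 - x $ 2 * y $ 1]"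

lemma cross_nth [simp]:
  "cross x y $ 1 = x $ 2 * y $ 3 - x $ 3 * y $ 2"
  "cross x y $ 2 = x $ 3 * y $ 1 - x $ 1 * y $ 3"
  "cross x y $ 3 = x $ 1 * y $ 2 - x $ 2 * y $ 1"
  by (simp_all add: cross_def)

lemma vec3_eq_iff: "x = y \<longleftrightarrow> x $ 1 = y $ 1 \<and> x $ 2 = y $ 2 \<and> x $ 3 = y $ 3"
  for x y :: "'a^3"
  by (simp add: vec_eq_iff forall_3)

lemma cross_scale: "cross (c *s x) (d *s y) = (c * d) *s cross x y"
  by (simp add: vec3_eq_iff algebra_simps)

lemma cross_add_right: "cross x (y + z) = cross x y + cross x z"
  by (simp add: vec3_eq_iff algebra_simps)

lemma cross_scale_right: "cross x (d *s y) = d *s cross x y"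
  by (simp add: vec3_eq_iff algebra_simps)

lemma cross_self [simp]: "cross x x = 0"
  by (simp add: vec3_eq_iff)

lemma parallel_if_cross_eq_0:
  assumes "cross x y = 0" "x \<noteq> 0"
  shows "\<exists>c. y = c *s x"
proof -
  obtain i where i: "x $ i \<noteq> 0" using assms(2) by (auto simp: vec_eq_iff)
  have "x $ i * y $ j = y $ i * x $ j" for j
    using assms(1) exhaust_3[of i] exhaust_3[of j] by (auto simp: vec3_eq_iff mult.commute)
  then have "y $ j = (y $ i / x $ i) * x $ j" for j
    using i by (simp add: field_simps)
  then show ?thesis unfolding vec_eq_iff vector_smult_component by blast
qed

text \<open>Two lifts of one curve in the projective plane: if \<open>q = k p\<close>, then
  \<open>q' = k' p + k v\<close>, and the term with \<open>k'\<close> dies in the cross product with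
  \<open>q\<close>.\<close>

lemma cross_curve_multiple:
  assumes p: "curve_deriv p v t" and q: "curve_deriv q w t" and pt: "p t \<noteq> 0"
    and ev: "\<forall>\<^sub>F s in nhds t. \<exists>l. q s = l *s p s"
  shows "\<exists>k. q t = k *s p t \<and> cross (q t) w = k\<^sup>2 *s cross (p t) v"
proof -
  obtain i where i: "p t $ i \<noteq> 0" using pt by (auto simp: vec_eq_iff)
  \<comment> \<open>The factors in \<open>ev\<close> are chosen pointwise; a quotient of coordinates
    is a differentiable choice.\<close>
  define k where "k = (\<lambda>s. q s $ i / p s $ i)"
  have "\<forall>\<^sub>F s in nhds t. p s $ i \<noteq> 0"
    using tendsto_imp_eventually_ne[OF tendsto_vec_nth[OF curve_deriv_tendsto[OF p]] i] .
  with ev have ev': "\<forall>\<^sub>F s in nhds t. k s *s p s = q s"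
    by eventually_elim (auto simp: k_def)
  obtain k' where k': "(k has_field_derivative k') (at t)"
    unfolding k_def using p q DERIV_divide i unfolding curve_deriv_def by blast
  have w: "w = k' *s p t + k t *s v"
    using curve_deriv_unique[OF q curve_deriv_cong[OF curve_deriv_scaled[OF p k'] ev']] .
  have "q t = k t *s p t" using eventually_nhds_x_imp_x[OF ev'] by simp
  then show ?thesis
    unfolding w cross_add_right by (intro exI[of _ "k t"]) (simp add: cross_scale power2_eq_square)
qed

lemma cross_eq_scale_if_orthogonal:
  assumes "dot n x = 0" "dot n y = 0" "n \<noteq> 0"
  shows "\<exists>c. cross x y = c *s n"
proof -
  have "cross n (cross x y) = 0"
    using assms(1,2) by (simp add: vec3_eq_iff dot_def) algebra
  then show ?thesis using parallel_if_cross_eq_0 assms(3) by blast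
qed

lemma cross_cross_right: "cross x (cross n w) = dot x w *s n - dot x n *s w"
  by (simp add: vec3_eq_iff dot_def algebra_simps)

definition conic :: "complex \<Rightarrow> complex \<Rightarrow> complex \<Rightarrow> complex^3 \<Rightarrow> complex" where
  "conic a b c u = (u$1)\<^sup>2 + (u$2)\<^sup>2 + (u$3)\<^sup>2 + a * u$1 * u$2 + b * u$1 * u$3 + c * u$2 * u$3"

definition sq :: "complex^3 \<Rightarrow> complex^3" where
  "sq x = (\<chi> i. (x $ i)\<^sup>2)"

lemma sq_nth [simp]: "sq x $ i = (x $ i)\<^sup>2"
  by (simp add: sq_def)

definition qform :: "complex \<Rightarrow> complex \<Rightarrow> complex \<Rightarrow> complex^3 \<Rightarrow> complex" where
  "qform a b c x = conic a b c (sq x)"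

definition conic_grad :: "complex \<Rightarrow> complex \<Rightarrow> complex \<Rightarrow> complex^3 \<Rightarrow> complex^3" where
  "conic_grad a b c u = vector [2 * u$1 + a * u$2 + b * u$3, a * u$1 + 2 * u$2 + c * u$3,
     b * u$1 + c * u$2 + 2 * u$3]"

definition qgrad :: "complex \<Rightarrow> complex \<Rightarrow> complex \<Rightarrow> complex^3 \<Rightarrow> complex^3" where
  "qgrad a b c x = (\<chi> i. 2 * x $ i * conic_grad a b c (sq x) $ i)"

lemma conic_grad_nth [simp]:
  "conic_grad a b c u $ 1 = 2 * u$1 + a * u$2 + b * u$3"
  "conic_grad a b c u $ 2 = a * u$1 + 2 * u$2 + c * u$3"
  "conic_grad a b c u $ 3 = b * u$1 + c * u$2 + 2 * u$3"
  by (simp_all add: conic_grad_def)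

lemma conic_scale: "conic a b c (k *s u) = k\<^sup>2 * conic a b c u"
  by (simp add: conic_def power2_eq_square algebra_simps)

lemma qform_scale: "qform a b c (k *s x) = k ^ 4 * qform a b c x"
  by (simp add: qform_def conic_def power_mult_distrib algebra_simps power2_eq_square
     power4_eq_xxxx)

lemma qgrad_scale: "qgrad a b c (k *s x) = k ^ 3 *s qgrad a b c x"
  by (simp add: qgrad_def vec3_eq_iff power2_eq_square power3_eq_cube algebra_simps)

lemma dot_qgrad: "dot (qgrad a b c x) x = 4 * qform a b c x"
  by (simp add: qgrad_def qform_def conic_def dot_def power2_eq_square algebra_simps)

lemma qform_deriv:
  assumes "curve_deriv p v t"
  shows "((\<lambda>s. qform a b c (p s)) has_field_derivative dot (qgrad a b c (p t)) v) (at t)"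
  using assms unfolding curve_deriv_def forall_3 qform_def conic_def sq_nth
  by (auto intro!: derivative_eq_intros
    simp: qgrad_def dot_def power2_eq_square algebra_simps)

lemma polyfun_qform: "qform a b c \<in> polyfun"
  unfolding qform_def[abs_def] conic_def sq_nth by (intro polyfun_intros)

lemma polyfun_qgrad: "(\<lambda>x. qgrad a b c x $ i) \<in> polyfun"
proof -
  have "(\<lambda>x. conic_grad a b c (sq x) $ i) \<in> polyfun"
    using exhaust_3[of i] by (auto intro!: polyfun_intros)
  then show ?thesis by (auto simp: qgrad_def intro!: polyfun_intros)
qed

locale smooth_quartic =
  fixes a b c :: complex
  assumes smooth: "x \<noteq> 0 \<Longrightarrow> qform a b c x = 0 \<Longrightarrow> qgrad a b c x \<noteq> 0"
begin

abbreviation "F \<equiv> qform a b c"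
abbreviation "dF \<equiv> qgrad a b c"

definition cone :: "(complex^3) set" where
  "cone = {x. x \<noteq> 0 \<and> F x = 0}"

text \<open>Away from the coordinate lines squaring the coordinates is unramified, so curves on the
  conic lift locally.\<close>

definition generic :: "(complex^3) set" where
  "generic = {x. F x = 0 \<and> (\<forall>i. x $ i \<noteq> 0)}"

lemma generic_subset: "generic \<subseteq> cone"
  by (auto simp: generic_def cone_def)

lemma generic_scale: "x \<in> generic \<Longrightarrow> k \<noteq> 0 \<Longrightarrow> k *s x \<in> generic"
  by (auto simp: generic_def qform_scale vec_eq_iff)

lemma exists_sqrt: "\<exists>x. sq x = u"
  by (intro exI[of _ "\<chi> i. csqrt (u $ i)"]) (simp add: vec_eq_iff)

text \<open>Take square roots of the coordinates: the gradient of the quartic there has the entries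
  \<open>2 * x $ i * conic_grad a b c u $ i\<close>. Geometrically, the conic is smooth and
  transversal to the coordinate lines.\<close>

lemma conic_nondegenerate:
  assumes "conic a b c u = 0" "u \<noteq> 0"
  shows "\<exists>i. u $ i \<noteq> 0 \<and> conic_grad a b c u $ i \<noteq> 0"
proof -
  obtain x where x: "sq x = u" using exists_sqrt by blast
  have "x \<noteq> 0" using assms(2) x by (metis vec_eq_iff sq_nth zero_index zero_power2)
  moreover have "F x = 0" using assms(1) x by (simp add: qform_def)
  ultimately have "dF x \<noteq> 0" by (rule smooth)
  then obtain i where "dF x $ i \<noteq> 0" by (auto simp: vec_eq_iff)
  then show ?thesis using x by (intro exI[of _ i]) (auto simp: qgrad_def)
qed

section \<open>Rational parametrization of the conic\<close>

definition root :: "complex \<Rightarrow> bool" where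
  "root r \<longleftrightarrow> r\<^sup>2 + c * r + 1 = 0"

text \<open>The projection of the conic from its point \<open>(0, r, 1)\<close> onto the line of the points \<open>(1, t, 0)\<close>.\<close>

definition qparam :: "complex \<Rightarrow> complex \<Rightarrow> complex^3" where
  "qparam r t = vector [(a * r + b) + (2 * r + c) * t,
     t * ((a * r + b) + (2 * r + c) * t) - r * (1 + a * t + t\<^sup>2), - (1 + a * t + t\<^sup>2)]"

definition qparam' :: "complex \<Rightarrow> complex \<Rightarrow> complex^3" where
  "qparam' r t = vector [2 * r + c, (a * r + b) + 2 * (2 * r + c) * t - r * (a + 2 * t), - (a + 2 * t)]"

lemma qparam_nth [simp]:
  "qparam r t $ 1 = (a * r + b) + (2 * r + c) * t"
  "qparam r t $ 2 = t * ((a * r + b) + (2 * r + c) * t) - r * (1 + a * t + t\<^sup>2)"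
  "qparam r t $ 3 = - (1 + a * t + t\<^sup>2)"
  "qparam' r t $ 1 = 2 * r + c"
  "qparam' r t $ 2 = (a * r + b) + 2 * (2 * r + c) * t - r * (a + 2 * t)"
  "qparam' r t $ 3 = - (a + 2 * t)"
  by (simp_all add: qparam_def qparam'_def)

lemma exists_root: "\<exists>r. root r"
proof -
  define s where "s = csqrt (c\<^sup>2 - 4)"
  have s: "s\<^sup>2 = c\<^sup>2 - 4" by (simp add: s_def)
  have "((s - c) / 2)\<^sup>2 + c * ((s - c) / 2) + 1 = (s\<^sup>2 - (c\<^sup>2 - 4)) / 4"
    by (simp add: power2_eq_square field_simps)
  also have "\<dots> = 0" using s by simp
  finally show ?thesis unfolding root_def by blast
qed

lemma root_nonzero: "root r \<Longrightarrow> r \<noteq> 0"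
  by (auto simp: root_def)

text \<open>A double root would make the conic tangent to the line \<open>u $ 1 = 0\<close> at
  \<open>(0, r, 1)\<close>, which \<open>conic_nondegenerate\<close> excludes.\<close>

lemma root_simple:
  assumes "root r" shows "2 * r + c \<noteq> 0"
proof
  assume 0: "2 * r + c = 0"
  have "conic a b c (vector [0, r, 1]) = 0"
    using assms by (simp add: conic_def root_def power2_eq_square algebra_simps)
  moreover have "vector [0, r, 1] \<noteq> (0 :: complex^3)" by (simp add: vec3_eq_iff)
  ultimately obtain i where i: "vector [0, r, 1] $ i \<noteq> (0::complex)"
      "conic_grad a b c (vector [0, r, 1]) $ i \<noteq> 0"
    using conic_nondegenerate by blast
  have "2 + c * r = 0" using 0 assms unfolding root_def by algebra
  with i 0 exhaust_3[of i] show False by (auto simp: algebra_simps)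
qed

lemma conic_qparam: "root r \<Longrightarrow> conic a b c (qparam r t) = 0"
  unfolding conic_def root_def qparam_nth by algebra

text \<open>Position and velocity span the tangent line, so proportionality is clear; the point is
  that the factor is exactly 1, that is, the residue form of the conic is dt.\<close>

lemma cross_qparam: "root r \<Longrightarrow> cross (qparam r t) (qparam' r t) = conic_grad a b c (qparam r t)"
  unfolding root_def vec3_eq_iff cross_nth conic_grad_nth qparam_nth by algebra

(* A common zero of the components would be a line on the conic, hence a singular point. *)
lemma qparam_nonzero:
  assumes "root r" shows "qparam r t \<noteq> 0"
proof
  assume "qparam r t = 0"
  then have "qparam r t $ 1 = 0" "qparam r t $ 3 = 0" by simp_all
  then have 1: "(a * r + b) + (2 * r + c) * t = 0" and 2: "1 + a * t + t\<^sup>2 = 0"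
    unfolding qparam_nth neg_equal_0_iff_equal .
  \<comment> \<open>The whole line through \<open>(1, t, 0)\<close> and \<open>(0, r, 1)\<close>
    would lie on the conic. The value \<open>s\<close> picks its point where the second partial
    derivative vanishes, and the other two then vanish as well.\<close>
  define s where "s = - (a + 2 * t) / (2 * r + c)"
  have s: "s * (2 * r + c) = - (a + 2 * t)" using root_simple[OF assms] by (simp add: s_def)
  let ?u = "vector [1, s * r + t, s] :: complex^3"
  have "conic a b c ?u = 0"
    using assms 1 2 s unfolding root_def conic_def by simp algebra
  moreover have "?u \<noteq> 0" by (simp add: vec3_eq_iff)
  ultimately obtain i where i: "conic_grad a b c ?u $ i \<noteq> 0"
    using conic_nondegenerate by blast
  have g2: "a + 2 * (s * r + t) + c * s = 0" using s by algebra
  have g3: "b + c * (s * r + t) + 2 * s = 0"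
    using assms 1 g2 unfolding root_def by algebra
  have g1: "2 + a * (s * r + t) + b * s = 0" using 1 2 g2 g3 by algebra
  from i g1 g2 g3 show False using exhaust_3[of i] by auto
qed

lemma qparam_deriv: "((\<lambda>t. qparam r t $ i) has_field_derivative qparam' r t $ i) (at t)"
  using exhaust_3[of i] by (auto intro!: derivative_eq_intros simp: algebra_simps)

lemma finite_qparam_zeros:
  assumes "root r" shows "finite {t. qparam r t $ i = 0}"
proof -
  define P where "P = (if i = 1 then [:a * r + b, 2 * r + c:]
     else if i = 2 then [:- r, a * r + b - r * a, r + c:] else [:-1, -a, -1:])"
  have "poly P t = qparam r t $ i" for t
    using exhaust_3[of i] by (auto simp: P_def algebra_simps power2_eq_square)
  moreover have "P \<noteq> 0" using root_simple[OF assms] root_nonzero[OF assms] by (simp add: P_def)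
  ultimately show ?thesis using poly_roots_finite[of P] by simp
qed

lemma cone_qparam_root:
  assumes x: "x \<in> cone" and x1: "x $ 1 \<noteq> 0" and root: "root r"
  shows "\<exists>t k. k \<noteq> 0 \<and> sq x = k *s qparam r t"
proof -
  define u v w where uvw: "u = (x$1)\<^sup>2" "v = (x$2)\<^sup>2" "w = (x$3)\<^sup>2"
  have u: "u \<noteq> 0" using x1 by (simp add: uvw)
  \<comment> \<open>Projection from \<open>(0, r, 1)\<close> sends \<open>(u, v, w)\<close> to
    \<open>(u, v - r * w, 0)\<close>.\<close>
  define t where "t = (v - r * w) / u"
  have t: "u * t = v - r * w" using u by (simp add: t_def)
  define B where "B = (a * r + b) + (2 * r + c) * t"
  have F: "u\<^sup>2 + v\<^sup>2 + w\<^sup>2 + a * u * v + b * u * w + c * v * w = 0"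
    using x by (simp add: cone_def qform_def conic_def uvw)
  have "u * (u * (1 + a * t + t\<^sup>2) + w * B) = 0"
    using F t root unfolding root_def B_def by algebra
  then have C: "u * (1 + a * t + t\<^sup>2) = - w * B" using u by (simp add: add_eq_0_iff)
  have B: "B \<noteq> 0"
  proof
    assume 0: "B = 0"
    with C u have C0: "1 + a * t + t\<^sup>2 = 0" by simp
    have "qparam r t = 0" unfolding vec3_eq_iff qparam_nth B_def[symmetric]
      by (simp only: 0 C0 mult_zero_right diff_zero minus_zero zero_index simp_thms)
    then show False using qparam_nonzero[OF root] by blast
  qed
  have "u * (t * B - r * (1 + a * t + t\<^sup>2)) = v * B" using C t by algebra
  then have "v = u / B * (t * B - r * (1 + a * t + t\<^sup>2))"
    using B by (metis nonzero_mult_div_cancel_right times_divide_eq_left)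
  moreover have "w = u / B * - (1 + a * t + t\<^sup>2)"
    using B C by (metis minus_mult_left minus_mult_right minus_minus mult.commute
      nonzero_mult_div_cancel_right times_divide_eq_left)
  moreover have "u = u / B * B" using B by simp
  ultimately have "sq x = (u / B) *s qparam r t"
    unfolding vec3_eq_iff sq_nth vector_smult_component qparam_nth uvw[symmetric] B_def[symmetric]
    by blast
  moreover have "u / B \<noteq> 0" using B u by simp
  ultimately show ?thesis by blast
qed

lemma cone_qparam:
  assumes "x \<in> cone"
  shows "\<exists>r t k. root r \<and> k \<noteq> 0 \<and> sq x = k *s qparam r t"
proof (cases "x $ 1 = 0")
  case True
  \<comment> \<open>A point on the line \<open>u $ 1 = 0\<close> serves as its own centre of
    projection; seen from the other centre on that line it would have parameter infinity.\<close>
  define r where "r = (x$2)\<^sup>2 / (x$3)\<^sup>2"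
  have F: "((x$2)\<^sup>2)\<^sup>2 + ((x$3)\<^sup>2)\<^sup>2 + c * (x$2)\<^sup>2 * (x$3)\<^sup>2 = 0"
    using assms True by (simp add: cone_def qform_def conic_def)
  have x3: "x $ 3 \<noteq> 0" using assms True F by (auto simp: cone_def vec3_eq_iff)
  have r: "r * (x$3)\<^sup>2 = (x$2)\<^sup>2" using x3 by (simp add: r_def)
  have "((x$3)\<^sup>2)\<^sup>2 * (r\<^sup>2 + c * r + 1) = 0" using F r by algebra
  then have root: "root r" using x3 by (simp add: root_def)
  \<comment> \<open>The parameter of the tangent at the centre, where the parametrization passes
    through the centre itself.\<close>
  define t where "t = - (a * r + b) / (2 * r + c)"
  have t: "(a * r + b) + (2 * r + c) * t = 0" using root_simple[OF root] by (simp add: t_def)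
  define B where "B = 1 + a * t + t\<^sup>2"
  have B: "B \<noteq> 0"
  proof
    assume 0: "B = 0"
    have "qparam r t = 0" unfolding vec3_eq_iff qparam_nth B_def[symmetric]
      by (simp only: 0 t mult_zero_right diff_zero minus_zero zero_index simp_thms)
    then show False using qparam_nonzero[OF root] by blast
  qed
  have "sq x = (- (x$3)\<^sup>2 / B) *s qparam r t"
    using t True B r by (simp add: vec3_eq_iff mult.commute flip: B_def)
  moreover have "- (x$3)\<^sup>2 / B \<noteq> 0" using B x3 by simp
  ultimately show ?thesis using root by blast
next
  case False
  then show ?thesis using cone_qparam_root[OF assms] exists_root by blast
qed

lemma sq_eq_in_generic:
  assumes "root r" "sq x = k *s qparam r t" "k \<noteq> 0" "\<And>i. qparam r t $ i \<noteq> 0"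
  shows "x \<in> generic"
proof -
  have "F x = 0" by (simp add: qform_def assms(2) conic_scale conic_qparam[OF assms(1)])
  moreover have "x $ i \<noteq> 0" for i
    using assms(3,4) arg_cong[OF assms(2), of "\<lambda>v. v $ i"] by auto
  ultimately show ?thesis by (simp add: generic_def)
qed

end

section \<open>The residue form and its pull-back\<close>

lemma polyfun_comp:
  assumes "f \<in> polyfun" "polymap g"
  shows "(\<lambda>x. f (g x)) \<in> polyfun"
  using assms(1)
  by (induction rule: polyfun.induct) (use assms(2) in \<open>auto simp: polymap_def intro: polyfun.intros\<close>)

lemma polyfun_cross:
  assumes "polymap f" "polymap g"
  shows "polymap (\<lambda>x. cross (f x) (g x))"
  unfolding polymap_def
proof
  fix k show "(\<lambda>x. cross (f x) (g x) $ k) \<in> polyfun"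
    using assms exhaust_3[of k] by (auto simp: polymap_def intro!: polyfun_intros)
qed

lemma polymap_pjac:
  assumes "polymap g" "polymap v"
  shows "polymap (\<lambda>x. pjac g x *v v x)"
  unfolding polymap_def matrix_vector_mult_def
  using assms pjac(1)[OF assms(1)] by (auto simp: polymap_def intro!: polyfun_intros)

lemma polymap_const: "polymap (\<lambda>_. v)"
  by (auto simp: polymap_def intro: polyfun_intros)

lemma polymap_qgrad: "polymap (qgrad a b c)"
  by (simp add: polymap_def polyfun_qgrad)

lemma tendsto_polymap:
  assumes "polymap f" "(p \<longlongrightarrow> P) F"
  shows "((\<lambda>t. f (p t)) \<longlongrightarrow> f P) F"
proof (rule vec_tendstoI)
  fix i
  have "(\<lambda>x. f x $ i) \<in> polyfun" using assms(1) unfolding polymap_def by blast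
  from tendsto_polyfun[OF this assms(2)]
  show "((\<lambda>t. f (p t) $ i) \<longlongrightarrow> f P $ i) F" .
qed

section \<open>Curves through generic points, and generic points near arbitrary ones\<close>

context smooth_quartic
begin

text \<open>Generic points tending to \<open>P\<close>, where \<open>P\<close> itself may have
  vanishing coordinates.\<close>

definition gen_filter :: "complex^3 \<Rightarrow> (complex^3) filter" where
  "gen_filter P = inf (nhds P) (principal generic)"

lemma gen_filter_tendsto: "((\<lambda>x. x) \<longlongrightarrow> P) (gen_filter P)"
  unfolding gen_filter_def by (simp add: filterlim_def inf.coboundedI1)

lemma eventually_gen_filter_generic: "\<forall>\<^sub>F x in gen_filter P. x \<in> generic"
  unfolding gen_filter_def eventually_inf_principal by simp

text \<open>Square roots of the coordinates lift the parametrized conic to the quartic. Twice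
  \<open>x $ i\<close> times the velocity is \<open>k\<close> times \<open>qparam'\<close>, which
  turns \<open>cross_qparam\<close> into the stated residue of the lifted velocity.\<close>

lemma generic_curve:
  assumes x: "x \<in> generic" and r: "root r" and k: "k \<noteq> 0" and sq: "sq x = k *s qparam r t0"
  shows "\<exists>p v. p t0 = x \<and> curve_deriv p v t0 \<and>
    (\<forall>\<^sub>F t in nhds t0. p t \<in> generic \<and> sq (p t) = k *s qparam r t) \<and>
    cross x v = (k / (4 * (x $ 1 * x $ 2 * x $ 3))) *s dF x"
proof -
  have xi: "x $ i \<noteq> 0" for i using x by (simp add: generic_def)
  have sqi: "(x $ i)\<^sup>2 = k * qparam r t0 $ i" for i using arg_cong[OF sq, of "\<lambda>v. v $ i"] by simp
  have q: "qparam r t0 $ i \<noteq> 0" for i using sqi[of i] xi[of i] by auto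
  \<comment> \<open>The quotients equal 1 at \<open>t0\<close>, away from the branch cut of
    \<open>csqrt\<close>, and the factor \<open>x $ i\<close> makes the lift pass through
    \<open>x\<close>.\<close>
  define p where "p = (\<lambda>t. \<chi> i. x $ i * csqrt (qparam r t $ i / qparam r t0 $ i))"
  define v where "v = (\<chi> i. x $ i * qparam' r t0 $ i / (2 * qparam r t0 $ i))"
  have "p t0 = x" using q by (simp add: p_def vec_eq_iff)
  moreover have "curve_deriv p v t0"
    unfolding curve_deriv_def
  proof
    fix i
    have "((\<lambda>t. csqrt (qparam r t $ i / qparam r t0 $ i)) has_field_derivative
       inverse (2 * csqrt 1) * (qparam' r t0 $ i / qparam r t0 $ i)) (at t0)"
      by (rule DERIV_chain2[where f = csqrt])
        (use q[of i] in \<open>auto intro!: has_field_derivative_csqrt[THEN DERIV_cong] DERIV_cdivide qparam_deriv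
          simp: complex_nonpos_Reals_iff\<close>)
    from DERIV_cmult[OF this, of "x $ i"]
    show "((\<lambda>t. p t $ i) has_field_derivative v $ i) (at t0)"
      by (simp add: p_def v_def field_simps)
  qed
  moreover have sqp: "sq (p t) = k *s qparam r t" for t
    using q sqi by (simp add: p_def vec_eq_iff power_mult_distrib)
  have "\<forall>\<^sub>F t in nhds t0. \<forall>i. qparam r t $ i \<noteq> 0"
  proof (intro eventually_all_finite, rule tendsto_imp_eventually_ne[OF _ q])
    fix i
    show "((\<lambda>t. qparam r t $ i) \<longlongrightarrow> qparam r t0 $ i) (nhds t0)"
      using DERIV_isCont[OF qparam_deriv] by (simp add: tendsto_nhds_iff isCont_def)
  qed
  then have "\<forall>\<^sub>F t in nhds t0. p t \<in> generic \<and> sq (p t) = k *s qparam r t"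
    by eventually_elim (use sqp sq_eq_in_generic[OF r sqp k] in blast)
  moreover have "cross x v = (k / (4 * (x $ 1 * x $ 2 * x $ 3))) *s dF x"
  proof -
    have g: "dF x $ i = 2 * x $ i * k * cross (qparam r t0) (qparam' r t0) $ i" for i
      using exhaust_3[of i] unfolding cross_qparam[OF r] qgrad_def sq
      by (auto simp: algebra_simps simp del: qparam_nth)
    have vi: "v $ i * x $ i = k * qparam' r t0 $ i / 2" for i
      using q[of i] sqi[of i] by (simp add: v_def power2_eq_square field_simps)
    have *: "(2 * x1 * x2 * x3) * (x2 * v3 - x3 * v2) = k * x1 * (k * (q2 * q3' - q3 * q2'))"
      if "x2 * x2 = k * q2" "x3 * x3 = k * q3" "v2 * x2 = k * q2' / 2" "v3 * x3 = k * q3' / 2"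
      for x1 x2 x3 v2 v3 q2 q3 q2' q3' :: complex
    proof -
      have "(2 * x1 * x2 * x3) * (x2 * v3 - x3 * v2)
          = 2 * x1 * ((x2 * x2) * (v3 * x3) - (x3 * x3) * (v2 * x2))" by algebra
      then show ?thesis unfolding that by algebra
    qed
    have sq': "x $ i * x $ i = k * qparam r t0 $ i" for i using sqi by (simp add: power2_eq_square)
    note a = *[OF sq'[of 2] sq'[of 3] vi[of 2] vi[of 3], of "x $ 1"]
      *[OF sq'[of 3] sq'[of 1] vi[of 3] vi[of 1], of "x $ 2"]
      *[OF sq'[of 1] sq'[of 2] vi[of 1] vi[of 2], of "x $ 3"]
    have "(4 * (x $ 1 * x $ 2 * x $ 3)) * cross x v $ i = k * dF x $ i" for i
      unfolding g using exhaust_3[of i] a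
      by (auto simp: mult_ac simp del: qparam_nth)
    then show ?thesis using xi by (simp add: vec_eq_iff field_simps del: cross_nth)
  qed
  ultimately show ?thesis by blast
qed

lemma exists_curve:
  assumes x: "x \<in> generic"
  shows "\<exists>p v t m. p t = x \<and> curve_deriv p v t \<and> (\<forall>\<^sub>F s in nhds t. p s \<in> generic) \<and>
    cross x v = m *s dF x \<and> m \<noteq> 0"
proof -
  obtain r t k where 1: "root r" "k \<noteq> 0" "sq x = k *s qparam r t"
    using cone_qparam x generic_subset by blast
  from generic_curve[OF x this] obtain p v where "p t = x" "curve_deriv p v t"
    "\<forall>\<^sub>F t in nhds t. p t \<in> generic \<and> sq (p t) = k *s qparam r t"
    "cross x v = (k / (4 * (x $ 1 * x $ 2 * x $ 3))) *s dF x" by blast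
  moreover have "k / (4 * (x $ 1 * x $ 2 * x $ 3)) \<noteq> 0"
    using x 1(2) by (simp add: generic_def)
  moreover have "\<forall>\<^sub>F t in nhds t. p t \<in> generic"
    using calculation(3) by eventually_elim blast
  ultimately show ?thesis by blast
qed

text \<open>Square roots of the parametrized conic again approach \<open>P\<close>. At a vanishing
  coordinate a root need not be differentiable, but any root tends to 0.\<close>

lemma generic_dense:
  assumes P: "P \<in> cone"
  shows "gen_filter P \<noteq> bot"
proof -
  obtain r t0 k where r: "root r" and k: "k \<noteq> 0" and sq: "sq P = k *s qparam r t0"
    using cone_qparam[OF P] by blast
  have sqi: "(P $ i)\<^sup>2 = k * qparam r t0 $ i" for i using arg_cong[OF sq, of "\<lambda>v. v $ i"] by simp
  define p where "p = (\<lambda>t. \<chi> i. if P $ i = 0 then csqrt (k * qparam r t $ i)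
     else P $ i * csqrt (qparam r t $ i / qparam r t0 $ i))"
  have "(p t $ i)\<^sup>2 = k * qparam r t $ i" for t i
  proof (cases "P $ i = 0")
    case False
    then have "qparam r t0 $ i \<noteq> 0" using sqi[of i] by auto
    then show ?thesis using False sqi[of i] by (simp add: p_def power_mult_distrib del: qparam_nth)
  qed (simp add: p_def)
  then have sqp: "sq (p t) = k *s qparam r t" for t
    by (simp add: vec_eq_iff del: qparam_nth)
  have cont: "((\<lambda>t. qparam r t $ i) \<longlongrightarrow> qparam r t0 $ i) (at t0)" for i
    using DERIV_isCont[OF qparam_deriv] by (simp add: isCont_def)
  have "(p \<longlongrightarrow> P) (at t0)"
  proof (rule vec_tendstoI)
    fix i
    show "((\<lambda>t. p t $ i) \<longlongrightarrow> P $ i) (at t0)"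
    proof (cases "P $ i = 0")
      case True
      then have q: "qparam r t0 $ i = 0" using sqi[of i] k by auto
      have "((\<lambda>t. sqrt (norm (k * qparam r t $ i))) \<longlongrightarrow> sqrt (norm (k * qparam r t0 $ i))) (at t0)"
        by (intro tendsto_intros cont)
      then have "((\<lambda>t. norm (csqrt (k * qparam r t $ i))) \<longlongrightarrow> 0) (at t0)"
        using q by (simp del: qparam_nth)
      from tendsto_norm_zero_cancel[OF this] show ?thesis using True unfolding p_def
        by (simp del: qparam_nth)
    next
      case False
      then have q: "qparam r t0 $ i \<noteq> 0" using sqi[of i] by auto
      have "((\<lambda>t. qparam r t $ i / qparam r t0 $ i) \<longlongrightarrow> 1) (at t0)"
        using tendsto_divide[OF cont[of i] tendsto_const q] q by simp
      moreover have "isCont csqrt 1"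
        by (rule continuous_at_csqrt) (auto simp: complex_nonpos_Reals_iff)
      ultimately have "((\<lambda>t. csqrt (qparam r t $ i / qparam r t0 $ i)) \<longlongrightarrow> csqrt 1) (at t0)"
        by (rule isCont_tendsto_compose[rotated])
      from tendsto_mult_left[OF this, of "P $ i"] show ?thesis
        using False by (simp add: p_def)
    qed
  qed
  moreover have "\<forall>\<^sub>F t in at t0. p t \<in> generic"
  proof -
    have "finite (\<Union>i. {t. qparam r t $ i = 0})"
      using finite_qparam_zeros[OF r] by auto
    then have "\<forall>\<^sub>F t in at t0. t \<notin> (\<Union>i. {t. qparam r t $ i = 0})"
      using islimpt_finite[of _ t0] islimpt_iff_eventually by blast
    then show ?thesis
      by eventually_elim (rule sq_eq_in_generic[OF r sqp k], auto simp del: qparam_nth)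
  qed
  ultimately have "filterlim p (gen_filter P) (at t0)"
    unfolding gen_filter_def by (simp add: filterlim_inf filterlim_principal)
  then show ?thesis using trivial_limit_at[of t0]
    unfolding filterlim_def by (metis filtermap_bot_iff bot.extremum_uniqueI trivial_limit_def)
qed

end

text \<open>A regular map between two quartics as a set of homogeneous polynomial lifts. They may
  have different degrees and vanish at points of the cone; only proportionality at common nonzeros
  ties them together.\<close>

locale regular_rep = X: smooth_quartic a b c + Y: smooth_quartic a' b' c'
  for a b c a' b' c' :: complex +
  fixes rep :: "(complex^3 \<Rightarrow> complex^3) set"
  assumes polymap_rep: "g \<in> rep \<Longrightarrow> polymap g"
    and homogeneous_rep: "g \<in> rep \<Longrightarrow> \<exists>d. homogeneous d g"
    and rep_cover: "x \<in> X.cone \<Longrightarrow> \<exists>g\<in>rep. g x \<noteq> 0"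
    and rep_maps: "g \<in> rep \<Longrightarrow> x \<in> X.cone \<Longrightarrow> g x \<noteq> 0 \<Longrightarrow> Y.F (g x) = 0"
    and rep_consistent: "g \<in> rep \<Longrightarrow> g' \<in> rep \<Longrightarrow> x \<in> X.cone \<Longrightarrow> g x \<noteq> 0 \<Longrightarrow> g' x \<noteq> 0 \<Longrightarrow>
      \<exists>k. k \<noteq> 0 \<and> g' x = k *s g x"
begin

(* With x \<times> v = l dF(x), the number l is the value at v of the residue form on the curve;
   h compares it with the pull-back of the residue form of the target. *)
definition twist :: "(complex^3 \<Rightarrow> complex^3) \<Rightarrow> complex^3 \<Rightarrow> complex \<Rightarrow> bool" where
  "twist g x h \<longleftrightarrow> (\<forall>v l. cross x v = l *s X.dF x \<longrightarrow>
     cross (g x) (pjac g x *v v) = (h * l) *s Y.dF (g x))"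

lemma dF_nonzero: "x \<in> X.cone \<Longrightarrow> X.dF x \<noteq> 0"
  using X.smooth by (simp add: X.cone_def)

lemma rep_dF_nonzero: "g \<in> rep \<Longrightarrow> x \<in> X.cone \<Longrightarrow> g x \<noteq> 0 \<Longrightarrow> Y.dF (g x) \<noteq> 0"
  using Y.smooth rep_maps by blast

text \<open>Modulo \<open>x\<close> the vectors \<open>v\<close> with \<open>cross x v\<close>
  proportional to the gradient form a line, and Euler's identity sends \<open>x\<close> to a
  multiple of \<open>g x\<close>, which the cross product ignores. One vector \<open>v0\<close> with
  nonzero residue therefore decides.\<close>

lemma twist_extend:
  assumes g: "g \<in> rep" and x: "x \<noteq> 0" and v0: "cross x v0 = m *s X.dF x" "m \<noteq> 0"
    and eq: "cross (g x) (pjac g x *v v0) = (h * m) *s Y.dF (g x)"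
  shows "twist g x h"
  unfolding twist_def
proof (intro allI impI)
  fix v l assume v: "cross x v = l *s X.dF x"
  obtain d where d: "homogeneous d g" using homogeneous_rep[OF g] by blast
  have "cross x (v - (l / m) *s v0) = 0"
    using v v0 by (simp add: vec3_eq_iff field_simps)
  then obtain k where "v - (l / m) *s v0 = k *s x" using parallel_if_cross_eq_0 x by blast
  then have v': "v = (l / m) *s v0 + k *s x" by (simp add: algebra_simps)
  have "pjac g x *v v = (l / m) *s (pjac g x *v v0) + (k * of_nat d) *s g x"
    using euler[OF polymap_rep[OF g] d] unfolding v'
    by (simp add: matrix_vector_right_distrib vec.scale)
  then have "cross (g x) (pjac g x *v v) = (l / m) *s cross (g x) (pjac g x *v v0)"
    by (simp add: cross_add_right cross_scale_right)
  then show "cross (g x) (pjac g x *v v) = (h * l) *s Y.dF (g x)"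
    using v0(2) by (simp add: eq)
qed

lemma rep_curve:
  assumes g: "g \<in> rep" and gx: "g (p t) \<noteq> 0"
    and p: "curve_deriv p v t" "\<forall>\<^sub>F s in nhds t. p s \<in> X.generic"
  shows "curve_deriv (\<lambda>s. g (p s)) (pjac g (p t) *v v) t"
    and "\<forall>\<^sub>F s in nhds t. g (p s) \<noteq> 0 \<and> Y.F (g (p s)) = 0"
proof -
  show d: "curve_deriv (\<lambda>s. g (p s)) (pjac g (p t) *v v) t"
    using pjac(2)[OF polymap_rep[OF g] p(1)] .
  have "\<forall>\<^sub>F s in nhds t. g (p s) \<noteq> 0"
    using tendsto_imp_eventually_ne[OF curve_deriv_tendsto[OF d] gx] .
  with p(2) show "\<forall>\<^sub>F s in nhds t. g (p s) \<noteq> 0 \<and> Y.F (g (p s)) = 0"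
    by eventually_elim (use rep_maps[OF g] X.generic_subset in blast)
qed

text \<open>The image of a curve through \<open>x\<close> stays on the target, so \<open>g x\<close>
  and the image velocity are both orthogonal to the gradient there, and their cross product is a
  multiple of it.\<close>

lemma twist_exists:
  assumes x: "x \<in> X.generic" and g: "g \<in> rep" and gx: "g x \<noteq> 0"
  shows "\<exists>h. twist g x h"
proof -
  obtain p v t m where p: "p t = x" "curve_deriv p v t" "\<forall>\<^sub>F s in nhds t. p s \<in> X.generic"
      "cross x v = m *s X.dF x" "m \<noteq> 0"
    using X.exists_curve[OF x] by blast
  have gp: "g (p t) \<noteq> 0" using gx p(1) by simp
  note c = rep_curve[OF g gp p(2,3)]
  have "((\<lambda>s. Y.F (g (p s))) has_field_derivative dot (Y.dF (g (p t))) (pjac g (p t) *v v)) (at t)"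
    by (rule qform_deriv[OF c(1)])
  moreover have "((\<lambda>s. Y.F (g (p s))) has_field_derivative 0) (at t)"
    by (rule DERIV_cong_ev[OF refl _ refl, THEN iffD1, OF _ DERIV_const[of 0]])
      (use c(2) in \<open>auto elim: eventually_mono\<close>)
  ultimately have o1: "dot (Y.dF (g x)) (pjac g x *v v) = 0" using DERIV_unique p(1) by blast
  have xc: "x \<in> X.cone" using x X.generic_subset by blast
  have o2: "dot (Y.dF (g x)) (g x) = 0"
    using dot_qgrad rep_maps[OF g xc gx] by simp
  obtain n where "cross (g x) (pjac g x *v v) = n *s Y.dF (g x)"
    using cross_eq_scale_if_orthogonal[OF o2 o1 rep_dF_nonzero[OF g xc gx]] by blast
  then have "cross (g x) (pjac g x *v v) = (n / m * m) *s Y.dF (g x)" using p(5) by simp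
  from twist_extend[OF g _ p(4,5) this] xc show ?thesis by (auto simp: X.cone_def)
qed

text \<open>If \<open>g' x = k *s g x\<close>, the cross product changes by k^2 and the gradient by
  k^3, so \<open>h' = h / k\<close>, which cancels against the change of the lift.\<close>

lemma twist_consistent:
  assumes x: "x \<in> X.generic" and g: "g \<in> rep" "g x \<noteq> 0" "twist g x h"
    and g': "g' \<in> rep" "g' x \<noteq> 0" "twist g' x h'"
  shows "h' *s g' x = h *s g x"
proof -
  obtain p v t m where p: "p t = x" "curve_deriv p v t" "\<forall>\<^sub>F s in nhds t. p s \<in> X.generic"
      "cross x v = m *s X.dF x" "m \<noteq> 0"
    using X.exists_curve[OF x] by blast
  have gp: "g (p t) \<noteq> 0" "g' (p t) \<noteq> 0" using g g' p(1) by simp_all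
  note c = rep_curve[OF g(1) gp(1) p(2,3)] and c' = rep_curve[OF g'(1) gp(2) p(2,3)]
  define v1 v2 where "v1 = pjac g x *v v" and "v2 = pjac g' x *v v"
  have "\<forall>\<^sub>F s in nhds t. \<exists>l. g' (p s) = l *s g (p s)"
    using c(2) c'(2) p(3)
    by eventually_elim (use rep_consistent[OF g(1) g'(1)] X.generic_subset in blast)
  from cross_curve_multiple[OF c(1) c'(1) gp(1) this] obtain k
    where gx: "g' x = k *s g x" and cr: "cross (g' x) v2 = k\<^sup>2 *s cross (g x) v1"
    unfolding p(1) v1_def v2_def by blast
  have kt: "k \<noteq> 0" using gx g'(2) by auto
  have "(h' * m) *s Y.dF (g' x) = cross (g' x) v2"
    using g'(3) p(4) unfolding twist_def v2_def by metis
  also note cr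
  also have "cross (g x) v1 = (h * m) *s Y.dF (g x)"
    using g(3) p(4) unfolding twist_def v1_def by blast
  finally have "(h' * m * k ^ 3) *s Y.dF (g x) = (k\<^sup>2 * (h * m)) *s Y.dF (g x)"
    unfolding gx qgrad_scale by simp
  moreover have "Y.dF (g x) \<noteq> 0" using rep_dF_nonzero g x X.generic_subset by blast
  ultimately have "h' * m * k ^ 3 = k\<^sup>2 * (h * m)" using vec.scale_cancel_right by blast
  then have "(m * k\<^sup>2) * (h' * k) = (m * k\<^sup>2) * h"
    by (simp add: power2_eq_square power3_eq_cube mult_ac)
  then have "h' * k = h" using kt p(5) by simp
  then show ?thesis unfolding gx by simp
qed

text \<open>Its coordinate \<open>i\<close> is the pull-back of the differential given by coordinate
  \<open>i\<close> times the residue form of the target, divided by the residue form of the source.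
  By \<open>twist_consistent\<close> the choice is irrelevant at generic points.\<close>

definition sect :: "complex^3 \<Rightarrow> complex^3" where
  "sect x = (SOME s. \<exists>g\<in>rep. \<exists>h. g x \<noteq> 0 \<and> twist g x h \<and> s = h *s g x)"

lemma sect_eq:
  assumes "x \<in> X.generic" "g \<in> rep" "g x \<noteq> 0" "twist g x h"
  shows "sect x = h *s g x"
proof -
  have "\<exists>g\<in>rep. \<exists>h. g x \<noteq> 0 \<and> twist g x h \<and> sect x = h *s g x"
    unfolding sect_def by (rule someI[where x = "h *s g x"]) (use assms in blast)
  then show ?thesis using twist_consistent assms by metis
qed

text \<open>Whatever the degree \<open>d\<close> of the lift, \<open>h\<close> has weight
  \<open>1 - d\<close>, so \<open>h *s g x\<close> has weight 1 and is a section of O(1).\<close>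

lemma sect_scale:
  assumes x: "x \<in> X.generic" and k: "k \<noteq> 0"
  shows "sect (k *s x) = k *s sect x"
proof -
  obtain g where g: "g \<in> rep" "g x \<noteq> 0" using rep_cover x X.generic_subset by blast
  obtain d where d: "homogeneous d g" using homogeneous_rep[OF g(1)] by blast
  obtain h where h: "twist g x h" using twist_exists[OF x g] by blast
  have gk: "g (k *s x) = k ^ d *s g x" using d by (simp add: homogeneous_def)
  have "twist g (k *s x) (h * k / k ^ d)"
    unfolding twist_def
  proof (intro allI impI)
    fix v l assume "cross (k *s x) v = l *s X.dF (k *s x)"
    moreover have "v = k *s ((1 / k) *s v)" using k by simp
    ultimately have "(k * k) *s cross x ((1 / k) *s v) = (l * k ^ 3) *s X.dF x"
      by (metis cross_scale qgrad_scale vector_smult_assoc)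
    then have "(k * k) *s cross x ((1 / k) *s v) = (k * k) *s ((l * k) *s X.dF x)"
      by (simp add: power3_eq_cube mult_ac)
    then have "cross x ((1 / k) *s v) = (l * k) *s X.dF x"
      using k vec.scale_cancel_left by (metis mult_eq_0_iff)
    then have "cross (g x) (pjac g x *v ((1 / k) *s v)) = (h * (l * k)) *s Y.dF (g x)"
      using h unfolding twist_def by blast
    moreover have "pjac g (k *s x) *v v = k ^ d *s (pjac g x *v ((1 / k) *s v))"
      using pjac_homogeneous[OF polymap_rep[OF g(1)] d, of k x "(1 / k) *s v"] k by simp
    ultimately show "cross (g (k *s x)) (pjac g (k *s x) *v v)
        = (h * k / k ^ d * l) *s Y.dF (g (k *s x))"
      using k unfolding gk qgrad_scale by (simp add: cross_scale power3_eq_cube mult_ac)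
  qed
  moreover have "g (k *s x) \<noteq> 0" using gk g(2) k by (simp add: vec_eq_iff)
  ultimately have "sect (k *s x) = (h * k / k ^ d) *s g (k *s x)"
    using sect_eq X.generic_scale[OF x k] g(1) by blast
  then show ?thesis unfolding gk sect_eq[OF x g h] using k by simp
qed

lemma cross_tangent: "X.F x = 0 \<Longrightarrow> cross x (cross (X.dF x) w) = dot x w *s X.dF x"
  using dot_qgrad[of a b c x] unfolding cross_cross_right by (simp add: dot_def mult.commute)

text \<open>Along a polynomial tangent field the equation defining \<open>twist\<close> can be
  solved for \<open>h\<close> in a component where the target gradient is nonzero at
  \<open>P\<close>.\<close>

lemma twist_regular:
  assumes P: "P \<in> X.cone" and g: "g \<in> rep" "g P \<noteq> 0"
  shows "\<exists>n\<in>polyfun. \<exists>d\<in>polyfun. d P \<noteq> 0 \<and> (\<forall>\<^sub>F x in X.gen_filter P. twist g x (n x / d x))"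
proof -
  obtain k where k: "Y.dF (g P) $ k \<noteq> 0"
    using rep_dF_nonzero[OF g(1) P g(2)] by (auto simp: vec_eq_iff)
  obtain i where i: "P $ i \<noteq> 0" using P by (auto simp: X.cone_def vec_eq_iff)
  \<comment> \<open>By \<open>cross_tangent\<close> this field has residue \<open>x $ i\<close>,
    which is nonzero at \<open>P\<close>.\<close>
  define v where "v = (\<lambda>x. cross (X.dF x) (axis i 1))"
  define w where "w = (\<lambda>x. cross (g x) (pjac g x *v v x))"
  define d where "d = (\<lambda>x. x $ i * Y.dF (g x) $ k)"
  note pg = polymap_rep[OF g(1)]
  have "polymap w" unfolding w_def v_def
    by (intro polyfun_cross polymap_pjac pg polymap_const polymap_qgrad)
  then have "(\<lambda>x. w x $ k) \<in> polyfun" unfolding polymap_def by blast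
  moreover have d: "d \<in> polyfun" unfolding d_def
    by (intro polyfun.intros polyfun_comp[OF polyfun_qgrad pg])
  moreover have dP: "d P \<noteq> 0" using i k by (simp add: d_def)
  moreover have "\<forall>\<^sub>F x in X.gen_filter P. d x \<noteq> 0"
    by (rule tendsto_imp_eventually_ne[OF tendsto_polyfun[OF d X.gen_filter_tendsto] dP])
  then have "\<forall>\<^sub>F x in X.gen_filter P. twist g x (w x $ k / d x)"
    using X.eventually_gen_filter_generic
      tendsto_imp_eventually_ne[OF tendsto_polymap[OF pg X.gen_filter_tendsto] g(2)]
  proof eventually_elim
    case (elim x)
    obtain h where h: "twist g x h" using twist_exists elim g(1) by blast
    have "dot x (axis i 1) = x $ i"
      using exhaust_3[of i] by (auto simp: dot_def axis_def)
    then have "cross x (v x) = x $ i *s X.dF x"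
      using cross_tangent elim(2) unfolding v_def by (simp add: X.generic_def)
    then have "w x = (h * x $ i) *s Y.dF (g x)" using h unfolding twist_def w_def by blast
    then have "w x $ k = h * d x" by (simp add: d_def)
    then show ?case using h elim(1) by simp
  qed
  ultimately show ?thesis
    by (intro bexI[of _ "\<lambda>x. w x $ k"] bexI[of _ d] conjI)
qed

end

section \<open>Regular sections of O(1)\<close>

lemma holomorphic_extend_finite:
  assumes "finite E" "f holomorphic_on - E" "\<And>z. z \<notin> E \<Longrightarrow> norm (f z) \<le> B"
  shows "\<exists>g. g holomorphic_on UNIV \<and> (\<forall>z. z \<notin> E \<longrightarrow> g z = f z)"
  using assms
proof (induction E arbitrary: f B rule: finite_induct)
  case empty
  then show ?case by (intro exI[of _ f]) simp
next
  case (insert e E)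
  have op: "open (- E)" using insert.hyps(1) by (simp add: finite_imp_closed open_Compl)
  have eq: "- insert e E = - E - {e}" by blast
  have "f holomorphic_on - E - {e}" using insert.prems(1) eq by simp
  moreover have "e \<in> interior (- E)" using op insert.hyps(2) by (simp add: interior_open)
  moreover have "\<forall>\<^sub>F z in at e. norm (f z) \<le> B"
  proof -
    have "\<forall>\<^sub>F z in at e. z \<in> - E - {e}"
      using op insert.hyps(2) by (intro eventually_at_in_open) auto
    then show ?thesis by eventually_elim (use insert.prems(2) in auto)
  qed
  ultimately obtain g where g: "g holomorphic_on - E" "\<And>z. z \<in> - E - {e} \<Longrightarrow> g z = f z"
    using holomorphic_on_extend_bounded by blast
  \<comment> \<open>The value at the filled-in point is not controlled by \<open>B\<close>, so the
    bound is enlarged before the next point is removed.\<close>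
  have "norm (g z) \<le> max B (norm (g e))" if "z \<notin> E" for z
    using that g(2)[of z] insert.prems(2)[of z] by (cases "z = e") auto
  from insert.IH[OF g(1) this] show ?case using g(2) by auto
qed

lemma Liouville_finite:
  assumes "finite E" "f holomorphic_on - E" "\<And>z. z \<notin> E \<Longrightarrow> norm (f z) \<le> B"
  shows "\<exists>k. \<forall>z. z \<notin> E \<longrightarrow> f z = k"
proof -
  obtain g where g: "g holomorphic_on UNIV" "\<And>z. z \<notin> E \<Longrightarrow> g z = f z"
    using holomorphic_extend_finite[OF assms] by blast
  have "range g \<subseteq> cball 0 B \<union> g ` E" using assms(3) g(2) by fastforce
  then have "bounded (range g)"
    using bounded_subset assms(1) by (metis bounded_Un bounded_cball finite_imageI finite_imp_bounded)
  from Liouville_theorem[OF g(1) this] show ?thesis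
    using g(2) unfolding constant_on_def by (metis UNIV_I)
qed

lemma flip_nth: "flip i x $ j = (if j = i then - x $ j else x $ j)"
  by (simp add: flip_def)

lemma flip_flip [simp]: "flip i (flip i x) = x"
  by (simp add: vec_eq_iff flip_nth)

lemma sq_flip [simp]: "sq (flip i x) = sq x"
  by (simp add: vec_eq_iff flip_nth)

lemma flip_commute: "flip i (flip j x) = flip j (flip i x)"
  by (simp add: vec_eq_iff flip_nth)

lemma flip_scale: "flip i (k *s x) = k *s flip i x"
  by (simp add: vec_eq_iff flip_nth)

lemma flip_fixed: "x $ i = 0 \<Longrightarrow> flip i x = x"
  by (auto simp: vec_eq_iff flip_nth)

lemma tendsto_flip: "((\<lambda>x. flip i x) \<longlongrightarrow> flip i P) (nhds P)"
proof (rule tendsto_polymap[OF _ filterlim_ident])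
  have "(\<lambda>x. flip i x $ k) \<in> polyfun" for k
    by (cases "k = i") (simp_all add: flip_nth polyfun_intros)
  then show "polymap (flip i)" unfolding polymap_def by blast
qed

context smooth_quartic
begin

lemma flip_cone: "x \<in> cone \<Longrightarrow> flip i x \<in> cone"
proof -
  assume "x \<in> cone"
  moreover from this have "flip i x \<noteq> 0" unfolding cone_def
    by (auto simp: vec_eq_iff flip_nth)
  ultimately show ?thesis by (simp add: cone_def qform_def)
qed

lemma flip_generic: "x \<in> generic \<Longrightarrow> flip i x \<in> generic"
  by (simp add: generic_def qform_def flip_nth)

lemma filterlim_flip: "filterlim (flip i) (gen_filter (flip i P)) (gen_filter P)"
proof -
  have "filterlim (flip i) (nhds (flip i P)) (gen_filter P)"
    unfolding gen_filter_def by (rule filterlim_mono[OF tendsto_flip order_refl inf.cobounded1])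
  moreover have "\<forall>\<^sub>F x in gen_filter P. flip i x \<in> generic"
    using eventually_gen_filter_generic by (rule eventually_mono) (rule flip_generic)
  ultimately show ?thesis
    unfolding gen_filter_def[of "flip i P"] filterlim_inf filterlim_principal by blast
qed

text \<open>Regularity of a germ at \<open>P\<close>: the values of \<open>f\<close> at nongeneric
  points, possibly including \<open>P\<close>, do not matter.\<close>

definition ratl :: "complex^3 \<Rightarrow> (complex^3 \<Rightarrow> complex) \<Rightarrow> bool" where
  "ratl P f \<longleftrightarrow> (\<exists>n\<in>polyfun. \<exists>d\<in>polyfun. d P \<noteq> 0 \<and> (\<forall>\<^sub>F x in gen_filter P. f x = n x / d x))"

lemma ratlI:
  "n \<in> polyfun \<Longrightarrow> d \<in> polyfun \<Longrightarrow> d P \<noteq> 0 \<Longrightarrow> \<forall>\<^sub>F x in gen_filter P. f x = n x / d x \<Longrightarrow> ratl P f"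
  unfolding ratl_def by blast

lemma polyfun_eventually_nonzero:
  "d \<in> polyfun \<Longrightarrow> d P \<noteq> 0 \<Longrightarrow> \<forall>\<^sub>F x in gen_filter P. d x \<noteq> 0"
  by (rule tendsto_imp_eventually_ne[OF tendsto_polyfun[OF _ gen_filter_tendsto]])

lemma ratlE:
  assumes "ratl P f"
  obtains n d where "n \<in> polyfun" "d \<in> polyfun" "d P \<noteq> 0" "\<forall>\<^sub>F x in gen_filter P. f x = n x / d x"
  using assms unfolding ratl_def by blast

lemma ratl_cong:
  assumes "ratl P g" "\<And>x. x \<in> generic \<Longrightarrow> f x = g x"
  shows "ratl P f"
  using assms(1)
proof (rule ratlE)
  fix n d assume nd: "n \<in> polyfun" "d \<in> polyfun" "d P \<noteq> 0" "\<forall>\<^sub>F x in gen_filter P. g x = n x / d x"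
  from nd(4) eventually_gen_filter_generic have "\<forall>\<^sub>F x in gen_filter P. f x = n x / d x"
    by eventually_elim (simp only: assms(2))
  with nd(1-3) show ?thesis by (rule ratlI)
qed

lemma ratl_tendsto: "ratl P f \<Longrightarrow> \<exists>l. (f \<longlongrightarrow> l) (gen_filter P)"
proof -
  assume "ratl P f"
  then obtain n d where nd: "n \<in> polyfun" "d \<in> polyfun" "d P \<noteq> 0"
    "\<forall>\<^sub>F x in gen_filter P. f x = n x / d x" unfolding ratl_def by blast
  have "((\<lambda>x. n x / d x) \<longlongrightarrow> n P / d P) (gen_filter P)"
    by (rule tendsto_divide[OF tendsto_polyfun[OF nd(1) gen_filter_tendsto]
          tendsto_polyfun[OF nd(2) gen_filter_tendsto] nd(3)])
  then show ?thesis using tendsto_cong[OF nd(4)] by blast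
qed

lemma ratl_polyfun: "f \<in> polyfun \<Longrightarrow> ratl P f"
  by (rule ratlI[of _ "\<lambda>_. 1"]) (auto intro: polyfun.intros)

lemma ratl_inverse:
  assumes "P $ i \<noteq> 0" shows "ratl P (\<lambda>x. 1 / x $ i)"
  by (rule ratlI[of "\<lambda>_. 1" "\<lambda>x. x $ i"]) (use assms in \<open>auto intro: polyfun.intros\<close>)

lemma ratl_add:
  assumes "ratl P f" "ratl P g" shows "ratl P (\<lambda>x. f x + g x)"
proof -
  obtain n d where nd: "n \<in> polyfun" "d \<in> polyfun" "d P \<noteq> 0"
    "\<forall>\<^sub>F x in gen_filter P. f x = n x / d x" using assms(1) by (rule ratlE)
  obtain m e where me: "m \<in> polyfun" "e \<in> polyfun" "e P \<noteq> 0"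
    "\<forall>\<^sub>F x in gen_filter P. g x = m x / e x" using assms(2) unfolding ratl_def by blast
  show ?thesis
  proof (rule ratlI[of "\<lambda>x. n x * e x + m x * d x" "\<lambda>x. d x * e x"])
    show "\<forall>\<^sub>F x in gen_filter P. f x + g x = (n x * e x + m x * d x) / (d x * e x)"
      using nd(4) me(4) polyfun_eventually_nonzero[OF nd(2,3)] polyfun_eventually_nonzero[OF me(2,3)]
      by eventually_elim (simp add: field_simps)
  qed (use nd me in \<open>auto intro: polyfun.intros\<close>)
qed

lemma ratl_mult:
  assumes "ratl P f" "ratl P g" shows "ratl P (\<lambda>x. f x * g x)"
proof -
  obtain n d where nd: "n \<in> polyfun" "d \<in> polyfun" "d P \<noteq> 0"
    "\<forall>\<^sub>F x in gen_filter P. f x = n x / d x" using assms(1) by (rule ratlE)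
  obtain m e where me: "m \<in> polyfun" "e \<in> polyfun" "e P \<noteq> 0"
    "\<forall>\<^sub>F x in gen_filter P. g x = m x / e x" using assms(2) unfolding ratl_def by blast
  show ?thesis
  proof (rule ratlI[of "\<lambda>x. n x * m x" "\<lambda>x. d x * e x"])
    show "\<forall>\<^sub>F x in gen_filter P. f x * g x = (n x * m x) / (d x * e x)"
      using nd(4) me(4) by eventually_elim simp
  qed (use nd me in \<open>auto intro: polyfun.intros\<close>)
qed

lemma ratl_flip:
  assumes "ratl (flip i P) f" shows "ratl P (\<lambda>x. f (flip i x))"
proof -
  obtain n d where nd: "n \<in> polyfun" "d \<in> polyfun" "d (flip i P) \<noteq> 0"
    "\<forall>\<^sub>F x in gen_filter (flip i P). f x = n x / d x" using assms(1) unfolding ratl_def by blast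
  show ?thesis
    by (rule ratlI[of "\<lambda>x. n (flip i x)" "\<lambda>x. d (flip i x)"])
      (use nd eventually_compose_filterlim[OF nd(4) filterlim_flip] in \<open>auto intro: polyfun_flip\<close>)
qed

lemma ratl_diff:
  assumes "ratl P f" "ratl P g" shows "ratl P (\<lambda>x. f x - g x)"
  using ratl_add[OF assms(1) ratl_mult[OF ratl_polyfun[OF polyfun.const[of "-1"]] assms(2)]] by simp

text \<open>Twice the part of \<open>s\<close> that is odd in coordinate \<open>i\<close>, divided
  by that coordinate.\<close>

definition slope :: "3 \<Rightarrow> (complex^3 \<Rightarrow> complex) \<Rightarrow> complex^3 \<Rightarrow> complex" where
  "slope i s x = (s x - s (flip i x)) / x $ i"

text \<open>Where \<open>P $ i = 0\<close> the flip fixes \<open>P\<close>, so \<open>d\<close> and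
  its flip are both nonzero there. Over the common denominator the numerator is
  \<open>f x - f (flip i x)\<close> with \<open>f x = n x * d (flip i x)\<close>, hence divisible by
  \<open>x $ i\<close>.\<close>

lemma ratl_slope:
  assumes "\<And>P. P \<in> cone \<Longrightarrow> ratl P s" "P \<in> cone"
  shows "ratl P (slope i s)"
proof (cases "P $ i = 0")
  case False
  have "ratl P (\<lambda>x. (s x - s (flip i x)) * (1 / x $ i))"
    by (intro ratl_mult ratl_diff ratl_flip ratl_inverse assms flip_cone False)
  then show ?thesis by (simp add: slope_def[abs_def])
next
  case True
  obtain n d where nd: "n \<in> polyfun" "d \<in> polyfun" "d P \<noteq> 0"
    "\<forall>\<^sub>F x in gen_filter P. s x = n x / d x" using assms unfolding ratl_def by blast
  have fP: "flip i P = P" using True by (rule flip_fixed)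
  have ev: "\<forall>\<^sub>F x in gen_filter P. s (flip i x) = n (flip i x) / d (flip i x)"
    using eventually_compose_filterlim[OF _ filterlim_flip, where P = "\<lambda>x. s x = n x / d x"] nd(4) fP
    by simp
  have nz: "\<forall>\<^sub>F x in gen_filter P. d (flip i x) \<noteq> 0"
    by (rule polyfun_eventually_nonzero) (use nd fP in \<open>auto intro: polyfun_flip\<close>)
  have "(\<lambda>x. n x * d (flip i x)) \<in> polyfun" by (intro polyfun.intros polyfun_flip nd)
  from polyfun_flip_diff[OF this, of i] obtain E where E: "E \<in> polyfun"
    "\<And>x. n x * d (flip i x) - n (flip i x) * d x = x $ i * E x" by auto
  show ?thesis
  proof (rule ratlI[of E "\<lambda>x. d x * d (flip i x)"])
    show "\<forall>\<^sub>F x in gen_filter P. slope i s x = E x / (d x * d (flip i x))"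
      using nd(4) ev nz polyfun_eventually_nonzero[OF nd(2,3)] eventually_gen_filter_generic
    proof eventually_elim
      case (elim x)
      then have "x $ i \<noteq> 0" by (simp add: generic_def)
      then have "E x = (n x * d (flip i x) - n (flip i x) * d x) / x $ i" using E(2) by simp
      then show ?case using elim \<open>x $ i \<noteq> 0\<close> unfolding slope_def by (simp add: field_simps)
    qed
  qed (use nd E fP in \<open>auto intro: polyfun.intros polyfun_flip\<close>)
qed

text \<open>Degree 0 permits normalising to the unit sphere. There an unbounded sequence would
  accumulate at a point of the cone, where \<open>f\<close> has a limit along generic
  points.\<close>

lemma generic_bounded:
  assumes conv: "\<And>P. P \<in> cone \<Longrightarrow> ratl P f"
    and inv: "\<And>x k. x \<in> generic \<Longrightarrow> k \<noteq> 0 \<Longrightarrow> f (k *s x) = f x"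
  shows "\<exists>B. \<forall>x\<in>generic. norm (f x) \<le> B"
proof (rule ccontr)
  assume "\<not> ?thesis"
  then have "\<forall>n. \<exists>x\<in>generic. norm (f x) > real n" by (meson not_le)
  then obtain X where X: "\<And>n. X n \<in> generic" "\<And>n. norm (f (X n)) > real n" by metis
  have X0: "X n \<noteq> 0" for n using X(1)[of n] by (auto simp: generic_def vec_eq_iff)
  define Y where "Y = (\<lambda>n. complex_of_real (1 / norm (X n)) *s X n)"
  have Yg: "Y n \<in> generic" for n unfolding Y_def by (rule generic_scale[OF X(1)]) (simp add: X0)
  have Yf: "norm (f (Y n)) > real n" for n
    unfolding Y_def using inv[OF X(1)] X0 X(2) by simp
  have "Y n = (1 / norm (X n)) *\<^sub>R X n" for n
    unfolding vec_eq_iff vector_scaleR_component Y_def vector_smult_component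
    by (simp add: scaleR_conv_of_real)
  then have "norm (Y n) = 1" for n using X0 by simp
  moreover have "compact (sphere (0 :: complex^3) 1)" by simp
  ultimately obtain P r where P: "P \<in> sphere 0 1" "strict_mono r" "(Y \<circ> r) \<longlonglongrightarrow> P"
    unfolding compact_def by (metis dist_0_norm mem_sphere)
  have "(\<lambda>n. F ((Y \<circ> r) n)) \<longlonglongrightarrow> F P" by (rule tendsto_polyfun[OF polyfun_qform P(3)])
  moreover have "F ((Y \<circ> r) n) = 0" for n using Yg by (simp add: generic_def)
  ultimately have "F P = 0" by (simp add: LIMSEQ_const_iff)
  then have "P \<in> cone" using P(1) by (auto simp: cone_def)
  from ratl_tendsto[OF conv[OF this]] obtain l where l: "(f \<longlongrightarrow> l) (gen_filter P)" by blast
  have "filterlim (Y \<circ> r) (gen_filter P) sequentially"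
    unfolding gen_filter_def using P(3) Yg by (simp add: filterlim_inf filterlim_principal o_def)
  from filterlim_compose[OF l this] have "(\<lambda>n. norm (f ((Y \<circ> r) n))) \<longlonglongrightarrow> norm l"
    by (rule tendsto_norm)
  then have "\<forall>\<^sub>F n in sequentially. norm (f ((Y \<circ> r) n)) < norm l + 1"
    by (rule order_tendstoD) simp
  moreover have "\<forall>\<^sub>F n in sequentially. real n > norm l + 1"
    using filterlim_real_sequentially unfolding filterlim_at_top_dense by blast
  ultimately have "\<forall>\<^sub>F n in sequentially. False"
  proof eventually_elim
    case (elim n)
    have "real n \<le> real (r n)" using seq_suble[OF P(2)] by simp
    also have "\<dots> < norm (f ((Y \<circ> r) n))" using Yf by simp
    finally show ?case using elim by simp
  qed
  then show False by simp
qed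

text \<open>Invariance makes \<open>f\<close> a function of the parameter \<open>t\<close> alone,
  holomorphic off a finite set and bounded.\<close>

lemma regular_function_constant:
  assumes conv: "\<And>P. P \<in> cone \<Longrightarrow> ratl P f"
    and inv: "\<And>x y k. x \<in> generic \<Longrightarrow> y \<in> generic \<Longrightarrow> sq y = k *s sq x \<Longrightarrow> f y = f x"
  shows "\<exists>k. \<forall>x\<in>generic. f x = k"
proof -
  have inv': "f (k *s x) = f x" if "x \<in> generic" "k \<noteq> 0" for x k
    by (rule inv[OF that(1) generic_scale[OF that], of "k\<^sup>2"]) (simp add: vec_eq_iff power_mult_distrib)
  obtain B where B: "\<And>x. x \<in> generic \<Longrightarrow> norm (f x) \<le> B"
    using generic_bounded[OF conv inv'] by blast
  obtain r where r: "root r" using exists_root by blast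
  define E where "E = (\<Union>i. {t. qparam r t $ i = 0})"
  have E: "finite E" unfolding E_def using finite_qparam_zeros[OF r] by auto
  \<comment> \<open>These roots jump across branch cuts. Since \<open>f\<close> does not see the
    choice of roots, the holomorphic lifts of \<open>generic_curve\<close> may replace them
    locally.\<close>
  define p0 where "p0 = (\<lambda>t. \<chi> i. csqrt (qparam r t $ i))"
  have sq0: "sq (p0 t) = 1 *s qparam r t" for t by (simp add: p0_def vec_eq_iff)
  have p0: "p0 t \<in> generic" if "t \<notin> E" for t
    by (rule sq_eq_in_generic[OF r sq0]) (use that in \<open>auto simp: E_def simp del: qparam_nth\<close>)
  have "(\<lambda>t. f (p0 t)) field_differentiable at t" if t: "t \<notin> E" for t
  proof -
    obtain p v where p: "p t = p0 t" "curve_deriv p v t"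
      "\<forall>\<^sub>F s in nhds t. p s \<in> generic \<and> sq (p s) = 1 *s qparam r s"
      using generic_curve[OF p0[OF t] r one_neq_zero sq0] by blast
    obtain n d where nd: "n \<in> polyfun" "d \<in> polyfun" "d (p t) \<noteq> 0"
      "\<forall>\<^sub>F x in gen_filter (p t). f x = n x / d x"
      using conv p0[OF t] generic_subset p(1) unfolding ratl_def by (metis subsetD)
    have "filterlim p (gen_filter (p t)) (nhds t)"
      unfolding gen_filter_def filterlim_inf filterlim_principal
      using curve_deriv_tendsto[OF p(2)] p(3) by (auto elim: eventually_mono)
    from eventually_compose_filterlim[OF nd(4) this]
    have 1: "\<forall>\<^sub>F s in nhds t. f (p s) = n (p s) / d (p s)" .
    have "\<forall>\<^sub>F s in nhds t. s \<in> - E"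
      by (rule eventually_nhds_in_open) (use E t in \<open>auto simp: finite_imp_closed\<close>)
    with 1 p(3) have "\<forall>\<^sub>F s in nhds t. f (p0 s) = n (p s) / d (p s)"
    proof eventually_elim
      case (elim s)
      then show ?case using inv[OF _ p0, of "p s" s 1] sq0 by auto
    qed
    note ev = this
    obtain D where D: "((\<lambda>s. n (p s)) has_field_derivative D) (at t)"
      using polyfun_deriv[OF nd(1) p(2)] by blast
    obtain D' where D': "((\<lambda>s. d (p s)) has_field_derivative D') (at t)"
      using polyfun_deriv[OF nd(2) p(2)] by blast
    show ?thesis unfolding field_differentiable_def
      using DERIV_cong_ev[OF refl ev refl] DERIV_divide[OF D D' nd(3)] by blast
  qed
  then have "(\<lambda>t. f (p0 t)) holomorphic_on - E"
    by (simp add: holomorphic_on_def field_differentiable_at_within)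
  from Liouville_finite[OF E this] obtain k where k: "\<And>t. t \<notin> E \<Longrightarrow> f (p0 t) = k"
    using B p0 by blast
  have "f x = k" if x: "x \<in> generic" for x
  proof -
    have "x \<in> cone" "x $ 1 \<noteq> 0" using x generic_subset by (auto simp: generic_def)
    from cone_qparam_root[OF this r] obtain t l where tl: "l \<noteq> 0" "sq x = l *s qparam r t" by blast
    have "qparam r t $ i \<noteq> 0" for i
      using x arg_cong[OF tl(2), of "\<lambda>v. v $ i"] by (auto simp: generic_def)
    then have t: "t \<notin> E" by (simp add: E_def del: qparam_nth)
    have "f x = f (p0 t)" by (rule inv[OF p0[OF t] x, of l]) (simp add: sq0 tl)
    then show ?thesis using k[OF t] by simp
  qed
  then show ?thesis by blast
qed

text \<open>Points with proportional squares differ by a scalar and signs; the scalar absorbs the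
  sign of the first coordinate, so flips 2 and 3 suffice.\<close>

lemma flip_invariant:
  assumes sc: "\<And>x k. x \<in> generic \<Longrightarrow> k \<noteq> 0 \<Longrightarrow> f (k *s x) = f x"
    and f2: "\<And>x. x \<in> generic \<Longrightarrow> f (flip 2 x) = f x"
    and f3: "\<And>x. x \<in> generic \<Longrightarrow> f (flip 3 x) = f x"
    and x: "x \<in> generic" and y: "y \<in> generic" and eq: "sq y = k *s sq x"
  shows "f y = f x"
proof -
  have e: "(y $ i)\<^sup>2 = k * (x $ i)\<^sup>2" for i using arg_cong[OF eq, of "\<lambda>v. v $ i"] by simp
  define m where "m = y $ 1 / x $ 1"
  have x0: "x $ i \<noteq> 0" and y0: "y $ i \<noteq> 0" for i using x y by (auto simp: generic_def)
  have m: "m \<noteq> 0" "m\<^sup>2 = k" using e[of 1] x0 y0 by (auto simp: m_def power_divide)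
  have y1: "y $ 1 = m * x $ 1" using x0 by (simp add: m_def)
  have pm: "y $ i = m * x $ i \<or> y $ i = - (m * x $ i)" for i
    using e[of i] m(2) by (metis power2_eq_iff power_mult_distrib)
  then consider "y = m *s x" | "y = m *s flip 2 x" | "y = m *s flip 3 x" | "y = m *s flip 2 (flip 3 x)"
    using y1 pm[of 2] pm[of 3] by (auto simp: vec3_eq_iff flip_nth)
  then show ?thesis
    by cases (simp_all add: sc m x flip_generic f2 f3)
qed

definition regular_section :: "(complex^3 \<Rightarrow> complex) \<Rightarrow> bool" where
  "regular_section s \<longleftrightarrow> (\<forall>x\<in>generic. \<forall>k. k \<noteq> 0 \<longrightarrow> s (k *s x) = k * s x) \<and> (\<forall>P\<in>cone. ratl P s)"

lemma slope_scale:
  "regular_section s \<Longrightarrow> x \<in> generic \<Longrightarrow> k \<noteq> 0 \<Longrightarrow> slope i s (k *s x) = slope i s x"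
  by (simp add: slope_def regular_section_def flip_scale flip_generic right_diff_distrib[symmetric])

lemma slope_flip_same: "slope i s (flip i x) = slope i s x"
  by (simp add: slope_def flip_nth minus_divide_left)

text \<open>Scaling by -1 is the product of all flips, so only characters odd in an odd number of
  coordinates occur: those of the three coordinates, which yield the linear terms, and that of their
  product, whose piece has to vanish.\<close>

lemma regular_section_linear:
  assumes s: "regular_section s"
  shows "\<exists>k. \<forall>x\<in>generic. s x = dot k x"
proof -
  have sc: "s (k *s x) = k * s x" if "x \<in> generic" "k \<noteq> 0" for x k
    using s that by (simp add: regular_section_def)
  have rat: "\<And>P. P \<in> cone \<Longrightarrow> ratl P s" using s by (simp add: regular_section_def)
  have s1: "s (flip 1 x) = - s (flip 2 (flip 3 x))" if "x \<in> generic" for x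
  proof -
    have "flip 1 x = (-1) *s flip 2 (flip 3 x)" by (simp add: vec3_eq_iff flip_nth)
    then show ?thesis using sc[of "flip 2 (flip 3 x)" "-1"] that by (simp add: flip_generic)
  qed
  have s13: "s (flip 1 (flip 3 x)) = - s (flip 2 x)" if "x \<in> generic" for x
    using s1[OF flip_generic[OF that], of 3] by simp
  note slopes = ratl_slope[OF rat] slope_scale[OF s]
  define f1 where "f1 = (\<lambda>x. slope 1 s x + slope 1 s (flip 3 x))"
  define f2 where "f2 = (\<lambda>x. slope 2 s x + slope 2 s (flip 3 x))"
  define f3 where "f3 = (\<lambda>x. slope 3 s x + slope 3 s (flip 2 x))"
  \<comment> \<open>Four times the piece odd in all coordinates, multiplied by
    \<open>x $ 1 / (x $ 2 * x $ 3)\<close> to be of degree 0 and invariant. The second expression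
    \<open>f4'\<close> handles \<open>x $ 3 = 0\<close>, since coordinates 2 and 3 do not vanish
    together on the cone.\<close>
  define f4 where "f4 = (\<lambda>x. (slope 2 s x - slope 2 s (flip 3 x)) * (x $ 1 * (1 / x $ 3)))"
  have f4': "f4 x = (slope 3 s x - slope 3 s (flip 2 x)) * (x $ 1 * (1 / x $ 2))" if "x \<in> generic" for x
    using that unfolding f4_def slope_def
    by (simp add: generic_def flip_nth flip_commute[of 3 2] field_simps)
  have r: "ratl P f1" "ratl P f2" "ratl P f3" if P: "P \<in> cone" for P
  proof -
    have "ratl P (slope i s)" "ratl P (\<lambda>x. slope i s (flip j x))" for i j
      by (simp_all add: slopes ratl_flip flip_cone P)
    note sl = ratl_add[OF this]
    show "ratl P f1" "ratl P f2" "ratl P f3" unfolding f1_def f2_def f3_def by (rule sl)+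
  qed
  have r4: "ratl P f4" if P: "P \<in> cone" for P
  proof (cases "P $ 3 = 0")
    case False
    then show ?thesis unfolding f4_def
      by (intro ratl_mult ratl_diff ratl_flip slopes flip_cone P ratl_inverse ratl_polyfun polyfun.intros)
  next
    case True
    have "P $ 2 \<noteq> 0"
    proof
      assume "P $ 2 = 0"
      with True P show False by (auto simp: cone_def qform_def conic_def vec3_eq_iff)
    qed
    then have "ratl P (\<lambda>x. (slope 3 s x - slope 3 s (flip 2 x)) * (x $ 1 * (1 / x $ 2)))"
      by (intro ratl_mult ratl_diff ratl_flip slopes flip_cone P ratl_inverse
          ratl_polyfun polyfun.intros)
    then show ?thesis using f4' by (rule ratl_cong)
  qed
  have i1: "f1 y = f1 x" if "x \<in> generic" "y \<in> generic" "sq y = k *s sq x" for x y k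
  proof (rule flip_invariant[OF _ _ _ that])
    fix x k assume x: "x \<in> generic" and "k \<noteq> (0::complex)"
    then show "f1 (k *s x) = f1 x" by (simp add: f1_def flip_scale slopes flip_generic)
  next
    fix x assume x: "x \<in> generic"
    show "f1 (flip 3 x) = f1 x" by (simp add: f1_def)
    have "s (flip 1 (flip 2 x)) = - s (flip 3 x)"
      using s1[OF flip_generic[OF x], of 2] by (simp add: flip_commute[of 3 2])
    moreover have "s (flip 1 (flip 3 (flip 2 x))) = - s x"
      using s13[OF flip_generic[OF x], of 2] by simp
    ultimately show "f1 (flip 2 x) = f1 x"
      unfolding f1_def slope_def using s1[OF x] s13[OF x]
      by (simp add: flip_nth flip_commute[of 3 2] add_divide_distrib[symmetric])
  qed
  have i2: "f2 y = f2 x" if "x \<in> generic" "y \<in> generic" "sq y = k *s sq x" for x y k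
  proof (rule flip_invariant[OF _ _ _ that])
    fix x k assume x: "x \<in> generic" and "k \<noteq> (0::complex)"
    then show "f2 (k *s x) = f2 x" by (simp add: f2_def flip_scale slopes flip_generic)
  next
    fix x assume x: "x \<in> generic"
    show "f2 (flip 3 x) = f2 x" by (simp add: f2_def)
    show "f2 (flip 2 x) = f2 x" by (simp add: f2_def slope_flip_same flip_commute[of 3 2])
  qed
  have i3: "f3 y = f3 x" if "x \<in> generic" "y \<in> generic" "sq y = k *s sq x" for x y k
  proof (rule flip_invariant[OF _ _ _ that])
    fix x k assume x: "x \<in> generic" and "k \<noteq> (0::complex)"
    then show "f3 (k *s x) = f3 x" by (simp add: f3_def flip_scale slopes flip_generic)
  next
    fix x assume x: "x \<in> generic"
    show "f3 (flip 2 x) = f3 x" by (simp add: f3_def)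
    show "f3 (flip 3 x) = f3 x" by (simp add: f3_def slope_flip_same flip_commute[of 2 3])
  qed
  have i4: "f4 y = f4 x" if "x \<in> generic" "y \<in> generic" "sq y = k *s sq x" for x y k
  proof (rule flip_invariant[OF _ _ _ that])
    fix x k assume x: "x \<in> generic" and "k \<noteq> (0::complex)"
    then show "f4 (k *s x) = f4 x" by (simp add: f4_def flip_scale slopes flip_generic)
  next
    fix x assume x: "x \<in> generic"
    show "f4 (flip 3 x) = f4 x" by (simp add: f4_def flip_nth algebra_simps)
    show "f4 (flip 2 x) = f4 x" by (simp add: f4_def slope_flip_same flip_commute[of 3 2] flip_nth)
  qed
  have "\<exists>k. \<forall>x\<in>generic. f1 x = k"
    by (rule regular_function_constant) (erule r(1), erule (2) i1)
  then obtain k1 where k1: "\<And>x. x \<in> generic \<Longrightarrow> f1 x = k1" by blast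
  have "\<exists>k. \<forall>x\<in>generic. f2 x = k"
    by (rule regular_function_constant) (erule r(2), erule (2) i2)
  then obtain k2 where k2: "\<And>x. x \<in> generic \<Longrightarrow> f2 x = k2" by blast
  have "\<exists>k. \<forall>x\<in>generic. f3 x = k"
    by (rule regular_function_constant) (erule r(3), erule (2) i3)
  then obtain k3 where k3: "\<And>x. x \<in> generic \<Longrightarrow> f3 x = k3" by blast
  have "\<exists>k. \<forall>x\<in>generic. f4 x = k"
    by (rule regular_function_constant) (erule r4, erule (2) i4)
  then obtain k4 where k4: "\<And>x. x \<in> generic \<Longrightarrow> f4 x = k4" by blast
  \<comment> \<open>The factor \<open>x $ 1\<close> forces \<open>f4\<close> to tend to 0 at a point
    of the curve on the line \<open>x $ 1 = 0\<close>.\<close>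
  have "k4 = 0"
  proof -
    obtain ro where ro: "root ro" using exists_root by blast
    define P :: "complex^3" where "P = vector [0, csqrt ro, 1]"
    have Pi: "P $ 1 = 0" "P $ 2 = csqrt ro" "P $ 3 = 1" by (simp_all add: P_def)
    have "F P = ro\<^sup>2 + c * ro + 1" by (simp add: qform_def conic_def Pi)
    then have P: "P \<in> cone"
      using ro Pi(3) by (auto simp: cone_def root_def)
    have "P $ 3 \<noteq> 0" using Pi(3) by simp
    then have "ratl P (\<lambda>x. (slope 2 s x - slope 2 s (flip 3 x)) * (1 / x $ 3))"
      by (intro ratl_mult ratl_diff ratl_flip slopes flip_cone P ratl_inverse)
    from ratl_tendsto[OF this] obtain l where
      l: "((\<lambda>x. (slope 2 s x - slope 2 s (flip 3 x)) * (1 / x $ 3)) \<longlongrightarrow> l) (gen_filter P)" by blast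
    have "((\<lambda>x. x $ 1) \<longlongrightarrow> P $ 1) (gen_filter P)"
      by (intro tendsto_vec_nth gen_filter_tendsto)
    from tendsto_mult[OF l this] have "(f4 \<longlongrightarrow> 0) (gen_filter P)"
      by (simp add: Pi(1) f4_def[abs_def] mult_ac)
    moreover have "\<forall>\<^sub>F x in gen_filter P. f4 x = k4"
      using eventually_gen_filter_generic by eventually_elim (rule k4)
    then have "(f4 \<longlongrightarrow> k4) (gen_filter P)" by (rule tendsto_eventually)
    ultimately show ?thesis using tendsto_unique generic_dense[OF P] by blast
  qed
  have "s x = dot (vector [k1 / 4, k2 / 4, k3 / 4]) x" if x: "x \<in> generic" for x
  proof -
    have x0: "x $ 1 \<noteq> 0" "x $ 2 \<noteq> 0" "x $ 3 \<noteq> 0" using x by (auto simp: generic_def)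
    have "x $ 1 * f1 x = s x + s (flip 2 (flip 3 x)) + s (flip 3 x) + s (flip 2 x)"
      using x0 s1[OF x] s13[OF x] by (simp add: f1_def slope_def flip_nth field_simps)
    moreover have "x $ 2 * f2 x = s x - s (flip 2 x) + s (flip 3 x) - s (flip 2 (flip 3 x))"
      using x0 by (simp add: f2_def slope_def flip_nth field_simps)
    moreover have "x $ 3 * f3 x = s x - s (flip 3 x) + s (flip 2 x) - s (flip 2 (flip 3 x))"
      using x0 by (simp add: f3_def slope_def flip_nth flip_commute[of 3 2] field_simps)
    moreover have "0 = s x - s (flip 2 x) - (s (flip 3 x) - s (flip 2 (flip 3 x)))"
    proof -
      have "f4 x = (s x - s (flip 2 x) - (s (flip 3 x) - s (flip 2 (flip 3 x)))) / x $ 2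
          * (x $ 1 * (1 / x $ 3))"
        by (simp add: f4_def slope_def flip_nth diff_divide_distrib)
      then show ?thesis using x0 k4[OF x] \<open>k4 = 0\<close> by simp
    qed
    ultimately have "4 * s x = x $ 1 * k1 + x $ 2 * k2 + x $ 3 * k3"
      unfolding k1[OF x] k2[OF x] k3[OF x] by algebra
    then show ?thesis by (simp add: dot_def field_simps)
  qed
  then show ?thesis by blast
qed

end

section \<open>Isomorphisms are linear\<close>

lemma eventually_eq_imp_limit_eq:
  assumes "\<forall>\<^sub>F x in F. f x = g x" "(f \<longlongrightarrow> a) F" "(g \<longlongrightarrow> b) F" "F \<noteq> bot"
  shows "a = (b :: 'b::t2_space)"
  using assms tendsto_cong tendsto_unique by metis

context regular_rep
begin

lemma sect_ratl:
  assumes P: "P \<in> X.cone" shows "X.ratl P (\<lambda>x. sect x $ i)"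
proof -
  obtain g where g: "g \<in> rep" "g P \<noteq> 0" using rep_cover P by blast
  obtain n d where nd: "n \<in> polyfun" "d \<in> polyfun" "d P \<noteq> 0"
    "\<forall>\<^sub>F x in X.gen_filter P. twist g x (n x / d x)" using twist_regular[OF P g] by blast
  have pg: "(\<lambda>x. g x $ i) \<in> polyfun" using polymap_rep[OF g(1)] unfolding polymap_def by blast
  show ?thesis
  proof (rule X.ratlI[of "\<lambda>x. n x * g x $ i" d])
    show "\<forall>\<^sub>F x in X.gen_filter P. sect x $ i = n x * g x $ i / d x"
      using nd(4) X.eventually_gen_filter_generic
        tendsto_imp_eventually_ne[OF tendsto_polymap[OF polymap_rep[OF g(1)] X.gen_filter_tendsto] g(2)]
      by eventually_elim (use sect_eq[OF _ g(1)] in simp)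
  qed (use nd pg in \<open>auto intro: polyfun.intros\<close>)
qed

lemma sect_linear: "\<exists>A. \<forall>x\<in>X.generic. sect x = A *v x"
proof -
  have "X.regular_section (\<lambda>x. sect x $ i)" for i
    unfolding X.regular_section_def using sect_ratl sect_scale by simp
  then have "\<exists>k. \<forall>x\<in>X.generic. sect x $ i = dot k x" for i
    by (rule X.regular_section_linear)
  then obtain k where k: "\<And>i x. x \<in> X.generic \<Longrightarrow> sect x $ i = dot (k i) x" by metis
  have "sect x = (\<chi> i. k i) *v x" if "x \<in> X.generic" for x
    using k[OF that] by (simp add: vec_eq_iff matrix_vector_mult_def sum_3 dot_def)
  then show ?thesis by blast
qed

text \<open>Identities at generic points pass to the limit. Generic points alone would not do,
  because the map may send one to a point with a vanishing coordinate, where the inverse map must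
  still be described.\<close>

lemma linear_rep:
  "\<exists>A. \<forall>x\<in>X.cone. \<forall>g\<in>rep. g x \<noteq> 0 \<longrightarrow> (\<exists>h. A *v x = h *s g x \<and> twist g x h)"
proof -
  obtain A where A: "\<And>x. x \<in> X.generic \<Longrightarrow> sect x = A *v x" using sect_linear by blast
  have "\<exists>h. A *v P = h *s g P \<and> twist g P h" if P: "P \<in> X.cone" and g: "g \<in> rep" "g P \<noteq> 0" for P g
  proof -
    note bot = X.generic_dense[OF P] and pg = polymap_rep[OF g(1)] and id = X.gen_filter_tendsto[of P]
    obtain n d where nd: "n \<in> polyfun" "d \<in> polyfun" "d P \<noteq> 0"
      and tw: "\<forall>\<^sub>F x in X.gen_filter P. twist g x (n x / d x)" using twist_regular[OF P g] by blast
    note th = tendsto_divide[OF tendsto_polyfun[OF nd(1) id] tendsto_polyfun[OF nd(2) id] nd(3)]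
    let ?h = "n P / d P"
    have "A *v P = ?h *s g P"
    proof (rule eventually_eq_imp_limit_eq[OF _ _ _ bot])
      show "\<forall>\<^sub>F x in X.gen_filter P. A *v x = (n x / d x) *s g x"
        using tw X.eventually_gen_filter_generic
          tendsto_imp_eventually_ne[OF tendsto_polymap[OF pg id] g(2)]
        by eventually_elim (use sect_eq[OF _ g(1)] A in simp)
      have "polymap (\<lambda>x. A *v x)"
        unfolding polymap_def matrix_vector_mult_def by (auto intro!: polyfun_intros)
      from tendsto_polymap[OF this id] show "((*v) A \<longlongrightarrow> A *v P) (X.gen_filter P)" .
      show "((\<lambda>x. (n x / d x) *s g x) \<longlongrightarrow> ?h *s g P) (X.gen_filter P)"
        using tendsto_mult[OF th tendsto_vec_nth[OF tendsto_polymap[OF pg id]]]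
        by (intro vec_tendstoI) simp
    qed
    moreover have "twist g P ?h"
    proof -
      obtain i where i: "P $ i \<noteq> 0" using P by (auto simp: X.cone_def vec_eq_iff)
      \<comment> \<open>With \<open>dot P w = 1\<close> the tangent field \<open>v\<close> below has
        residue \<open>dot x w\<close>, which is 1 at \<open>P\<close>.\<close>
      define w :: "complex^3" where "w = axis i (1 / P $ i)"
      have w: "dot P w = 1" using i exhaust_3[of i] by (auto simp: w_def dot_def axis_def)
      define v where "v = (\<lambda>x. cross (X.dF x) w)"
      have F: "X.F P = 0" "P \<noteq> 0" using P by (simp_all add: X.cone_def)
      have "cross P (v P) = 1 *s X.dF P" using cross_tangent[OF F(1), of w] w by (simp add: v_def)
      moreover have "cross (g P) (pjac g P *v v P) = (?h * dot P w) *s Y.dF (g P)"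
      proof (rule eventually_eq_imp_limit_eq[OF _ _ _ bot])
        show "\<forall>\<^sub>F x in X.gen_filter P.
            cross (g x) (pjac g x *v v x) = (n x / d x * dot x w) *s Y.dF (g x)"
          using tw X.eventually_gen_filter_generic
        proof eventually_elim
          case (elim x)
          then show ?case using cross_tangent[of x w] unfolding twist_def v_def X.generic_def by blast
        qed
        have "polymap (\<lambda>x. cross (g x) (pjac g x *v v x))" unfolding v_def
          by (intro polyfun_cross polymap_pjac pg polymap_const polymap_qgrad)
        from tendsto_polymap[OF this id]
        show "((\<lambda>x. cross (g x) (pjac g x *v v x)) \<longlongrightarrow> cross (g P) (pjac g P *v v P)) (X.gen_filter P)" .
        have "(\<lambda>x. dot x w) \<in> polyfun" unfolding dot_def by (intro polyfun_intros)
        note td = tendsto_mult[OF th tendsto_polyfun[OF this id]]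
        have "((\<lambda>x. Y.dF (g x) $ i) \<longlongrightarrow> Y.dF (g P) $ i) (X.gen_filter P)" for i
          by (rule tendsto_polyfun[OF polyfun_comp[OF polyfun_qgrad pg] id])
        from tendsto_mult[OF td this]
        show "((\<lambda>x. (n x / d x * dot x w) *s Y.dF (g x)) \<longlongrightarrow> (?h * dot P w) *s Y.dF (g P)) (X.gen_filter P)"
          by (intro vec_tendstoI) simp
      qed
      ultimately show ?thesis using twist_extend[OF g(1) F(2), of "v P" 1 ?h] w by simp
    qed
    ultimately show ?thesis by blast
  qed
  then show ?thesis by blast
qed

end

section \<open>Forms vanishing on the quartic\<close>

lemma qform_line:
  "qform a b c (p + z *s n) = qform a b c p + z * dot (qgrad a b c p) n
     + z\<^sup>2 * (4 * conic a b c (\<chi> i. p $ i * n $ i) + dot (conic_grad a b c (sq p)) (sq n))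
     + z ^ 3 * dot (qgrad a b c n) p + z ^ 4 * qform a b c n"
  unfolding qform_def conic_def dot_def qgrad_def by simp algebra

lemma quartic_in_parameter:
  "\<exists>d1 d2. \<forall>z. qform a b c (p + z *s n) = qform a b c p + d1 * z + d2 * z\<^sup>2
     + dot (qgrad a b c n) p * z ^ 3 + qform a b c n * z ^ 4"
  unfolding qform_line
  by (rule exI[of _ "dot (qgrad a b c p) n"],
      rule exI[of _ "4 * conic a b c (\<chi> i. p $ i * n $ i) + dot (conic_grad a b c (sq p)) (sq n)"])
    (simp add: mult.commute)

text \<open>Opposite roots \<open>z\<close> and \<open>- z\<close> separate the even from the odd
  part; after removal of a factor \<open>z\<close> each is linear in \<open>z\<^sup>2\<close> and
  vanishes at two values.\<close>

lemma cubic_zero: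
  fixes d0 d1 d2 d3 :: complex
  assumes "\<And>z. z\<^sup>2 = w1 \<or> z\<^sup>2 = w2 \<Longrightarrow> d0 + d1 * z + d2 * z\<^sup>2 + d3 * z ^ 3 = 0"
    and "w1 \<noteq> w2" "w1 \<noteq> 0" "w2 \<noteq> 0"
  shows "d0 = 0 \<and> d1 = 0 \<and> d2 = 0 \<and> d3 = 0"
proof -
  have *: "d0 + d2 * w = 0 \<and> d1 + d3 * w = 0" if w: "w = w1 \<or> w = w2" for w
  proof -
    define z where "z = csqrt w"
    have z: "z\<^sup>2 = w" "(- z)\<^sup>2 = w" "z \<noteq> 0" using w assms(3,4) by (auto simp: z_def)
    have "d0 + d1 * z + d2 * z\<^sup>2 + d3 * z ^ 3 = 0" "d0 - d1 * z + d2 * z\<^sup>2 - d3 * z ^ 3 = 0"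
      using assms(1)[of z] assms(1)[of "- z"] z(1,2) w by auto
    then have "2 * (d0 + d2 * w) = 0" "2 * z * (d1 + d3 * w) = 0"
      using z(1) by algebra+
    then show ?thesis using z(3) unfolding mult_eq_0_iff by simp
  qed
  have "d0 + d2 * w1 = 0" "d1 + d3 * w1 = 0" "d0 + d2 * w2 = 0" "d1 + d3 * w2 = 0"
    using * by auto
  then have "d2 * (w1 - w2) = 0" "d3 * (w1 - w2) = 0"
    by algebra+
  then have "d2 = 0" "d3 = 0" using assms(2) by auto
  then show ?thesis using *[of w1] by auto
qed

lemma polyfun_cofinite_zero:
  assumes f: "f \<in> polyfun" and E: "finite E" "\<And>t. t \<notin> E \<Longrightarrow> f (p + t *s v) = 0"
  shows "f (p + t *s v) = 0"
proof (rule eventually_eq_imp_limit_eq)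
  have c: "((\<lambda>s. p + s *s v) \<longlongrightarrow> p + t *s v) (at t)"
    using curve_deriv_tendsto[OF curve_deriv_line] by (simp add: tendsto_nhds_iff)
  show "((\<lambda>s. f (p + s *s v)) \<longlongrightarrow> f (p + t *s v)) (at t)"
    by (rule tendsto_polyfun[OF f c])
  have "\<forall>\<^sub>F s in at t. s \<notin> E"
    using islimpt_finite[OF E(1)] islimpt_iff_eventually by blast
  then show "\<forall>\<^sub>F s in at t. f (p + s *s v) = 0"
    by eventually_elim (rule E(2))
qed auto

context smooth_quartic
begin

text \<open>On a line \<open>(1, y, z)\<close> with \<open>y\<close> fixed outside a finite set,
  \<open>F\<close> is monic of degree 4 in \<open>z\<close> with four distinct roots, all at generic
  points. The difference from \<open>k * F\<close> has degree at most 3 there, hence vanishes;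
  continuity and homogeneity cover the other points.\<close>

lemma form_multiple:
  assumes H: "\<And>x. x \<in> generic \<Longrightarrow> qform a' b' c' (A *v x) = 0"
  shows "\<exists>k. \<forall>x. qform a' b' c' (A *v x) = k * F x"
proof -
  \<comment> \<open>\<open>F\<close> is 1 at \<open>axis 3 1\<close>, so this \<open>k\<close>
    cancels the terms with \<open>z ^ 4\<close>.\<close>
  define k where "k = qform a' b' c' (A *v axis 3 1)"
  define D where "D = (\<lambda>x. qform a' b' c' (A *v x) - k * F x)"
  have pA: "polymap (\<lambda>x. A *v x)"
    unfolding polymap_def matrix_vector_mult_def by (auto intro!: polyfun_intros)
  have pD: "D \<in> polyfun" unfolding D_def
    by (intro polyfun_diff polyfun.mult polyfun.const polyfun_comp[OF polyfun_qform pA] polyfun_qform)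
  obtain r where r: "root r" using exists_root by blast
  have "(2 * r + c)\<^sup>2 = c\<^sup>2 - 4" using r unfolding root_def by algebra
  then have c: "c\<^sup>2 - 4 \<noteq> 0" using root_simple[OF r] by auto
  \<comment> \<open>The factors are \<open>y\<close>, \<open>F\<close> at \<open>(1, y, 0)\<close>
    and the discriminant of \<open>F\<close> in \<open>z\<^sup>2\<close>. They exclude
    \<open>y = 0\<close>, a root \<open>z = 0\<close> and a double root; the last factor is not the
    zero polynomial because \<open>c\<^sup>2 - 4\<close> is nonzero.\<close>
  define E where "E = {y. poly ([:0, 1:] * [:1, 0, a, 0, 1:] * [:b\<^sup>2 - 4, 0, 2 * b * c - 4 * a, 0, c\<^sup>2 - 4:]) y = 0}"
  have E: "finite E" unfolding E_def by (rule poly_roots_finite) (use c in simp)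
  have 1: "D (vector [1, 0, z] + y *s vector [0, 1, 0]) = 0" if y: "y \<notin> E" for y z
  proof -
    define p :: "complex^3" where "p = vector [1, y, 0]"
    have y0: "y \<noteq> 0" and y1: "1 + a * y\<^sup>2 + y ^ 4 \<noteq> 0"
      and y2: "(b + c * y\<^sup>2)\<^sup>2 - 4 * (1 + a * y\<^sup>2 + y ^ 4) \<noteq> 0"
    proof -
      have "poly [:1, 0, a, 0, 1:] y = 1 + a * y\<^sup>2 + y ^ 4"
        "poly [:b\<^sup>2 - 4, 0, 2 * b * c - 4 * a, 0, c\<^sup>2 - 4:] y = (b + c * y\<^sup>2)\<^sup>2 - 4 * (1 + a * y\<^sup>2 + y ^ 4)"
        by (simp, algebra)+
      moreover have "poly [:0, 1:] y \<noteq> 0" "poly [:1, 0, a, 0, 1:] y \<noteq> 0"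
        "poly [:b\<^sup>2 - 4, 0, 2 * b * c - 4 * a, 0, c\<^sup>2 - 4:] y \<noteq> 0"
        using y unfolding E_def mem_Collect_eq poly_mult mult_eq_0_iff by blast+
      ultimately show "y \<noteq> 0" "1 + a * y\<^sup>2 + y ^ 4 \<noteq> 0" "(b + c * y\<^sup>2)\<^sup>2 - 4 * (1 + a * y\<^sup>2 + y ^ 4) \<noteq> 0"
        by (simp, metis, metis)
    qed
    define e where "e = csqrt ((b + c * y\<^sup>2)\<^sup>2 - 4 * (1 + a * y\<^sup>2 + y ^ 4))"
    have e: "e\<^sup>2 = (b + c * y\<^sup>2)\<^sup>2 - 4 * (1 + a * y\<^sup>2 + y ^ 4)" by (simp add: e_def)
    define w1 w2 where "w1 = (e - (b + c * y\<^sup>2)) / 2" and "w2 = (- e - (b + c * y\<^sup>2)) / 2"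
    have w: "w1 + w2 = - (b + c * y\<^sup>2)" "w1 * w2 = 1 + a * y\<^sup>2 + y ^ 4" "w1 - w2 = e"
      using e by (simp_all add: w1_def w2_def field_simps power2_eq_square)
    have "e \<noteq> 0" using y2 e by auto
    then have w12: "w1 \<noteq> w2" "w1 \<noteq> 0" "w2 \<noteq> 0" using w y1 by auto
    let ?p = "\<lambda>z. p + z *s axis 3 1"
    have F: "F (?p z) = (z\<^sup>2 - w1) * (z\<^sup>2 - w2)" for z
    proof -
      have "F (?p z) = z ^ 4 + (b + c * y\<^sup>2) * z\<^sup>2 + (1 + a * y\<^sup>2 + y ^ 4)"
        unfolding qform_def conic_def by (simp add: p_def axis_def algebra_simps flip: power_mult)
      then show ?thesis using w(1,2) by algebra
    qed
    have gen: "?p z \<in> generic" if "z\<^sup>2 = w1 \<or> z\<^sup>2 = w2" for z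
    proof -
      have "z \<noteq> 0" using that w12 by auto
      then have "?p z $ i \<noteq> 0" for i using y0 exhaust_3[of i] by (auto simp: p_def axis_def)
      moreover have "F (?p z) = 0" using F that by auto
      ultimately show ?thesis by (simp add: generic_def)
    qed
    obtain d0 d1 d2 d3 where d: "\<And>z. D (?p z) = d0 + d1 * z + d2 * z\<^sup>2 + d3 * z ^ 3"
    proof -
      have "A *v ?p z = A *v p + z *s (A *v axis 3 1)" for z
        by (simp add: matrix_vector_right_distrib vec.scale)
      moreover obtain e0 e1 e2 e3 where "\<And>z. qform a' b' c' (A *v p + z *s (A *v axis 3 1))
          = e0 + e1 * z + e2 * z\<^sup>2 + e3 * z ^ 3 + k * z ^ 4"
        using quartic_in_parameter[of a' b' c' "A *v p" "A *v axis 3 1"] unfolding k_def by blast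
      moreover have "F (axis 3 1) = 1" by (simp add: qform_def conic_def axis_def)
      then obtain f0 f1 f2 f3 where "\<And>z. F (?p z) = f0 + f1 * z + f2 * z\<^sup>2 + f3 * z ^ 3 + 1 * z ^ 4"
        using quartic_in_parameter[of a b c p "axis 3 1"] by metis
      ultimately have "D (?p z) = (e0 - k * f0) + (e1 - k * f1) * z + (e2 - k * f2) * z\<^sup>2
          + (e3 - k * f3) * z ^ 3" for z
        unfolding D_def by (simp add: algebra_simps)
      then show ?thesis by (rule that)
    qed
    have "d0 + d1 * z + d2 * z\<^sup>2 + d3 * z ^ 3 = 0" if "z\<^sup>2 = w1 \<or> z\<^sup>2 = w2" for z
      unfolding d[symmetric] using H[OF gen[OF that]] gen[OF that] by (simp add: D_def generic_def)
    then have "d0 = 0 \<and> d1 = 0 \<and> d2 = 0 \<and> d3 = 0" by (rule cubic_zero[OF _ w12])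
    then have "D (?p z) = 0" for z unfolding d by simp
    moreover have "vector [1, 0, z] + y *s vector [0, 1, 0] = ?p z"
      by (simp add: vec3_eq_iff p_def axis_def)
    ultimately show ?thesis by simp
  qed
  have 2: "D (vector [1, y, z]) = 0" for y z
  proof -
    have "D (vector [1, 0, z] + y *s vector [0, 1, 0]) = 0"
      by (rule polyfun_cofinite_zero[OF pD E 1])
    moreover have "vector [1, 0, z] + y *s vector [0, 1, 0] = (vector [1, y, z] :: complex^3)"
      by (simp add: vec3_eq_iff)
    ultimately show ?thesis by simp
  qed
  have 3: "D x = 0" if "x $ 1 \<noteq> 0" for x
  proof -
    have "x = x $ 1 *s vector [1, x $ 2 / x $ 1, x $ 3 / x $ 1]"
      using that by (simp add: vec3_eq_iff)
    moreover have "D (l *s x) = l ^ 4 * D x" for l x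
      by (simp add: D_def vec.scale qform_scale algebra_simps)
    ultimately show ?thesis using 2 by (metis mult_zero_right)
  qed
  have "D x = 0" for x
  proof -
    have "D (x + 0 *s axis 1 1) = 0"
      by (rule polyfun_cofinite_zero[OF pD, of "{- x $ 1}"])
        (auto intro!: 3 simp: axis_def add_eq_0_iff)
    then show ?thesis by simp
  qed
  then show ?thesis unfolding D_def by auto
qed

lemma exists_generic: "\<exists>x. x \<in> generic"
proof -
  obtain r where r: "root r" using exists_root by blast
  have "finite (\<Union>i. {t. qparam r t $ i = 0})" using finite_qparam_zeros[OF r] by auto
  then obtain t where t: "t \<notin> (\<Union>i. {t. qparam r t $ i = 0})"
    using infinite_UNIV_char_0 by (metis ex_new_if_finite)
  obtain x where "sq x = qparam r t" using exists_sqrt by blast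
  then have "sq x = 1 *s qparam r t" by simp
  from sq_eq_in_generic[OF r this] t show ?thesis by (auto simp del: qparam_nth)
qed

text \<open>One generic point and its flips span the space: \<open>x - flip i x\<close> is a nonzero
  multiple of \<open>axis i 1\<close>.\<close>

lemma identity_on_generic:
  assumes M: "\<And>x. x \<in> generic \<Longrightarrow> M *v x = x"
  shows "M = mat 1"
proof -
  obtain x where x: "x \<in> generic" using exists_generic by blast
  have "M *v axis i 1 = axis i 1" for i
  proof -
    have xi: "x $ i \<noteq> 0" using x by (simp add: generic_def)
    have "axis i 1 = (1 / (2 * x $ i)) *s (x - flip i x)"
      using xi by (auto simp: vec_eq_iff axis_def flip_nth)
    then show ?thesis
      using M[OF x] M[OF flip_generic[OF x, of i]] by (simp add: vec.scale vec.diff)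
  qed
  moreover have "column i M = M *v axis i 1" for i
    by (simp add: vec_eq_iff column_def matrix_vector_mult_def axis_def if_distrib cong: if_cong)
  ultimately have "column i M = axis i 1" for i by simp
  then show ?thesis by (auto simp: vec_eq_iff column_def mat_def axis_def)
qed

end

text \<open>The composite lifts the identity, so it pulls the residue form back to itself:
  evaluating a cross product in two ways gives \<open>h * h' * k = 1\<close>. Hence
  \<open>B *v (A *v x)\<close> is \<open>x\<close> exactly and not only up to a factor.\<close>

lemma isomorphism_linear:
  assumes "regular_rep a b c a' b' c' rep" "regular_rep a' b' c' a b c rep'"
    and comp: "\<And>x g g'. x \<noteq> 0 \<Longrightarrow> qform a b c x = 0 \<Longrightarrow> g \<in> rep \<Longrightarrow> g' \<in> rep' \<Longrightarrow> g x \<noteq> 0 \<Longrightarrow>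
      g' (g x) \<noteq> 0 \<Longrightarrow> \<exists>k. k \<noteq> 0 \<and> g' (g x) = k *s x"
  shows "\<exists>A B. B ** A = mat 1 \<and> (\<exists>k. \<forall>x. qform a' b' c' (A *v x) = k * qform a b c x)"
proof -
  interpret R: regular_rep a b c a' b' c' rep by fact
  interpret R': regular_rep a' b' c' a b c rep' by fact
  obtain A where A: "\<And>x g. x \<in> R.X.cone \<Longrightarrow> g \<in> rep \<Longrightarrow> g x \<noteq> 0 \<Longrightarrow> \<exists>h. A *v x = h *s g x \<and> R.twist g x h"
    using R.linear_rep by blast
  obtain B where B: "\<And>x g. x \<in> R.Y.cone \<Longrightarrow> g \<in> rep' \<Longrightarrow> g x \<noteq> 0 \<Longrightarrow> \<exists>h. B *v x = h *s g x \<and> R'.twist g x h"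
    using R'.linear_rep by blast
  have "B *v (A *v x) = x" if x: "x \<in> R.X.generic" for x
  proof -
    have xc: "x \<in> R.X.cone" using x R.X.generic_subset by blast
    obtain g where g: "g \<in> rep" "g x \<noteq> 0" using R.rep_cover[OF xc] by blast
    have gc: "g x \<in> R.Y.cone" using R.rep_maps[OF g(1) xc g(2)] g(2) by (simp add: R.Y.cone_def)
    obtain g' where g': "g' \<in> rep'" "g' (g x) \<noteq> 0" using R'.rep_cover[OF gc] by blast
    obtain h where h: "A *v x = h *s g x" "R.twist g x h" using A[OF xc g] by blast
    obtain h' where h': "B *v g x = h' *s g' (g x)" "R'.twist g' (g x) h'" using B[OF gc g'] by blast
    obtain p v t m where p: "p t = x" "curve_deriv p v t" "\<forall>\<^sub>F s in nhds t. p s \<in> R.X.generic"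
        "cross x v = m *s R.X.dF x" "m \<noteq> 0"
      using R.X.exists_curve[OF x] by blast
    have gp: "g (p t) \<noteq> 0" "g' (g (p t)) \<noteq> 0" using g g' p(1) by simp_all
    define v1 where "v1 = pjac g x *v v"
    define v2 where "v2 = pjac g' (g x) *v v1"
    have c1: "curve_deriv (\<lambda>s. g (p s)) v1 t"
      using pjac(2)[OF R.polymap_rep[OF g(1)] p(2)] p(1) by (simp add: v1_def)
    have c2: "curve_deriv (\<lambda>s. g' (g (p s))) v2 t"
      using pjac(2)[OF R'.polymap_rep[OF g'(1)] c1] p(1) by (simp add: v2_def)
    have t1: "cross (g x) v1 = (h * m) *s R.Y.dF (g x)"
      using h(2) p(4) unfolding R.twist_def v1_def by blast
    then have t2: "cross (g' (g x)) v2 = (h' * (h * m)) *s R.X.dF (g' (g x))"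
      using h'(2) unfolding R'.twist_def v2_def by blast
    have "\<forall>\<^sub>F s in nhds t. g (p s) \<noteq> 0"
      using tendsto_imp_eventually_ne[OF curve_deriv_tendsto[OF c1] gp(1)] .
    moreover have "\<forall>\<^sub>F s in nhds t. g' (g (p s)) \<noteq> 0"
      using tendsto_imp_eventually_ne[OF curve_deriv_tendsto[OF c2] gp(2)] .
    ultimately have "\<forall>\<^sub>F s in nhds t. \<exists>l. g' (g (p s)) = l *s p s"
      using p(3)
    proof eventually_elim
      case (elim s)
      then have "p s \<noteq> 0" "R.X.F (p s) = 0" using R.X.generic_subset by (auto simp: R.X.cone_def)
      then show ?case using comp[OF _ _ g(1) g'(1)] elim(1,2) by blast
    qed
    moreover have "p t \<noteq> 0" using p(1) xc by (simp add: R.X.cone_def)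
    ultimately obtain k where gx: "g' (g x) = k *s x" and cr: "cross (g' (g x)) v2 = k\<^sup>2 *s cross x v"
      using cross_curve_multiple[OF p(2) c2] unfolding p(1) by blast
    have kt: "k \<noteq> 0" using gx g'(2) by auto
    have "(h' * (h * m) * k ^ 3) *s R.X.dF x = (k\<^sup>2 * m) *s R.X.dF x"
      using t2 cr unfolding gx qgrad_scale p(4) by auto
    moreover have "R.X.dF x \<noteq> 0" using R.dF_nonzero[OF xc] .
    ultimately have "h' * (h * m) * k ^ 3 = k\<^sup>2 * m" using vec.scale_cancel_right by blast
    then have "(k\<^sup>2 * m) * (h * h' * k) = (k\<^sup>2 * m) * 1"
      by (simp add: power2_eq_square power3_eq_cube mult_ac)
    then have "h * h' * k = 1" using kt p(5) by simp
    moreover have "h *s (h' *s (k *s x)) = (h * h' * k) *s x" by (simp add: mult.assoc)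
    ultimately show ?thesis unfolding h(1) vec.scale h'(1) gx by simp
  qed
  then have "B ** A = mat 1"
    by (intro R.X.identity_on_generic) (simp add: matrix_vector_mul_assoc[symmetric])
  moreover have "R.Y.F (A *v x) = 0" if x: "x \<in> R.X.generic" for x
  proof -
    have xc: "x \<in> R.X.cone" using x R.X.generic_subset by blast
    obtain g where g: "g \<in> rep" "g x \<noteq> 0" using R.rep_cover[OF xc] by blast
    obtain h where h: "A *v x = h *s g x" using A[OF xc g] by blast
    show ?thesis using R.rep_maps[OF g(1) xc g(2)] unfolding h qform_scale by simp
  qed
  ultimately show ?thesis using R.X.form_multiple by blast
qed

section \<open>Centralizers of sign changes\<close>

text \<open>\<open>m\<close> is a covector and \<open>n\<close> a vector; the map is an involution
  when \<open>dot m n = 1\<close>. Keeping them apart allows reflections that are not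
  orthogonal.\<close>

definition refl :: "complex^3 \<Rightarrow> complex^3 \<Rightarrow> complex^3 \<Rightarrow> complex^3" where
  "refl m n x = x - (2 * dot m x) *s n"

lemma dot_linear:
  "dot m (x + y) = dot m x + dot m y" "dot m (x - y) = dot m x - dot m y"
  "dot m (t *s x) = t * dot m x" "dot m (- x) = - dot m x"
  by (simp_all add: dot_def algebra_simps)

lemma flip_eq_refl: "flip i = refl (axis i 1) (axis i 1)"
proof
  fix x
  show "flip i x = refl (axis i 1) (axis i 1) x"
    using exhaust_3[of i] by (auto simp: vec3_eq_iff flip_nth refl_def dot_def axis_def)
qed

lemma dot_axis: "dot (axis i 1) x = x $ i" "dot x (axis i 1) = x $ i"
  using exhaust_3[of i] by (auto simp: dot_def axis_def)

text \<open>With the product of both pairings as cos^2 of the angle, 1/4 is the angle of a product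
  of order 3, which gives the braid relation of length 3.\<close>

lemma refl_braid3:
  assumes "dot m n = 1" "dot e' e = 1" "4 * (dot m e * dot e' n) = 1"
  shows "refl e' e (refl m n (refl e' e x)) = refl m n (refl e' e (refl m n x))"
proof -
  have "refl e' e (refl m n (refl e' e x)) $ k = refl m n (refl e' e (refl m n x)) $ k" for k
    unfolding refl_def dot_linear assms(1,2)
    using assms(3) by (simp add: dot_linear assms(1,2)) algebra
  then show ?thesis by (simp add: vec_eq_iff)
qed

text \<open>At the value 1/2 the product has order 4. Its square is -1 on the span of
  \<open>e\<close> and \<open>n\<close> and 1 on the common kernel of \<open>m\<close> and
  \<open>e'\<close>, and is unchanged when the factors trade places.\<close>

lemma refl_braid4:
  assumes "dot m n = 1" "dot e' e = 1" "2 * (dot m e * dot e' n) = 1"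
  shows "refl e' e (refl m n (refl e' e (refl m n x)))
      = x - (4 * (dot e' x - dot e' n * dot m x)) *s e - (4 * (dot m x - dot m e * dot e' x)) *s n"
    and "refl e' e (refl m n (refl e' e (refl m n x))) = refl m n (refl e' e (refl m n (refl e' e x)))"
proof -
  have "refl e' e (refl m n (refl e' e (refl m n x))) $ k
      = (x - (4 * (dot e' x - dot e' n * dot m x)) *s e - (4 * (dot m x - dot m e * dot e' x)) *s n) $ k" for k
    unfolding refl_def dot_linear assms(1,2)
    using assms(3) by (simp add: dot_linear assms(1,2)) algebra
  then show *: "refl e' e (refl m n (refl e' e (refl m n x)))
      = x - (4 * (dot e' x - dot e' n * dot m x)) *s e - (4 * (dot m x - dot m e * dot e' x)) *s n"
    by (simp add: vec_eq_iff)
  have "refl m n (refl e' e (refl m n (refl e' e x))) $ k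
      = (x - (4 * (dot e' x - dot e' n * dot m x)) *s e - (4 * (dot m x - dot m e * dot e' x)) *s n) $ k" for k
    unfolding refl_def dot_linear assms(1,2)
    using assms(3) by (simp add: dot_linear assms(1,2)) algebra
  then show "refl e' e (refl m n (refl e' e (refl m n x))) = refl m n (refl e' e (refl m n (refl e' e x)))"
    unfolding * by (simp add: vec_eq_iff)
qed

text \<open>If one pairing vanishes, the square of the product is a transvection, trivial only if
  the other pairing vanishes too. This is the ambiguity left by the value 0 of cos^2.\<close>

lemma refl_product_square:
  assumes "dot m n = 1" "dot e' e = 1"
  shows "dot e' n = 0 \<Longrightarrow> refl e' e (refl m n (refl e' e (refl m n x))) = x + (4 * dot m e * dot e' x) *s n"
    and "dot m e = 0 \<Longrightarrow> refl e' e (refl m n (refl e' e (refl m n x))) = x + (- 4 * dot e' n * dot m x) *s e"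
proof -
  assume 0: "dot e' n = 0"
  have "refl e' e (refl m n (refl e' e (refl m n x))) $ k = (x + (4 * dot m e * dot e' x) *s n) $ k" for k
    unfolding refl_def dot_linear assms(1,2)
    by (simp add: dot_linear assms(1,2) 0 algebra_simps)
  then show "refl e' e (refl m n (refl e' e (refl m n x))) = x + (4 * dot m e * dot e' x) *s n"
    by (simp add: vec_eq_iff)
next
  assume 0: "dot m e = 0"
  have "refl e' e (refl m n (refl e' e (refl m n x))) $ k = (x + (- 4 * dot e' n * dot m x) *s e) $ k" for k
    unfolding refl_def dot_linear assms(1,2)
    by (simp add: dot_linear assms(1,2) 0 algebra_simps)
  then show "refl e' e (refl m n (refl e' e (refl m n x))) = x + (- 4 * dot e' n * dot m x) *s e"
    by (simp add: vec_eq_iff)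
qed

text \<open>The substitution preserves a form with unique double factor \<open>z\<close>, hence the line \<open>z = 0\<close>.\<close>

lemma double_factor_preserved:
  fixes p q r s h t :: complex
  assumes T: "\<And>y z. (r * y + s * z)\<^sup>2 * (h * (r * y + s * z)\<^sup>2 + t * (p * y + q * z)\<^sup>2) = z\<^sup>2 * (h * z\<^sup>2 + t * y\<^sup>2)"
    and h: "h \<noteq> 0" and inv: "p * s - q * r \<noteq> 0"
  shows "r = 0"
proof (rule ccontr)
  assume r: "r \<noteq> 0"
  have "r\<^sup>2 * (h * r\<^sup>2 + t * p\<^sup>2) = 0" using T[of 1 0] by simp
  then have 1: "h * r\<^sup>2 + t * p\<^sup>2 = 0" using r by simp
  \<comment> \<open>Up to a factor this is the coefficient of \<open>y ^ 3 * z\<close> on the left,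
    isolated by the values at \<open>z\<close> equal to 1, -1, 2, -2; on the right that coefficient
    is 0.\<close>
  have "24 * (r * s * (h * r\<^sup>2 + t * p\<^sup>2) + r\<^sup>2 * (h * r * s + t * p * q)) = 0"
    using T[of 1 1] T[of 1 "-1"] T[of 1 2] T[of 1 "-2"] by simp algebra
  then have "r\<^sup>2 * (h * r * s + t * p * q) = 0" unfolding 1 by simp
  then have 2: "h * r * s + t * p * q = 0" using r by simp
  have "t * p * (p * s - q * r) = 0" using 1 2 by algebra
  then have "t * p = 0" using inv by simp
  then have "t * p\<^sup>2 = 0" by (auto simp: power2_eq_square)
  then have "h * r\<^sup>2 = 0" using 1 by (simp only: add_0_right)
  then show False using h r by simp
qed

text \<open>Eliminate one term of the quartic \<open>R\<close> by the square of the quadratic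
  \<open>Q\<close>, where \<open>e\<close> disappears: \<open>a\<^sup>2 R - Q\<^sup>2\<close> has
  the double factor \<open>z\<close>. If \<open>a = 0\<close>, then
  \<open>b\<^sup>2 R - Q\<^sup>2\<close> has the double factor \<open>y\<close>. The mixed
  coefficient of \<open>Q\<close> settles the other entry.\<close>

lemma quadratic_pair_preserved:
  fixes p q r s e a b c :: complex
  assumes Q: "\<And>y z. e * (a * (p * y + q * z)\<^sup>2 + b * (r * y + s * z)\<^sup>2) = a * y\<^sup>2 + b * z\<^sup>2"
    and R: "\<And>y z. (p * y + q * z) ^ 4 + (r * y + s * z) ^ 4 + c * (p * y + q * z)\<^sup>2 * (r * y + s * z)\<^sup>2
      = y ^ 4 + z ^ 4 + c * y\<^sup>2 * z\<^sup>2"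
    and e: "e\<^sup>2 = 1" and inv: "p * s - q * r \<noteq> 0" and ab: "a\<^sup>2 \<noteq> b\<^sup>2"
  shows "q = 0 \<and> r = 0"
proof -
  have e0: "e \<noteq> 0" using e by auto
  have "4 * e * (a * p * q + b * r * s) = 0" using Q[of 1 1] Q[of 1 "-1"] by simp algebra
  then have pq: "a * p * q + b * r * s = 0" using e0 by simp
  have Q2: "(a * (p * y + q * z)\<^sup>2 + b * (r * y + s * z)\<^sup>2)\<^sup>2 = (a * y\<^sup>2 + b * z\<^sup>2)\<^sup>2" for y z
    using Q[of y z] e by algebra
  show ?thesis
  proof (cases "a = 0")
    case False
    have "(r * y + s * z)\<^sup>2 * ((a\<^sup>2 - b\<^sup>2) * (r * y + s * z)\<^sup>2 + (a\<^sup>2 * c - 2 * a * b) * (p * y + q * z)\<^sup>2)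
        = z\<^sup>2 * ((a\<^sup>2 - b\<^sup>2) * z\<^sup>2 + (a\<^sup>2 * c - 2 * a * b) * y\<^sup>2)" for y z
      using Q2[of y z] R[of y z] by algebra
    then have "r = 0" by (rule double_factor_preserved) (use ab inv in auto)
    then show ?thesis using pq inv False by auto
  next
    case True
    then have b: "b \<noteq> 0" using ab by auto
    have "b\<^sup>2 * ((q * z + p * y)\<^sup>2 * (1 * (q * z + p * y)\<^sup>2 + c * (s * z + r * y)\<^sup>2))
        = b\<^sup>2 * (y\<^sup>2 * (1 * y\<^sup>2 + c * z\<^sup>2))" for z y
      using Q2[of y z] R[of y z] unfolding True by algebra
    then have "(q * z + p * y)\<^sup>2 * (1 * (q * z + p * y)\<^sup>2 + c * (s * z + r * y)\<^sup>2)
        = y\<^sup>2 * (1 * y\<^sup>2 + c * z\<^sup>2)" for z y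
      using b by simp
    then have "q = 0" by (rule double_factor_preserved) (use inv in \<open>auto simp: algebra_simps\<close>)
    then show ?thesis using pq inv True b by auto
  qed
qed

lemma matrix_vector_3: "(D *v x) $ i = D $ i $ 1 * x $ 1 + D $ i $ 2 * x $ 2 + D $ i $ 3 * (x $ 3 :: complex)"
  for D :: "complex^3^3"
  by (simp add: matrix_vector_mult_def sum_3)

lemma matrix_axis: "(D *v axis k 1) $ i = (D $ i $ k :: complex)" for D :: "complex^3^3"
  using exhaust_3[of k] by (auto simp: matrix_vector_3 axis_def)

lemma qform_explicit: "qform a b c x = (x$1) ^ 4 + (x$2) ^ 4 + (x$3) ^ 4 + a * (x$1)\<^sup>2 * (x$2)\<^sup>2
   + b * (x$1)\<^sup>2 * (x$3)\<^sup>2 + c * (x$2)\<^sup>2 * (x$3)\<^sup>2"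
  by (simp add: qform_def conic_def flip: power_mult)

lemma qform_flip: "qform a b c (flip i x) = qform a b c x"
  by (simp add: qform_def)

locale distinct_quartic = smooth_quartic +
  assumes distinct: "a\<^sup>2 \<noteq> b\<^sup>2" "a\<^sup>2 \<noteq> c\<^sup>2" "b\<^sup>2 \<noteq> c\<^sup>2"
begin

text \<open>Commuting with \<open>flip l\<close> splits \<open>D\<close> into the entry at
  \<open>l\<close> and a 2 by 2 block. In \<open>F = w ^ 4 + w\<^sup>2 Q + R\<close>, with
  \<open>w\<close> the coordinate \<open>l\<close>, the block preserves \<open>R\<close>, and
  \<open>Q\<close> up to the square of that entry. The two coefficients of \<open>Q\<close> are
  among \<open>a\<close>, \<open>b\<close>, \<open>c\<close>, so their squares differ.\<close>

lemma flip_centralizer_diagonal: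
  assumes D: "\<And>x. F (D *v x) = F x" and comm: "\<And>x. D *v flip l x = flip l (D *v x)"
    and inj: "\<And>x. D *v x = 0 \<Longrightarrow> x = 0" and ij: "i \<noteq> j"
  shows "D $ i $ j = 0"
proof -
  have off: "D $ l $ k = 0 \<and> D $ k $ l = 0" if "k \<noteq> l" for k
  proof -
    have "flip l (axis k 1) = axis k 1" "flip l (axis l 1) = - axis l 1"
      using that by (auto simp: vec_eq_iff flip_nth axis_def)
    then have 1: "D *v axis k 1 = flip l (D *v axis k 1)" and 2: "- (D *v axis l 1) = flip l (D *v axis l 1)"
      using comm[of "axis k 1"] comm[of "axis l 1"] by (simp_all add: vec.neg)
    have "D $ l $ k = - (D $ l $ k)" "- (D $ k $ l) = D $ k $ l"
      using arg_cong[OF 1, of "\<lambda>v. v $ l"] arg_cong[OF 2, of "\<lambda>v. v $ k"] that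
      by (simp_all add: flip_nth matrix_axis)
    then show ?thesis by simp
  qed
  have det: "det D \<noteq> 0"
    using inj by (metis invertible_det_nz invertible_left_inverse matrix_left_invertible_ker)
  have e: "(D $ l $ l) ^ 4 = 1"
  proof -
    have "D *v axis l 1 = D $ l $ l *s axis l 1"
    proof -
      have "D $ i $ l = D $ l $ l * axis l 1 $ i" for i
        using off[of i] by (cases "i = l") (auto simp: axis_def)
      then show ?thesis unfolding vec_eq_iff matrix_axis vector_smult_component by blast
    qed
    moreover have "F (axis l 1) = 1" using exhaust_3[of l] by (auto simp: qform_explicit axis_def)
    ultimately show ?thesis using D[of "axis l 1"] by (simp add: qform_scale)
  qed
  then have e2: "((D $ l $ l)\<^sup>2)\<^sup>2 = 1" by simp
  consider "l = 1" | "l = 2" | "l = 3" using exhaust_3 by blast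
  then have "\<forall>i1 i2. i1 \<noteq> l \<longrightarrow> i2 \<noteq> l \<longrightarrow> i1 \<noteq> i2 \<longrightarrow> D $ i1 $ i2 = 0"
  proof cases
    case 1
    have E: "F (D *v vector [x, y, z]) = F (vector [x, y, z])" for x y z by (rule D)
    have o: "D$1$2 = 0" "D$1$3 = 0" "D$2$1 = 0" "D$3$1 = 0" using off 1 by auto
    have R: "(D$2$2 * y + D$2$3 * z) ^ 4 + (D$3$2 * y + D$3$3 * z) ^ 4
        + c * (D$2$2 * y + D$2$3 * z)\<^sup>2 * (D$3$2 * y + D$3$3 * z)\<^sup>2 = y ^ 4 + z ^ 4 + c * y\<^sup>2 * z\<^sup>2" for y z
      using E[of 0 y z] o by (simp add: qform_explicit matrix_vector_3)
    have Q: "(D$1$1)\<^sup>2 * (a * (D$2$2 * y + D$2$3 * z)\<^sup>2 + b * (D$3$2 * y + D$3$3 * z)\<^sup>2) = a * y\<^sup>2 + b * z\<^sup>2" for y z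
      using E[of 1 y z] o R[of y z] e[unfolded 1] by (simp add: qform_explicit matrix_vector_3) algebra
    have "det D = D$1$1 * (D$2$2 * D$3$3 - D$2$3 * D$3$2)"
      by (simp add: det_3 o algebra_simps)
    then have "D $ 2 $ 3 = 0 \<and> D $ 3 $ 2 = 0"
      using det e2 distinct 1 by (intro quadratic_pair_preserved[OF Q R]) auto
    then show ?thesis using 1 exhaust_3 by metis
  next
    case 2
    have E: "F (D *v vector [x, y, z]) = F (vector [x, y, z])" for x y z by (rule D)
    have o: "D$2$1 = 0" "D$2$3 = 0" "D$1$2 = 0" "D$3$2 = 0" using off 2 by auto
    have R: "(D$1$1 * y + D$1$3 * z) ^ 4 + (D$3$1 * y + D$3$3 * z) ^ 4
        + b * (D$1$1 * y + D$1$3 * z)\<^sup>2 * (D$3$1 * y + D$3$3 * z)\<^sup>2 = y ^ 4 + z ^ 4 + b * y\<^sup>2 * z\<^sup>2" for y z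
      using E[of y 0 z] o by (simp add: qform_explicit matrix_vector_3)
    have Q: "(D$2$2)\<^sup>2 * (a * (D$1$1 * y + D$1$3 * z)\<^sup>2 + c * (D$3$1 * y + D$3$3 * z)\<^sup>2) = a * y\<^sup>2 + c * z\<^sup>2" for y z
      using E[of y 1 z] o R[of y z] e[unfolded 2] by (simp add: qform_explicit matrix_vector_3) algebra
    have "det D = D$2$2 * (D$1$1 * D$3$3 - D$1$3 * D$3$1)"
      by (simp add: det_3 o algebra_simps)
    then have "D $ 1 $ 3 = 0 \<and> D $ 3 $ 1 = 0"
      using det e2 distinct 2 by (intro quadratic_pair_preserved[OF Q R]) auto
    then show ?thesis using 2 exhaust_3 by metis
  next
    case 3
    have E: "F (D *v vector [x, y, z]) = F (vector [x, y, z])" for x y z by (rule D)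
    have o: "D$3$1 = 0" "D$3$2 = 0" "D$1$3 = 0" "D$2$3 = 0" using off 3 by auto
    have R: "(D$1$1 * y + D$1$2 * z) ^ 4 + (D$2$1 * y + D$2$2 * z) ^ 4
        + a * (D$1$1 * y + D$1$2 * z)\<^sup>2 * (D$2$1 * y + D$2$2 * z)\<^sup>2 = y ^ 4 + z ^ 4 + a * y\<^sup>2 * z\<^sup>2" for y z
      using E[of y z 0] o by (simp add: qform_explicit matrix_vector_3)
    have Q: "(D$3$3)\<^sup>2 * (b * (D$1$1 * y + D$1$2 * z)\<^sup>2 + c * (D$2$1 * y + D$2$2 * z)\<^sup>2) = b * y\<^sup>2 + c * z\<^sup>2" for y z
      using E[of y z 1] o R[of y z] e[unfolded 3] by (simp add: qform_explicit matrix_vector_3) algebra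
    have "det D = D$3$3 * (D$1$1 * D$2$2 - D$1$2 * D$2$1)"
      by (simp add: det_3 o algebra_simps)
    then have "D $ 1 $ 2 = 0 \<and> D $ 2 $ 1 = 0"
      using det e2 distinct 3 by (intro quadratic_pair_preserved[OF Q R]) auto
    then show ?thesis using 3 exhaust_3 by metis
  qed
  then show ?thesis using off ij by metis
qed

end

section \<open>Reduction to monomial maps\<close>

context smooth_quartic
begin

text \<open>All iterates preserve \<open>F\<close>, so on lines in the direction \<open>n\<close>
  the quartic takes one value too often for its two leading coefficients to survive. Their vanishing
  makes \<open>n\<close> a singular point.\<close>

lemma transvection_trivial:
  assumes inv: "\<And>x. F (x + dot m x *s n) = F x" and mn: "dot m n = 0" and m: "m \<noteq> 0"
  shows "n = 0"
proof (rule ccontr)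
  assume n: "n \<noteq> 0"
  have it: "F (x + (of_nat k * dot m x) *s n) = F x" for x k
  proof (induction k)
    case (Suc k)
    let ?y = "x + (of_nat k * dot m x) *s n"
    have "dot m ?y = dot m x" by (simp add: dot_linear mn)
    then have "?y + dot m ?y *s n = x + (of_nat (Suc k) * dot m x) *s n"
      by (simp add: vec_eq_iff algebra_simps)
    then show ?case using inv[of ?y] Suc by metis
  qed simp
  have 1: "F n = 0 \<and> dot (dF n) x = 0" if x: "dot m x \<noteq> 0" for x
  proof -
    define s where "s = dot m x"
    obtain d1 d2 where d: "\<And>z. F (x + z *s n) = F x + d1 * z + d2 * z\<^sup>2 + dot (dF n) x * z ^ 3 + F n * z ^ 4"
      using quartic_in_parameter[of a b c x n] by blast
    have e: "d1 * (of_nat k * s) + d2 * (of_nat k * s)\<^sup>2 + dot (dF n) x * (of_nat k * s) ^ 3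
        + F n * (of_nat k * s) ^ 4 = 0" for k
      using d[of "of_nat k * s"] it[of x k] by (simp add: s_def algebra_simps)
    \<comment> \<open>Finite differences isolate the leading coefficient; 24 is 4!, and 6 below is
      3!.\<close>
    have "24 * (F n * s ^ 4) = 0" using e[of 1] e[of 2] e[of 3] e[of 4] by simp algebra
    then have "F n = 0" using x by (simp add: s_def)
    moreover from this have "6 * (dot (dF n) x * s ^ 3) = 0" using e[of 1] e[of 2] e[of 3] by simp algebra
    then have "dot (dF n) x = 0" using x by (simp add: s_def)
    ultimately show ?thesis by simp
  qed
  obtain i where i: "m $ i \<noteq> 0" using m by (auto simp: vec_eq_iff)
  then have i': "dot m (axis i 1) \<noteq> 0" by (simp add: dot_axis)
  have "dot (dF n) x = 0" for x
  proof (cases "dot m x = 0")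
    case True
    then have "dot m (x + axis i 1) \<noteq> 0" using i' by (simp add: dot_linear)
    then have "dot (dF n) (x + axis i 1) = 0" using 1 by blast
    then show ?thesis using 1[OF i'] by (simp add: dot_linear)
  qed (use 1 in blast)
  then have "dF n $ k = 0" for k using dot_axis(2)[of "dF n" k] by metis
  then have "dF n = 0" by (simp add: vec_eq_iff)
  then show False using smooth[OF n] 1[OF i'] by blast
qed

lemma gradient_of_equal_restrictions:
  assumes "\<And>z. F (v + z *s w) = F (v' + z *s w')"
  shows "dot (dF v) w = dot (dF v') w'"
proof -
  have "((\<lambda>z. F (v + z *s w)) has_field_derivative dot (dF (v + 0 *s w)) w) (at 0)"
    "((\<lambda>z. F (v' + z *s w')) has_field_derivative dot (dF (v' + 0 *s w')) w') (at 0)"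
    by (rule qform_deriv[OF curve_deriv_line])+
  then show ?thesis using assms DERIV_unique by fastforce
qed

text \<open>Cramer's rule: the matrix with rows \<open>(4 f u - 1, - 2 f)\<close> and
  \<open>(2 u, - 1)\<close> has trace \<open>4 f u - 2\<close> and determinant 1, so the factor is
  the determinant of the system.\<close>

lemma eliminate:
  fixes L :: complex
  assumes "L * ((4 * f * u - 1) * p - 2 * f * q) = p" "L * (2 * u * p - q) = q"
  shows "(1 - (4 * f * u - 2) * L + L\<^sup>2) * p = 0" "(1 - (4 * f * u - 2) * L + L\<^sup>2) * q = 0"
proof -
  have "(1 - (4 * f * u - 2) * L + L\<^sup>2) * p
      = (1 + L) * (p - L * ((4 * f * u - 1) * p - 2 * f * q)) + 2 * f * L * (L * (2 * u * p - q) - q)"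
    by algebra
  then show "(1 - (4 * f * u - 2) * L + L\<^sup>2) * p = 0" using assms by simp
  have "(1 - (4 * f * u - 2) * L + L\<^sup>2) * q
      = 2 * u * L * (p - L * ((4 * f * u - 1) * p - 2 * f * q)) + (L * (4 * f * u - 1) - 1) * (L * (2 * u * p - q) - q)"
    by algebra
  then show "(1 - (4 * f * u - 2) * L + L\<^sup>2) * q = 0" using assms by simp
qed

text \<open>An eigenvector of the product of the reflections with eigenvalue \<open>l\<close> either lies off the curve,
  whence \<open>l ^ 4 = 1\<close>, or the gradient there is a left eigenvector with eigenvalue \<open>1 / l ^ 3\<close>.\<close>

lemma reflection_angle:
  assumes dots: "dot m n = 1" "dot e' e = 1"
    and inv: "\<And>x. F (refl e' e x) = F x" "\<And>x. F (refl m n x) = F x"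
  shows "dot m e * dot e' n \<in> {0, 1/4, 1/2, 1}"
proof -
  define f u where "f = dot m e" and "u = dot e' n"
  define M where "M = (\<lambda>x. refl e' e (refl m n x))"
  have FM: "F (M x) = F x" for x by (simp add: M_def inv)
  have M: "M x = x - (2 * dot e' x - 4 * u * dot m x) *s e - (2 * dot m x) *s n" for x
    unfolding M_def refl_def by (simp add: dot_linear dots u_def vec_eq_iff algebra_simps)
  show ?thesis
  proof (cases "f * u = 0 \<or> f * u = 1")
    case True
    then show ?thesis by (auto simp: f_def u_def)
  next
    case False
    then have f: "f \<noteq> 0" and u: "u \<noteq> 0" and fu: "f * u \<noteq> 1" by auto
    \<comment> \<open>Root of the discriminant of the characteristic polynomial of \<open>M\<close>
      on the span of \<open>e\<close> and \<open>n\<close>, which has trace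
      \<open>4 * f * u - 2\<close> and determinant 1; \<open>l\<close> is then an eigenvalue and
      \<open>v\<close> its eigenvector.\<close>
    define D where "D = csqrt ((4 * f * u - 2)\<^sup>2 - 4)"
    have D: "D\<^sup>2 = (4 * f * u - 2)\<^sup>2 - 4" by (simp add: D_def)
    define l where "l = (4 * f * u - 2 + D) / 2"
    have l2: "2 * l = 4 * f * u - 2 + D" by (simp add: l_def)
    have "4 * (l\<^sup>2 - (4 * f * u - 2) * l + 1) = 0" using l2 D by algebra
    then have l: "l\<^sup>2 - (4 * f * u - 2) * l + 1 = 0" unfolding mult_eq_0_iff by simp
    have l0: "l \<noteq> 0" using l by auto
    define v where "v = (2 * f) *s n - (1 + l) *s e"
    have dv: "dot e' v = 2 * f * u - (1 + l)" "dot m v = (1 - l) * f"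
      by (simp_all add: v_def dot_linear dots f_def u_def algebra_simps)
    have Mv: "M v = l *s v"
    proof -
      have "(M v) $ k = (l *s v) $ k" for k
        unfolding M dv using l by (simp add: v_def) algebra
      then show ?thesis by (simp add: vec_eq_iff)
    qed
    have v0: "v \<noteq> 0"
    proof
      assume "v = 0"
      then have "2 * f * u - (1 + l) = 0" "(1 - l) * f = 0" using dv by (simp_all add: dot_def)
      then show False using f fu by auto
    qed
    have ln: "l ^ 4 = 1 \<or> l ^ 3 = 1"
    proof (cases "F v = 0")
      case False
      moreover have "F v = l ^ 4 * F v" using FM[of v] unfolding Mv qform_scale by simp
      ultimately show ?thesis by simp
    next
      case True
      have G: "dF v \<noteq> 0" using smooth[OF v0 True] .
      have grad: "l ^ 3 * dot (dF v) (M w) = dot (dF v) w" for w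
      proof -
        have "M (v + z *s w) = l *s v + z *s M w" for z
        proof -
          have "M (v + z *s w) = M v + z *s M w"
            unfolding M by (simp add: dot_linear vec_eq_iff algebra_simps)
          then show ?thesis using Mv by simp
        qed
        then have "F (l *s v + z *s M w) = F (v + z *s w)" for z using FM by metis
        then have "dot (dF (l *s v)) (M w) = dot (dF v) w" by (rule gradient_of_equal_restrictions)
        then show ?thesis unfolding qgrad_scale by (simp add: dot_def algebra_simps)
      qed
      define p q where "p = dot (dF v) e" and "q = dot (dF v) n"
      have Mw: "dot (dF v) (M w) = dot (dF v) w - (2 * dot e' w - 4 * u * dot m w) * p - 2 * dot m w * q" for w
        unfolding M dot_linear p_def q_def ..
      have pe: "l ^ 3 * ((4 * f * u - 1) * p - 2 * f * q) = p"
        using grad[of e] unfolding Mw by (simp add: dots f_def[symmetric] p_def[symmetric] algebra_simps)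
      have qe: "l ^ 3 * (2 * u * p - q) = q"
        using grad[of n] unfolding Mw by (simp add: dots u_def[symmetric] q_def[symmetric] algebra_simps)
      show ?thesis
      proof (cases "p = 0 \<and> q = 0")
        case True
        then have "l ^ 3 * dot (dF v) w = dot (dF v) w" for w using grad[of w] unfolding Mw by simp
        moreover obtain i where "dF v $ i \<noteq> 0" using G by (auto simp: vec_eq_iff)
        then have "dot (dF v) (axis i 1) \<noteq> 0" by (simp add: dot_axis)
        ultimately have "l ^ 3 = 1" by (metis mult_cancel_right1)
        then show ?thesis ..
      next
        case False
        define K where "K = 1 - (4 * f * u - 2) * l ^ 3 + (l ^ 3)\<^sup>2"
        have "K * p = 0" "K * q = 0" unfolding K_def by (rule eliminate[OF pe qe])+
        then have "K = 0" using False by auto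
        \<comment> \<open>Since \<open>4 * f * u - 2\<close> is \<open>l + 1 / l\<close>, the
          polynomial factors as (1 - l L) (1 - L / l), taken at L = l^3.\<close>
        moreover have "K * l = (1 - l ^ 2) * (1 - l ^ 4) * l"
          using l unfolding K_def by algebra
        ultimately have "(1 - l ^ 2) * (1 - l ^ 4) = 0" using l0 by simp
        then have "l ^ 2 = 1 \<or> l ^ 4 = 1" by auto
        then show ?thesis by (metis power2_eq_square power4_eq_xxxx mult_1)
      qed
    qed
    \<comment> \<open>From \<open>4 * f * u = (l + 1)\<^sup>2 / l\<close> the four factors times
      \<open>l\<close> are (l-1)^2, (l+1)^2, l^2+1 and l^2+l+1; their product is a multiple of
      (l^4-1) (l^3-1).\<close>
    have "(4 * (f * u) - 4) * (4 * (f * u)) * (4 * (f * u) - 2) * (4 * (f * u) - 1) = 0"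
    proof -
      from ln have "(l ^ 4 - 1) * (l ^ 3 - 1) = 0" by auto
      then have "((4 * (f * u) - 4) * (4 * (f * u)) * (4 * (f * u) - 2) * (4 * (f * u) - 1)) * (l ^ 4) = 0"
        using l by algebra
      then show ?thesis using l0 by simp
    qed
    then have "f * u = 1 \<or> f * u = 0 \<or> 4 * (f * u) = 2 \<or> 4 * (f * u) = 1" by auto
    then show ?thesis unfolding f_def[symmetric] u_def[symmetric] by (auto simp: field_simps)
  qed
qed

text \<open>If just one pairing vanished, the square of the product would be a nontrivial
  transvection preserving the form.\<close>

lemma orthogonal_reflections_commute:
  assumes dots: "dot m n = 1" "dot e' e = 1"
    and inv: "\<And>x. F (refl e' e x) = F x" "\<And>x. F (refl m n x) = F x"
    and 0: "dot m e * dot e' n = 0"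
  shows "dot m e = 0 \<and> dot e' n = 0"
proof (rule ccontr)
  assume neg: "\<not> ?thesis"
  have I: "F (refl e' e (refl m n (refl e' e (refl m n x)))) = F x" for x by (simp add: inv)
  have nz: "m \<noteq> 0" "n \<noteq> 0" "e \<noteq> 0" "e' \<noteq> 0" using dots by (auto simp: dot_def)
  have sc: "dot (k *s x) y = k * dot x y" for k x y by (simp add: dot_def algebra_simps)
  show False
  proof (cases "dot e' n = 0")
    case True
    then have "dot m e \<noteq> 0" using neg by simp
    have "n = 0"
    proof (rule transvection_trivial)
      show "F (x + dot ((4 * dot m e) *s e') x *s n) = F x" for x
        using I[of x] unfolding refl_product_square(1)[OF dots True] sc .
      show "dot ((4 * dot m e) *s e') n = 0" by (simp only: sc True mult_zero_right)
      show "(4 * dot m e) *s e' \<noteq> 0" using \<open>dot m e \<noteq> 0\<close> nz by simp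
    qed
    then show False using nz by simp
  next
    case False
    then have me: "dot m e = 0" using 0 by simp
    have "e = 0"
    proof (rule transvection_trivial)
      show "F (x + dot ((- 4 * dot e' n) *s m) x *s e) = F x" for x
        using I[of x] unfolding refl_product_square(2)[OF dots me] sc .
      show "dot ((- 4 * dot e' n) *s m) e = 0" by (simp only: sc me mult_zero_right)
      show "(- 4 * dot e' n) *s m \<noteq> 0" using False nz by simp
    qed
    then show False using nz by simp
  qed
qed

end

lemma other_indices: "\<exists>r s :: 3. UNIV = {i, r, s} \<and> r \<noteq> i \<and> s \<noteq> i \<and> r \<noteq> s"
proof -
  have "(UNIV :: 3 set) = {1, 2, 3}" "(UNIV :: 3 set) = {2, 1, 3}" "(UNIV :: 3 set) = {3, 1, 2}"
    by (auto simp: UNIV_3)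
  moreover have "(1::3) \<noteq> 2" "(1::3) \<noteq> 3" "(2::3) \<noteq> 3" by simp_all
  ultimately show ?thesis using exhaust_3[of i] by metis
qed

definition flipm :: "3 \<Rightarrow> complex^3^3" where
  "flipm i = (\<chi> r s. if r = s then if r = i then -1 else 1 else 0)"

lemma flipm_vector: "flipm i *v x = flip i x"
  using exhaust_3[of i] by (auto simp: vec3_eq_iff matrix_vector_3 flipm_def flip_nth)

locale linear_equiv = X: distinct_quartic a b c + Y: distinct_quartic a' b' c'
  for a b c a' b' c' :: complex +
  fixes A B :: "complex^3^3" and k :: complex
  assumes BA: "B ** A = mat 1" and AB: "A ** B = mat 1" and k: "k \<noteq> 0"
    and equiv: "Y.F (A *v x) = k * X.F x"
begin

lemma BAx [simp]: "B *v (A *v x) = x" and ABx [simp]: "A *v (B *v x) = x"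
  by (simp_all add: matrix_vector_mul_assoc BA AB)

text \<open>\<open>flip j\<close> of the target transported to the source: the elements t of the
  conjugate group.\<close>

definition tau :: "3 \<Rightarrow> complex^3 \<Rightarrow> complex^3" where
  "tau j x = B *v flip j (A *v x)"

lemma tau_matrix: "tau j x = (B ** flipm j ** A) *v x"
  by (simp add: tau_def flipm_vector flip: matrix_vector_mul_assoc)

lemma dot_row: "dot (row j A) x = (A *v x) $ j"
  by (simp add: dot_def row_def matrix_vector_3)

lemma tau_refl: "tau j = refl (row j A) (column j B)"
proof
  fix x
  have "column j B = B *v axis j 1" by (simp add: vec_eq_iff column_def matrix_axis)
  moreover have "B *v flip j (A *v x) = B *v (A *v x) - (2 * (A *v x) $ j) *s (B *v axis j 1)"
    unfolding flip_eq_refl refl_def by (simp add: dot_axis vec.diff vec.scale)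
  ultimately show "tau j x = refl (row j A) (column j B) x"
    by (simp add: tau_def refl_def dot_row)
qed

lemma X_tau: "X.F (tau j x) = X.F x"
proof -
  have "k * X.F (tau j x) = Y.F (flip j (A *v x))" using equiv[of "tau j x"] by (simp add: tau_def)
  also have "\<dots> = k * X.F x" by (simp add: qform_flip equiv)
  finally show ?thesis using k by simp
qed

lemma dots: "dot (row j A) (column j B) = 1" "dot (axis i 1) (axis i 1) = 1"
    "dot (row j A) (axis i 1) = A $ j $ i" "dot (axis i 1) (column j B) = B $ i $ j"
proof -
  have "dot (row j A) (column j B) = (A ** B) $ j $ j"
    by (simp add: dot_def row_def column_def matrix_matrix_mult_def sum_3)
  then show "dot (row j A) (column j B) = 1" by (simp add: AB mat_def)
  show "dot (axis i 1) (axis i 1) = 1" unfolding dot_axis by (simp add: axis_def)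
  show "dot (row j A) (axis i 1) = A $ j $ i" by (simp add: dot_axis row_def)
  show "dot (axis i 1) (column j B) = B $ i $ j" by (simp add: dot_axis column_def)
qed

lemmas X_flip = qform_flip[of a b c, unfolded flip_eq_refl] and X_tau' = X_tau[unfolded tau_refl]

text \<open>For \<open>flip i\<close> and \<open>tau j\<close> the two pairings are the matrix
  entries \<open>A $ j $ i\<close> and \<open>B $ i $ j\<close>.\<close>

lemma angle: "A $ j $ i * B $ i $ j \<in> {0, 1/4, 1/2, 1}"
  using X.reflection_angle[OF dots(1,2) X_flip X_tau', of j i] by (simp add: dots)

lemma angle_0:
  assumes "A $ j $ i * B $ i $ j = 0" shows "A $ j $ i = 0"
  using X.orthogonal_reflections_commute[OF dots(1,2) X_flip X_tau', of j i] assms by (simp add: dots)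

definition monomial :: bool where
  "monomial \<longleftrightarrow> (\<forall>j. \<exists>i. A $ j $ i \<noteq> 0 \<and> (\<forall>m. m \<noteq> i \<longrightarrow> A $ j $ m = 0))"

text \<open>Every \<open>flip j\<close> commutes with \<open>flip l'\<close>, so every
  \<open>tau j\<close> commutes with \<open>flip l\<close> and is diagonal. Its entries off the
  diagonal are -2 times \<open>A $ j $ s * B $ r $ j\<close>, so a nonzero \<open>B $ i $ j\<close>
  leaves only \<open>A $ j $ i\<close> in row \<open>j\<close>.\<close>

lemma monomial_if_intertwines_flip:
  assumes comm: "\<And>x. A *v flip l x = flip l' (A *v x)"
  shows monomial
  unfolding monomial_def
proof
  fix j
  let ?T = "B ** flipm j ** A"
  have comm': "B *v flip l' x = flip l (B *v x)" for x
    using comm[of "B *v x"] BAx by (metis ABx)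
  have T: "?T *v x = tau j x" for x by (simp add: tau_matrix)
  have diag: "?T $ r $ s = 0" if "r \<noteq> s" for r s
  proof (rule X.flip_centralizer_diagonal[OF _ _ _ that])
    show "X.F (?T *v x) = X.F x" for x unfolding T by (rule X_tau)
    show "?T *v flip l x = flip l (?T *v x)" for x
      unfolding T tau_def comm by (simp add: flip_commute[of j l'] comm')
    show "x = 0" if "?T *v x = 0" for x
    proof -
      have "tau j (tau j x) = x" by (simp add: tau_def)
      moreover have "tau j 0 = 0" by (simp add: tau_matrix)
      ultimately show ?thesis using that T by metis
    qed
  qed
  have prod: "A $ j $ s * B $ r $ j = 0" if "r \<noteq> s" for r s
  proof -
    have "?T $ r $ s = tau j (axis s 1) $ r" by (simp add: tau_matrix matrix_axis)
    also have "\<dots> = - 2 * (A $ j $ s * B $ r $ j)"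
    proof -
      have "axis s 1 $ r = (0::complex)" using that by (simp add: axis_def)
      then show ?thesis unfolding tau_refl refl_def by (simp add: dots column_def)
    qed
    finally show ?thesis using diag[OF that] by simp
  qed
  have "(\<Sum>i\<in>UNIV. A $ j $ i * B $ i $ j) = 1"
    using dots(1)[of j] by (simp add: dot_def row_def column_def sum_3)
  then have "\<not> (\<forall>i. A $ j $ i * B $ i $ j = 0)" by (intro notI) simp
  then obtain i where i: "A $ j $ i * B $ i $ j \<noteq> 0" by blast
  have "A $ j $ m = 0" if "m \<noteq> i" for m
    using prod[of i m] that i by auto
  then show "\<exists>i. A $ j $ i \<noteq> 0 \<and> (\<forall>m. m \<noteq> i \<longrightarrow> A $ j $ m = 0)"
    using i by auto
qed

text \<open>The square of \<open>st\<close>, with \<open>s = flip i\<close> and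
  \<open>t = tau j\<close>, commutes with \<open>flip i\<close> and so is diagonal. Its entry at
  \<open>i\<close> is -1. The two other products \<open>A $ j $ r * B $ r $ j\<close> add up to 1/2
  and one of them is 0, so the remaining diagonal entries are 1 and -1.\<close>

lemma angle_half:
  assumes "2 * (A $ j $ i * B $ i $ j) = 1"
  shows "\<exists>l. \<forall>x. flip i (tau j (flip i (tau j x))) = - flip l x"
    and "flip i (tau j (flip i (tau j x))) = tau j (flip i (tau j (flip i x)))"
proof -
  note d = assms[folded dots(3,4)]
  note br = refl_braid4[OF dots(1,2) d, folded flip_eq_refl tau_refl,
    unfolded dots(3,4), unfolded dot_axis]
  show comm: "flip i (tau j (flip i (tau j x))) = tau j (flip i (tau j (flip i x)))" for x
    by (rule br(2))
  let ?D = "flipm i ** (B ** flipm j ** A) ** flipm i ** (B ** flipm j ** A)"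
  have D: "?D *v x = flip i (tau j (flip i (tau j x)))" for x
    by (simp add: tau_matrix flipm_vector flip: matrix_vector_mul_assoc)
  have diag: "?D $ r $ s = 0" if "r \<noteq> s" for r s
  proof (rule X.flip_centralizer_diagonal[OF _ _ _ that])
    show "X.F (?D *v x) = X.F x" for x unfolding D by (simp add: qform_flip X_tau)
    show "?D *v flip i x = flip i (?D *v x)" for x unfolding D using comm[of "flip i x"] comm[of x] by simp
    show "x = 0" if "?D *v x = 0" for x
    proof -
      have t: "tau j (tau j y) = y" for y by (simp add: tau_def)
      have "tau j 0 = 0" "flip i 0 = 0" by (simp_all add: tau_matrix vec_eq_iff flip_nth)
      then show ?thesis using that unfolding D by (metis t flip_flip)
    qed
  qed
  have Dx: "(?D *v x) $ r = x $ r - 4 * (x $ i - B $ i $ j * dot (row j A) x) * axis i 1 $ r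
      - 4 * (dot (row j A) x - A $ j $ i * x $ i) * B $ r $ j" for x r
    unfolding D br(1) by (simp add: column_def algebra_simps)
  have Drs: "?D $ r $ s = axis s 1 $ r - 4 * (axis s 1 $ i - B $ i $ j * A $ j $ s) * axis i 1 $ r
      - 4 * (A $ j $ s - A $ j $ i * axis s 1 $ i) * B $ r $ j" for r s
    using Dx[of "axis s 1" r] by (simp only: matrix_axis dots)
  have Dii: "?D $ i $ i = -1" unfolding Drs using assms by (simp add: axis_def algebra_simps)
  have Drr: "?D $ r $ r = 1 - 4 * (A $ j $ r * B $ r $ j)" if "r \<noteq> i" for r
    unfolding Drs using that by (simp add: axis_def)
  have off: "A $ j $ s * B $ r $ j = 0" if "r \<noteq> i" "s \<noteq> i" "r \<noteq> s" for r s
    using diag[OF that(3)] that unfolding Drs by (simp add: axis_def)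
  obtain r s where rs: "UNIV = {i, r, s}" "r \<noteq> i" "s \<noteq> i" "r \<noteq> s"
    using other_indices[of i] by blast
  have "(\<Sum>i\<in>UNIV. A $ j $ i * B $ i $ j) = 1"
    using dots(1)[of j] by (simp add: dot_def row_def column_def sum_3)
  then have sum: "2 * (A $ j $ r * B $ r $ j) + 2 * (A $ j $ s * B $ s $ j) = 1"
  proof -
    have "A $ j $ i * B $ i $ j + (A $ j $ r * B $ r $ j + A $ j $ s * B $ s $ j) = 1"
      using \<open>(\<Sum>i\<in>UNIV. A $ j $ i * B $ i $ j) = 1\<close> unfolding rs(1) using rs(2-4) by simp
    then show ?thesis using assms by algebra
  qed
  have "A $ j $ r * B $ r $ j = 0 \<or> A $ j $ s * B $ s $ j = 0"
    using off[OF rs(2,3,4)] off[OF rs(3,2) rs(4)[symmetric]] by auto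
  then obtain l where l: "l \<noteq> i" "?D $ l $ l = 1" "\<And>r. r \<noteq> l \<Longrightarrow> ?D $ r $ r = -1"
  proof
    assume 0: "A $ j $ r * B $ r $ j = 0"
    have "2 * (A $ j $ s * B $ s $ j) = 1" using sum unfolding 0 by simp
    then have "?D $ s $ s = -1" unfolding Drr[OF rs(3)] by (simp add: algebra_simps)
    moreover have "?D $ r $ r = 1" unfolding Drr[OF rs(2)] 0 by simp
    moreover have "q = i \<or> q = s" if "q \<noteq> r" for q using that UNIV_I[of q] unfolding rs(1) by blast
    ultimately show ?thesis using that[of r] Dii rs(2) by blast
  next
    assume 0: "A $ j $ s * B $ s $ j = 0"
    have "2 * (A $ j $ r * B $ r $ j) = 1" using sum unfolding 0 by simp
    then have "?D $ r $ r = -1" unfolding Drr[OF rs(2)] by (simp add: algebra_simps)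
    moreover have "?D $ s $ s = 1" unfolding Drr[OF rs(3)] 0 by simp
    moreover have "q = i \<or> q = r" if "q \<noteq> s" for q using that UNIV_I[of q] unfolding rs(1) by blast
    ultimately show ?thesis using that[of s] Dii rs(3) by blast
  qed
  have "flip i (tau j (flip i (tau j x))) $ r = - flip l x $ r" for x r
  proof -
    have "(?D *v x) $ r = (\<Sum>s\<in>UNIV. if s = r then ?D $ r $ r * x $ r else 0)"
      unfolding matrix_vector_mult_def vec_lambda_beta by (rule sum.cong[OF refl]) (use diag in auto)
    then show ?thesis using l(2,3) unfolding D by (auto simp: flip_nth)
  qed
  then show "\<exists>l. \<forall>x. flip i (tau j (flip i (tau j x))) = - flip l x"
    by (intro exI[of _ l]) (simp add: vec_eq_iff)
qed

lemma inverse_equiv: "linear_equiv a' b' c' a b c B A (1 / k)"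
proof
  show "X.F (B *v x) = 1 / k * Y.F x" for x using equiv[of "B *v x"] k by simp
qed (use AB BA k in auto)

text \<open>\<open>angle_half\<close> for the equivalence and for its inverse shows that the squared
  product is a negated sign change on both sides, and \<open>A\<close> intertwines the two.\<close>

lemma monomial_if_angle_half:
  assumes "2 * (A $ j $ i * B $ i $ j) = 1"
  shows monomial
proof -
  interpret inv: linear_equiv a' b' c' a b c B A "1 / k" by (rule inverse_equiv)
  obtain l where l: "\<And>x. flip i (tau j (flip i (tau j x))) = - flip l x"
    using angle_half(1)[OF assms] by blast
  have as': "2 * (B $ i $ j * A $ j $ i) = 1" using assms by (simp add: mult.commute)
  obtain l' where l': "\<And>x. flip j (inv.tau i (flip j (inv.tau i x))) = - flip l' x"
    using inv.angle_half(1)[OF as'] by blast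
  have "A *v flip l x = flip l' (A *v x)" for x
  proof -
    have "A *v (- flip l x) = inv.tau i (flip j (inv.tau i (flip j (A *v x))))"
      unfolding l[symmetric] by (simp add: tau_def inv.tau_def)
    also have "\<dots> = - flip l' (A *v x)" using inv.angle_half(2)[OF as'] l' by metis
    finally show ?thesis by (simp add: vec.neg)
  qed
  then show ?thesis by (rule monomial_if_intertwines_flip)
qed

text \<open>The three products of a row add up to a diagonal entry of \<open>A ** B\<close>, so
  exactly one of them is 1; \<open>angle_0\<close> turns the vanishing products into vanishing
  entries of \<open>A\<close>.\<close>

lemma monomial_if_angle_trivial:
  assumes "\<And>i j. A $ j $ i * B $ i $ j = 0 \<or> A $ j $ i * B $ i $ j = 1"
  shows monomial
  unfolding monomial_def
proof
  fix j
  have s: "A $ j $ 1 * B $ 1 $ j + A $ j $ 2 * B $ 2 $ j + A $ j $ 3 * B $ 3 $ j = 1"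
    using dots(1)[of j] by (simp add: dot_def row_def column_def)
  then obtain i where "A $ j $ i * B $ i $ j = 1" "\<And>m. m \<noteq> i \<Longrightarrow> A $ j $ m * B $ m $ j = 0"
  proof -
    define x where "x = (\<lambda>i. A $ j $ i * B $ i $ j)"
    have x: "x i = 0 \<or> x i = 1" for i using assms unfolding x_def by blast
    have "x 1 + x 2 + x 3 = 1" using s unfolding x_def .
    then have "x 1 = 1 \<and> x 2 = 0 \<and> x 3 = 0 \<or> x 2 = 1 \<and> x 1 = 0 \<and> x 3 = 0 \<or> x 3 = 1 \<and> x 1 = 0 \<and> x 2 = 0"
      using x[of 1] x[of 2] x[of 3] by auto
    then have "\<exists>i. x i = 1 \<and> (\<forall>m. m \<noteq> i \<longrightarrow> x m = 0)"
      unfolding forall_3 by (elim disjE) (rule exI[of _ 1], simp, rule exI[of _ 2], simp, rule exI[of _ 3], simp)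
    then show ?thesis using that unfolding x_def by blast
  qed
  then show "\<exists>i. A $ j $ i \<noteq> 0 \<and> (\<forall>m. m \<noteq> i \<longrightarrow> A $ j $ m = 0)"
    using angle_0 by (intro exI[of _ i]) auto
qed

lemma exists_monomial: "\<exists>A B k. linear_equiv a b c a' b' c' A B k \<and> linear_equiv.monomial A"
proof -
  consider (triv) "\<forall>i j. A $ j $ i * B $ i $ j = 0 \<or> A $ j $ i * B $ i $ j = 1"
    | (half) i j where "2 * (A $ j $ i * B $ i $ j) = 1"
    | (quarter) i j where "4 * (A $ j $ i * B $ i $ j) = 1"
    using angle by (auto simp: field_simps) metis
  then show ?thesis
  proof cases
    case triv
    then have monomial by (intro monomial_if_angle_trivial) auto
    then show ?thesis using linear_equiv_axioms by blast
  next
    case half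
    then have monomial by (rule monomial_if_angle_half)
    then show ?thesis using linear_equiv_axioms by blast
  next
    case quarter
    note br = refl_braid3[OF dots(1,2) quarter[folded dots(3,4)], folded flip_eq_refl tau_refl]
    \<comment> \<open>With \<open>s = flip i\<close> and \<open>t = tau j\<close>, the relation
      \<open>sts = tst\<close> says that \<open>st\<close> conjugates \<open>s\<close> to
      \<open>t\<close>. Composing \<open>A\<close> with the automorphism \<open>st\<close> gives an
      equivalence that carries \<open>flip i\<close> to \<open>flip j\<close>.\<close>
    let ?A = "A ** flipm i ** B ** flipm j ** A"
    let ?B = "B ** flipm j ** A ** flipm i ** B"
    have A: "?A *v x = A *v flip i (tau j x)" for x
      by (simp add: tau_def flipm_vector flip: matrix_vector_mul_assoc)
    have B: "?B *v x = tau j (flip i (B *v x))" for x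
      by (simp add: tau_def flipm_vector flip: matrix_vector_mul_assoc)
    have tt: "tau j (tau j x) = x" for x by (simp add: tau_def)
    have "(?B ** ?A) *v x = mat 1 *v x" "(?A ** ?B) *v x = mat 1 *v x" for x
      by (simp_all add: matrix_vector_mul_assoc[symmetric, of ?A] matrix_vector_mul_assoc[symmetric, of ?B]
          A B tt del: matrix_vector_mul_assoc)
    then have BA': "?B ** ?A = mat 1" "?A ** ?B = mat 1" using matrix_eq by blast+
    interpret new: linear_equiv a b c a' b' c' ?A ?B k
    proof
      show "Y.F (?A *v x) = k * X.F x" for x unfolding A equiv qform_flip X_tau ..
    qed (use BA' k in auto)
    have "?A *v flip i x = flip j (?A *v x)" for x
    proof -
      have "B *v (?A *v flip i x) = tau j (flip i (tau j x))" unfolding A using br by simp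
      also have "\<dots> = B *v flip j (?A *v x)" unfolding A by (simp add: tau_def)
      finally show ?thesis by (metis ABx)
    qed
    then have new.monomial by (rule new.monomial_if_intertwines_flip)
    then show ?thesis using new.linear_equiv_axioms by blast
  qed
qed

end

section \<open>Projective points and regular maps\<close>

text \<open>Fourth powers show that the squared entries \<open>\<beta> j\<close> have square
  \<open>k\<close>; the mixed terms then give the signs \<open>k / (\<beta> i * \<beta> j)\<close>.
  The product of the three signs is \<open>k ^ 3\<close> over the product of the squares of all
  \<open>\<beta> j\<close>, that is 1.\<close>

lemma (in linear_equiv) monomial_coefficients:
  assumes monomial
  shows "\<exists>p q r s1 s2 s3. a' = s1 * p \<and> b' = s2 * q \<and> c' = s3 * r \<and>
    s1\<^sup>2 = 1 \<and> s2\<^sup>2 = 1 \<and> s3\<^sup>2 = 1 \<and> s1 * s2 * s3 = 1 \<and>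
    (p, q, r) \<in> {(a, b, c), (a, c, b), (b, a, c), (b, c, a), (c, a, b), (c, b, a)}"
proof -
  obtain \<pi> where \<pi>: "\<And>j. A $ j $ \<pi> j \<noteq> 0" "\<And>j m. m \<noteq> \<pi> j \<Longrightarrow> A $ j $ m = 0"
    using assms unfolding monomial_def by metis
  have Ax: "(A *v x) $ j = A $ j $ \<pi> j * x $ \<pi> j" for x j
  proof -
    have "(A *v x) $ j = (\<Sum>m\<in>UNIV. if m = \<pi> j then A $ j $ \<pi> j * x $ \<pi> j else 0)"
      unfolding matrix_vector_mult_def vec_lambda_beta by (rule sum.cong[OF refl]) (use \<pi>(2) in auto)
    then show ?thesis by simp
  qed
  have inj: "\<pi> i \<noteq> \<pi> j" if "i \<noteq> j" for i j
  proof
    assume eq: "\<pi> i = \<pi> j"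
    have "(A *v (B *v axis i 1)) $ j = 0" "(A *v (B *v axis i 1)) $ i = 1"
      using that by (simp_all add: axis_def)
    then show False unfolding Ax eq using \<pi>(1) by auto
  qed
  define \<beta> where "\<beta> = (\<lambda>j. (A $ j $ \<pi> j)\<^sup>2)"
  \<comment> \<open>For distinct \<open>i\<close> and \<open>j\<close> each fourth power contributes
    1, so this is the coefficient at the squares of coordinates \<open>i\<close> and
    \<open>j\<close>.\<close>
  define co where "co = (\<lambda>i j. X.F (axis i 1 + axis j 1) - 2)"
  have Aax: "A *v axis (\<pi> j) 1 = A $ j $ \<pi> j *s axis j 1" for j
  proof -
    have "(A *v axis (\<pi> j) 1) $ i = (A $ j $ \<pi> j *s axis j 1) $ i" for i
      unfolding Ax using inj[of i j] by (cases "i = j") (simp_all add: axis_def)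
    then show ?thesis by (simp add: vec_eq_iff)
  qed
  have F1: "qform a b c (axis i 1) = 1" for a b c i
    using exhaust_3[of i] by (auto simp: qform_explicit axis_def)
  have \<beta>2: "(\<beta> j)\<^sup>2 = k" for j
    using equiv[of "axis (\<pi> j) 1"] unfolding Aax qform_scale F1 by (simp add: \<beta>_def)
  have G: "Y.F (A *v (axis (\<pi> i) 1 + axis (\<pi> j) 1)) = k * (co (\<pi> i) (\<pi> j) + 2)" for i j
    unfolding equiv co_def by simp
  have 1: "a' * (\<beta> 1 * \<beta> 2) = k * co (\<pi> 1) (\<pi> 2)"
    using G[of 1 2] \<beta>2[of 1] \<beta>2[of 2] unfolding vec.add Aax
    by (simp add: qform_explicit axis_def \<beta>_def algebra_simps)
  have 2: "b' * (\<beta> 1 * \<beta> 3) = k * co (\<pi> 1) (\<pi> 3)"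
    using G[of 1 3] \<beta>2[of 1] \<beta>2[of 3] unfolding vec.add Aax
    by (simp add: qform_explicit axis_def \<beta>_def algebra_simps)
  have 3: "c' * (\<beta> 2 * \<beta> 3) = k * co (\<pi> 2) (\<pi> 3)"
    using G[of 2 3] \<beta>2[of 2] \<beta>2[of 3] unfolding vec.add Aax
    by (simp add: qform_explicit axis_def \<beta>_def algebra_simps)
  have \<beta>0: "\<beta> j \<noteq> 0" for j using \<beta>2[of j] k by auto
  define s where "s = (\<lambda>i j. k / (\<beta> i * \<beta> j))"
  have "a' = s 1 2 * co (\<pi> 1) (\<pi> 2)" "b' = s 1 3 * co (\<pi> 1) (\<pi> 3)" "c' = s 2 3 * co (\<pi> 2) (\<pi> 3)"
    using 1 2 3 \<beta>0 by (simp_all add: s_def field_simps)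
  moreover have "(s i j)\<^sup>2 = 1" for i j
    using k by (simp add: s_def power_divide power_mult_distrib \<beta>2 power2_eq_square[of k])
  moreover have "s 1 2 * s 1 3 * s 2 3 = 1"
  proof -
    have "s 1 2 * s 1 3 * s 2 3 = k ^ 3 / ((\<beta> 1)\<^sup>2 * (\<beta> 2)\<^sup>2 * (\<beta> 3)\<^sup>2)"
      by (simp add: s_def power2_eq_square power3_eq_cube)
    then show ?thesis using k by (simp add: \<beta>2 power3_eq_cube)
  qed
  moreover have "(co (\<pi> 1) (\<pi> 2), co (\<pi> 1) (\<pi> 3), co (\<pi> 2) (\<pi> 3))
      \<in> {(a, b, c), (a, c, b), (b, a, c), (b, c, a), (c, a, b), (c, b, a)}"
  proof -
    have co: "co 1 2 = a" "co 1 3 = b" "co 2 3 = c" "co 2 1 = a" "co 3 1 = b" "co 3 2 = c"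
      by (simp_all add: co_def qform_explicit axis_def)
    have "\<pi> 1 \<noteq> \<pi> 2" "\<pi> 1 \<noteq> \<pi> 3" "\<pi> 2 \<noteq> \<pi> 3" by (rule inj, simp)+
    then show ?thesis
      using exhaust_3[of "\<pi> 1"] exhaust_3[of "\<pi> 2"] exhaust_3[of "\<pi> 3"]
      by (elim disjE) (simp_all add: co)
  qed
  ultimately show ?thesis by blast
qed

section \<open>Evaluation and partial derivatives of polynomials\<close>

lemma mpoly_eval_superset:
  assumes "finite S" "Poly_Mapping.keys f \<subseteq> S"
  shows "mpoly_eval f x = (\<Sum>m\<in>S. Poly_Mapping.lookup f m *
     (\<Prod>i\<in>Poly_Mapping.keys m. x i ^ Poly_Mapping.lookup m i))"
  unfolding mpoly_eval_def by (rule sum.mono_neutral_left) (use assms in \<open>auto simp: in_keys_iff\<close>)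

lemma mpoly_eval_add: "mpoly_eval (f + g) x = mpoly_eval f x + mpoly_eval g x"
proof -
  let ?S = "Poly_Mapping.keys f \<union> Poly_Mapping.keys g"
  have "finite ?S" "Poly_Mapping.keys (f + g) \<subseteq> ?S" by (auto simp: keys_add)
  then show ?thesis
    by (simp add: mpoly_eval_superset[of ?S] lookup_add distrib_right sum.distrib)
qed

lemma mpoly_pderiv_superset:
  assumes "finite S" "Poly_Mapping.keys f \<subseteq> S"
  shows "mpoly_pderiv i f = (\<Sum>m\<in>S. Poly_Mapping.single (m - Poly_Mapping.single i 1)
       (of_nat (Poly_Mapping.lookup m i) * Poly_Mapping.lookup f m))"
  unfolding mpoly_pderiv_def by (rule sum.mono_neutral_left) (use assms in \<open>auto simp: in_keys_iff\<close>)

lemma mpoly_pderiv_add: "mpoly_pderiv i (f + g) = mpoly_pderiv i f + mpoly_pderiv i g"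
proof -
  let ?S = "Poly_Mapping.keys f \<union> Poly_Mapping.keys g"
  have "finite ?S" "Poly_Mapping.keys (f + g) \<subseteq> ?S" by (auto simp: keys_add)
  then show ?thesis
    by (simp add: mpoly_pderiv_superset[of ?S] lookup_add distrib_left sum.distrib single_add)
qed

definition expo :: "nat \<Rightarrow> nat \<Rightarrow> nat \<Rightarrow> nat \<Rightarrow>\<^sub>0 nat" where
  "expo i j k = Poly_Mapping.single 0 i + Poly_Mapping.single 1 j + Poly_Mapping.single 2 k"

abbreviation mono3 :: "nat \<Rightarrow> nat \<Rightarrow> nat \<Rightarrow> complex \<Rightarrow> complex mpoly" where
  "mono3 i j k \<equiv> Poly_Mapping.single (expo i j k)"

lemma lookup_expo: "Poly_Mapping.lookup (expo i j k) n =
    (if n = 0 then i else if n = 1 then j else if n = 2 then k else 0)"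
  by (simp add: expo_def lookup_add lookup_single when_def)

lemma keys_expo: "Poly_Mapping.keys (expo i j k) \<subseteq> {..2}"
  by (auto simp: in_keys_iff lookup_expo split: if_splits)

lemma atMost_2: "{..2::nat} = {0, 1, 2}"
  by auto

lemma mpoly_eval_mono3: "mpoly_eval (mono3 i j k v) x = v * x 0 ^ i * x 1 ^ j * x 2 ^ k"
proof -
  have "(\<Prod>l\<in>Poly_Mapping.keys (expo i j k). x l ^ Poly_Mapping.lookup (expo i j k) l)
     = (\<Prod>l\<le>2. x l ^ Poly_Mapping.lookup (expo i j k) l)"
    by (rule prod.mono_neutral_left) (use keys_expo in \<open>auto simp: in_keys_iff\<close>)
  also have "\<dots> = x 0 ^ i * x 1 ^ j * x 2 ^ k" by (simp add: atMost_2 lookup_expo)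
  finally show ?thesis
    by (simp add: mpoly_eval_superset[of "{expo i j k}"] mult.assoc)
qed

lemma mpoly_pderiv_mono3:
  "mpoly_pderiv 0 (mono3 i j k v) = mono3 (i - 1) j k (of_nat i * v)"
  "mpoly_pderiv (Suc 0) (mono3 i j k v) = mono3 i (j - 1) k (of_nat j * v)"
  "mpoly_pderiv 2 (mono3 i j k v) = mono3 i j (k - 1) (of_nat k * v)"
proof -
  have "expo i j k - Poly_Mapping.single 0 1 = expo (i - 1) j k"
    "expo i j k - Poly_Mapping.single 1 1 = expo i (j - 1) k"
    "expo i j k - Poly_Mapping.single 2 1 = expo i j (k - 1)"
    by (rule poly_mapping_eqI, simp add: lookup_expo lookup_minus lookup_single when_def)+
  then show "mpoly_pderiv 0 (mono3 i j k v) = mono3 (i - 1) j k (of_nat i * v)"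
    "mpoly_pderiv (Suc 0) (mono3 i j k v) = mono3 i (j - 1) k (of_nat j * v)"
    "mpoly_pderiv 2 (mono3 i j k v) = mono3 i j (k - 1) (of_nat k * v)"
    by (simp_all add: mpoly_pderiv_superset[of "{expo i j k}"] lookup_expo)
qed

lemma is_form_add: "is_form n d f \<Longrightarrow> is_form n d g \<Longrightarrow> is_form n d (f + g)"
  unfolding is_form_def using keys_add[of f g] by blast

lemma is_form_mono3:
  assumes "i + j + k = d" shows "is_form 2 d (mono3 i j k v)"
proof -
  have "(\<Sum>l\<in>Poly_Mapping.keys (expo i j k). Poly_Mapping.lookup (expo i j k) l)
     = (\<Sum>l\<le>2. Poly_Mapping.lookup (expo i j k) l)"
    by (rule sum.mono_neutral_left) (use keys_expo in \<open>auto simp: in_keys_iff\<close>)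
  also have "\<dots> = d" using assms by (simp add: atMost_2 lookup_expo)
  finally show ?thesis
    unfolding is_form_def using keys_expo by (auto split: if_splits)
qed

lemma mpoly_eval_scale:
  assumes "is_form n d f"
  shows "mpoly_eval f (\<lambda>i. t * x i) = t ^ d * mpoly_eval f x"
proof -
  have "(\<Prod>i\<in>Poly_Mapping.keys m. (t * x i) ^ Poly_Mapping.lookup m i)
      = t ^ d * (\<Prod>i\<in>Poly_Mapping.keys m. x i ^ Poly_Mapping.lookup m i)"
    if "m \<in> Poly_Mapping.keys f" for m
    using assms that unfolding is_form_def
    by (simp add: power_mult_distrib prod.distrib flip: power_sum)
  then show ?thesis
    unfolding mpoly_eval_def sum_distrib_left by (intro sum.cong) (auto simp: mult_ac)
qed

section \<open>Vectors of \<open>complex^3\<close> as homogeneous coordinates\<close>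

definition tf :: "complex^3 \<Rightarrow> nat \<Rightarrow> complex" where
  "tf v = (\<lambda>n. if n = 0 then v $ 1 else if n = 1 then v $ 2 else if n = 2 then v $ 3 else 0)"

definition ft :: "(nat \<Rightarrow> complex) \<Rightarrow> complex^3" where
  "ft x = vector [x 0, x 1, x 2]"

lemma tf_nth [simp]: "tf v 0 = v $ 1" "tf v 1 = v $ 2" "tf v (Suc 0) = v $ 2" "tf v 2 = v $ 3"
  by (simp_all add: tf_def)

lemma ft_nth [simp]: "ft x $ 1 = x 0" "ft x $ 2 = x 1" "ft x $ 3 = x 2"
  by (simp_all add: ft_def)

lemma ft_tf [simp]: "ft (tf v) = v"
  by (simp add: vec3_eq_iff)

lemma tf_inject: "tf v = tf w \<longleftrightarrow> v = w"
  by (metis ft_tf)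

lemma tf_coord: "tf v \<in> coord_vectors 2"
  by (simp add: tf_def coord_vectors_def)

lemma tf_ft: "x \<in> coord_vectors 2 \<Longrightarrow> tf (ft x) = x"
proof
  fix n assume "x \<in> coord_vectors 2"
  then have "n > 2 \<Longrightarrow> x n = 0" by (simp add: coord_vectors_def)
  moreover consider "n = 0" | "n = 1" | "n = 2" | "n > 2" by linarith
  ultimately show "tf (ft x) n = x n" by cases (simp_all add: tf_def)
qed

lemma tf_scale: "tf (t *s v) = (\<lambda>i. t * tf v i)"
  by (rule ext) (simp add: tf_def)

lemma tf_0: "tf v = (\<lambda>_. 0) \<longleftrightarrow> v = 0"
proof -
  have "tf 0 = (\<lambda>_. 0)" by (rule ext) (simp add: tf_def)
  then show ?thesis by (metis tf_inject)
qed

lemma proj_point_eq_iff: "proj_point x = proj_point y \<longleftrightarrow> (\<exists>t. t \<noteq> 0 \<and> y = (\<lambda>i. t * x i))"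
proof
  assume "proj_point x = proj_point y"
  moreover have "y \<in> proj_point y" unfolding proj_point_def by (auto intro!: exI[of _ 1])
  ultimately show "\<exists>t. t \<noteq> 0 \<and> y = (\<lambda>i. t * x i)" unfolding proj_point_def by auto
next
  assume "\<exists>t. t \<noteq> 0 \<and> y = (\<lambda>i. t * x i)"
  then obtain t where t: "t \<noteq> 0" "y = (\<lambda>i. t * x i)" by blast
  show "proj_point x = proj_point y"
    unfolding proj_point_def t(2)
  proof (intro equalityI subsetI; clarsimp)
    fix s :: 'a assume "s \<noteq> 0"
    then show "\<exists>u. (\<lambda>i. s * x i) = (\<lambda>i. u * (t * x i)) \<and> u \<noteq> 0"
      using t(1) by (intro exI[of _ "s / t"]) auto
next
    fix s :: 'a assume "s \<noteq> 0"
    then show "\<exists>u. (\<lambda>i. s * (t * x i)) = (\<lambda>i. u * x i) \<and> u \<noteq> 0"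
      using t(1) by (intro exI[of _ "s * t"]) (auto simp: mult.assoc)
  qed
qed

abbreviation pt :: "complex^3 \<Rightarrow> (nat \<Rightarrow> complex) set" where
  "pt v \<equiv> proj_point (tf v)"

lemma pt_eq_iff: "pt v = pt w \<longleftrightarrow> (\<exists>t. t \<noteq> 0 \<and> w = t *s v)"
  unfolding proj_point_eq_iff tf_scale[symmetric] tf_inject by auto

lemma common_zeros_tf: "common_zeros 2 {f} = tf ` {v. v \<noteq> 0 \<and> mpoly_eval f (tf v) = 0}"
proof (intro equalityI subsetI)
  fix x assume x: "x \<in> common_zeros 2 {f}"
  then have "x = tf (ft x)" by (simp add: common_zeros_def tf_ft)
  moreover from this x have "ft x \<noteq> 0" "mpoly_eval f (tf (ft x)) = 0"
    unfolding common_zeros_def tf_0[symmetric] by auto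
  ultimately show "x \<in> tf ` {v. v \<noteq> 0 \<and> mpoly_eval f (tf v) = 0}" by blast
next
  fix x assume "x \<in> tf ` {v. v \<noteq> 0 \<and> mpoly_eval f (tf v) = 0}"
  then show "x \<in> common_zeros 2 {f}" unfolding common_zeros_def by (auto simp: tf_coord tf_0)
qed

lemma proj_set_pt: "proj_set 2 {f} = pt ` {v. v \<noteq> 0 \<and> mpoly_eval f (tf v) = 0}"
  unfolding proj_set_def common_zeros_tf by (simp add: image_image)

lemma mem_pt: "x \<in> pt v \<longleftrightarrow> (\<exists>t. t \<noteq> 0 \<and> x = tf (t *s v))"
  unfolding proj_point_def tf_scale by auto

text \<open>All homogeneous polynomial lifts of \<open>\<phi>\<close>, of any degree; nothing is
  required at the zeros of a lift. The forms in the definition of a regular map supply enough of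
  them.\<close>

definition map_rep ::
  "complex mpoly \<Rightarrow> ((nat \<Rightarrow> complex) set \<Rightarrow> (nat \<Rightarrow> complex) set) \<Rightarrow> (complex^3 \<Rightarrow> complex^3) set" where
  "map_rep f \<phi> = {G. polymap G \<and> (\<exists>d. homogeneous d G) \<and>
     (\<forall>v. v \<noteq> 0 \<longrightarrow> mpoly_eval f (tf v) = 0 \<longrightarrow> G v \<noteq> 0 \<longrightarrow> \<phi> (pt v) = pt (G v))}"

lemma polyfun_mpoly_eval: "(\<lambda>v. mpoly_eval f (tf v)) \<in> polyfun"
  unfolding mpoly_eval_def
proof (intro polyfun_intros)
  fix i
  show "(\<lambda>v. tf v i) \<in> polyfun"
    unfolding tf_def by (cases "i = 0"; cases "i = 1"; cases "i = 2") (auto intro: polyfun_intros)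
qed

lemma map_rep_cover:
  assumes reg: "regular_map 2 {f} 2 {f'} \<phi>" and v: "v \<noteq> 0" "mpoly_eval f (tf v) = 0"
  shows "\<exists>G\<in>map_rep f \<phi>. G v \<noteq> 0"
proof -
  have "pt v \<in> proj_set 2 {f}" unfolding proj_set_pt using v by blast
  from bspec[OF conjunct2[OF reg[unfolded regular_map_def]] this]
  obtain d g where form: "\<forall>j\<le>2. is_form 2 d (g j)"
    and nz: "\<exists>x\<in>pt v. \<exists>j\<le>2. mpoly_eval (g j) x \<noteq> 0"
    and eq: "\<forall>Q\<in>proj_set 2 {f}. \<forall>x\<in>Q. (\<exists>j\<le>2. mpoly_eval (g j) x \<noteq> 0) \<longrightarrow>
       \<phi> Q = proj_point (\<lambda>j. if j \<le> 2 then mpoly_eval (g j) x else 0)"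
    by (elim exE conjE)
  define G where "G = (\<lambda>w. ft (\<lambda>j. mpoly_eval (g j) (tf w)))"
  have tfG: "tf (G w) = (\<lambda>j. if j \<le> 2 then mpoly_eval (g j) (tf w) else 0)" for w
    unfolding G_def tf_def by (rule ext) (auto simp: le_Suc_eq eval_nat_numeral)
  have G0: "G w \<noteq> 0 \<longleftrightarrow> (\<exists>j\<le>2. mpoly_eval (g j) (tf w) \<noteq> 0)" for w
    unfolding tf_0[symmetric] tfG by (auto simp: fun_eq_iff)
  have "mpoly_eval (g j) (\<lambda>i. t * x i) = t ^ d * mpoly_eval (g j) x" if "j \<le> 2" for j t x
    by (rule mpoly_eval_scale) (use form that in blast)
  then have hom: "G (t *s w) = t ^ d *s G w" for t w
    by (simp add: vec3_eq_iff G_def tf_scale)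
  have "polymap G" unfolding polymap_def
  proof
    fix k show "(\<lambda>x. G x $ k) \<in> polyfun"
      using exhaust_3[of k] polyfun_mpoly_eval by (auto simp: G_def)
  qed
  moreover have "\<phi> (pt w) = pt (G w)" if "w \<noteq> 0" "mpoly_eval f (tf w) = 0" "G w \<noteq> 0" for w
  proof -
    have "pt w \<in> proj_set 2 {f}" unfolding proj_set_pt using that by blast
    moreover have "tf w \<in> pt w" unfolding mem_pt by (rule exI[of _ 1]) simp
    ultimately show ?thesis using eq that(3) unfolding G0 tfG by blast
  qed
  ultimately have "G \<in> map_rep f \<phi>"
    unfolding map_rep_def homogeneous_def using hom by blast
  moreover have "G v \<noteq> 0"
  proof -
    obtain x j where x: "x \<in> pt v" "j \<le> 2" "mpoly_eval (g j) x \<noteq> 0" using nz by blast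
    obtain t where "x = tf (t *s v)" using x(1) unfolding mem_pt by blast
    then have "G (t *s v) \<noteq> 0" unfolding G0 using x(2,3) by blast
    then show ?thesis unfolding hom by auto
  qed
  ultimately show ?thesis by blast
qed

lemma regular_rep_map_rep:
  assumes X: "smooth_quartic a b c" and Y: "smooth_quartic a' b' c'"
    and f: "\<And>v. mpoly_eval f (tf v) = qform a b c v" and f': "\<And>v. mpoly_eval f' (tf v) = qform a' b' c' v"
    and reg: "regular_map 2 {f} 2 {f'} \<phi>"
  shows "regular_rep a b c a' b' c' (map_rep f \<phi>)"
proof -
  interpret X: smooth_quartic a b c by fact
  interpret Y: smooth_quartic a' b' c' by fact
  show ?thesis
  proof
    show "polymap g" "\<exists>d. homogeneous d g" if "g \<in> map_rep f \<phi>" for g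
      using that by (auto simp: map_rep_def)
    show "\<exists>g\<in>map_rep f \<phi>. g x \<noteq> 0" if "x \<in> X.cone" for x
      using map_rep_cover[OF reg] that f by (simp add: X.cone_def)
    fix g x assume g: "g \<in> map_rep f \<phi>" and x: "x \<in> X.cone" and gx: "g x \<noteq> 0"
    have \<phi>: "\<phi> (pt x) = pt (g x)" using g x gx f by (simp add: map_rep_def X.cone_def)
    have "pt x \<in> proj_set 2 {f}" unfolding proj_set_pt using x f by (auto simp: X.cone_def)
    then have "pt (g x) \<in> proj_set 2 {f'}" using reg \<phi> unfolding regular_map_def by auto
    then obtain y where y: "pt (g x) = pt y" "mpoly_eval f' (tf y) = 0" unfolding proj_set_pt by blast
    then obtain t where "t \<noteq> 0" "y = t *s g x" unfolding pt_eq_iff by blast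
    then show "Y.F (g x) = 0" using y(2) unfolding f' by (simp add: qform_scale)
    fix g' assume g': "g' \<in> map_rep f \<phi>" "g' x \<noteq> 0"
    then have "\<phi> (pt x) = pt (g' x)" using x f by (simp add: map_rep_def X.cone_def)
    then show "\<exists>k. k \<noteq> 0 \<and> g' x = k *s g x" using \<phi> pt_eq_iff by simp
  qed
qed

lemma isomorphic_quartics_linear:
  assumes X: "smooth_quartic a b c" and Y: "smooth_quartic a' b' c'"
    and f: "\<And>v. mpoly_eval f (tf v) = qform a b c v" and f': "\<And>v. mpoly_eval f' (tf v) = qform a' b' c' v"
    and iso: "isomorphic_curves 2 {f} 2 {f'}"
  shows "\<exists>A B. B ** A = mat 1 \<and> (\<exists>k. \<forall>x. qform a' b' c' (A *v x) = k * qform a b c x)"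
proof -
  obtain \<phi> \<psi> where \<phi>: "regular_map 2 {f} 2 {f'} \<phi>" and \<psi>: "regular_map 2 {f'} 2 {f} \<psi>"
    and inv: "\<forall>P\<in>proj_set 2 {f}. \<psi> (\<phi> P) = P"
    using iso unfolding isomorphic_curves_def by blast
  show ?thesis
  proof (rule isomorphism_linear)
    show R: "regular_rep a b c a' b' c' (map_rep f \<phi>)"
      by (rule regular_rep_map_rep[OF X Y f f' \<phi>])
    show "regular_rep a' b' c' a b c (map_rep f' \<psi>)"
      by (rule regular_rep_map_rep[OF Y X f' f \<psi>])
    fix x g g' assume x: "x \<noteq> 0" "qform a b c x = 0" and g: "g \<in> map_rep f \<phi>" "g x \<noteq> 0"
      and g': "g' \<in> map_rep f' \<psi>" "g' (g x) \<noteq> 0"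
    have P: "\<phi> (pt x) = pt (g x)" using g x f by (simp add: map_rep_def)
    interpret regular_rep a b c a' b' c' "map_rep f \<phi>" by (rule R)
    have "qform a' b' c' (g x) = 0" using rep_maps g x by (simp add: X.cone_def)
    then have "\<psi> (pt (g x)) = pt (g' (g x))" using g g' f' by (simp add: map_rep_def)
    moreover have "pt x \<in> proj_set 2 {f}" unfolding proj_set_pt using x f by auto
    ultimately have "pt x = pt (g' (g x))" using inv P by metis
    then show "\<exists>k. k \<noteq> 0 \<and> g' (g x) = k *s x" by (simp add: pt_eq_iff)
  qed
qed

section \<open>Real models\<close>

text \<open>Conjugation permutes the variables up to scaling by an involution, so one variable is fixed and
  quartics even in it suffice as real models.\<close>

type_synonym model_coeffs =
  "complex \<times> complex \<times> complex \<times> complex \<times> complex \<times> complex \<times> complex"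

fun model :: "model_coeffs \<Rightarrow> complex mpoly" where
  "model (e, p1, p2, q, r1, r2, s) = mono3 4 0 0 e + mono3 2 2 0 p1 + mono3 2 0 2 p2 + mono3 2 1 1 q
     + mono3 0 4 0 r1 + mono3 0 0 4 r2 + mono3 0 2 2 s"

fun model_fun :: "model_coeffs \<Rightarrow> complex^3 \<Rightarrow> complex" where
  "model_fun (e, p1, p2, q, r1, r2, s) v = e * v$1 ^ 4 + p1 * (v$1)\<^sup>2 * (v$2)\<^sup>2
     + p2 * (v$1)\<^sup>2 * (v$3)\<^sup>2 + q * (v$1)\<^sup>2 * v$2 * v$3 + r1 * v$2 ^ 4 + r2 * v$3 ^ 4
     + s * (v$2)\<^sup>2 * (v$3)\<^sup>2"

fun model_grad :: "model_coeffs \<Rightarrow> complex^3 \<Rightarrow> complex^3" where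
  "model_grad (e, p1, p2, q, r1, r2, s) v = vector [
     4 * e * v$1 ^ 3 + 2 * p1 * v$1 * (v$2)\<^sup>2 + 2 * p2 * v$1 * (v$3)\<^sup>2 + 2 * q * v$1 * v$2 * v$3,
     2 * p1 * (v$1)\<^sup>2 * v$2 + q * (v$1)\<^sup>2 * v$3 + 4 * r1 * v$2 ^ 3 + 2 * s * v$2 * (v$3)\<^sup>2,
     2 * p2 * (v$1)\<^sup>2 * v$3 + q * (v$1)\<^sup>2 * v$2 + 4 * r2 * v$3 ^ 3 + 2 * s * (v$2)\<^sup>2 * v$3]"

fun model_real :: "model_coeffs \<Rightarrow> bool" where
  "model_real (e, p1, p2, q, r1, r2, s) \<longleftrightarrow> {e, p1, p2, q, r1, r2, s} \<subseteq> \<real>"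

declare model.simps [simp del] model_fun.simps [simp del] model_grad.simps [simp del]

lemma Var_power: "Var i ^ n = Poly_Mapping.single (Poly_Mapping.single i n) (1 :: complex)"
  by (induction n) (simp_all add: Var_def mult_single flip: single_add)

lemma quartic_eq_model: "quartic a b c = model (1, a, b, 0, 1, 1, c)"
proof -
  have "Poly_Mapping.single 0 4 = expo 4 0 0" "Poly_Mapping.single 1 4 = expo 0 4 0"
    "Poly_Mapping.single 2 4 = expo 0 0 4"
    "Poly_Mapping.single 0 2 + Poly_Mapping.single 1 2 = expo 2 2 0"
    "Poly_Mapping.single 0 2 + Poly_Mapping.single 2 2 = expo 2 0 2"
    "Poly_Mapping.single 1 2 + Poly_Mapping.single 2 2 = expo 0 2 2"
    by (simp_all add: expo_def)
  then show ?thesis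
    unfolding quartic_def model.simps Var_power Const_def mult_single
    by (simp add: add_ac)
qed

lemma mpoly_eval_model: "mpoly_eval (model m) (tf v) = model_fun m v"
  by (cases m) (simp add: model.simps model_fun.simps mpoly_eval_add mpoly_eval_mono3)

lemma model_fun_quartic: "model_fun (1, a, b, 0, 1, 1, c) v = qform a b c v"
  by (simp add: model_fun.simps qform_explicit)

lemma mpoly_eval_quartic: "mpoly_eval (quartic a b c) (tf v) = qform a b c v"
  unfolding quartic_eq_model mpoly_eval_model model_fun_quartic ..

lemma mpoly_pderiv_model:
  "mpoly_eval (mpoly_pderiv 0 (model m)) (tf v) = model_grad m v $ 1"
  "mpoly_eval (mpoly_pderiv (Suc 0) (model m)) (tf v) = model_grad m v $ 2"
  "mpoly_eval (mpoly_pderiv 2 (model m)) (tf v) = model_grad m v $ 3"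
  by (cases m; simp add: model.simps model_grad.simps mpoly_pderiv_add mpoly_pderiv_mono3
      mpoly_eval_add mpoly_eval_mono3)+

lemma model_grad_quartic: "model_grad (1, a, b, 0, 1, 1, c) v = qgrad a b c v"
  by (simp add: model_grad.simps qgrad_def vec3_eq_iff power2_eq_square power3_eq_cube algebra_simps)

lemma model_deriv:
  assumes "curve_deriv p v t"
  shows "((\<lambda>z. model_fun m (p z)) has_field_derivative
    dot (model_grad m (p t)) v) (at t)"
  using assms unfolding curve_deriv_def forall_3
  by (cases m) (auto intro!: derivative_eq_intros
    simp: model_fun.simps model_grad.simps dot_def power2_eq_square power3_eq_cube algebra_simps)

lemma is_form_model: "is_form 2 4 (model m)"
  by (cases m) (simp only: model.simps, intro is_form_add is_form_mono3, simp_all)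

lemma lookup_model_real:
  assumes "model_real m"
  shows "Poly_Mapping.lookup (model m) l \<in> \<real>"
proof (cases m)
  case (fields e p1 p2 q r1 r2 s)
  then show ?thesis
    unfolding fields model.simps lookup_add lookup_single when_def
    using assms[unfolded fields] by (intro Reals_add) auto
qed

lemma map_cnj_quartic: "Poly_Mapping.map cnj (quartic a b c) = quartic (cnj a) (cnj b) (cnj c)"
proof (rule poly_mapping_eqI)
  fix m
  show "Poly_Mapping.lookup (Poly_Mapping.map cnj (quartic a b c)) m
      = Poly_Mapping.lookup (quartic (cnj a) (cnj b) (cnj c)) m"
  proof -
    have "Poly_Mapping.lookup (Poly_Mapping.map cnj p) m = cnj (Poly_Mapping.lookup p m)" for p
      by (simp add: map.rep_eq when_def)
    note map = this
    show ?thesis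
      unfolding map quartic_eq_model model.simps lookup_add lookup_single when_def by simp
  qed
qed

section \<open>Tangent cones and the Jacobian criterion\<close>

interpretation fun_space: vector_space "\<lambda>(t::complex) (v::nat \<Rightarrow> complex) i. t * v i"
  by standard (auto simp: fun_eq_iff algebra_simps)

lemma coordinate_in_span:
  assumes "v \<in> fun_space.span S" "\<And>x. x \<in> S \<Longrightarrow> x i = 0"
  shows "v i = 0"
proof -
  have "fun_space.subspace {v. v i = 0}"
    by (auto simp: fun_space.subspace_def)
  then have "fun_space.span S \<subseteq> {v. v i = 0}"
    by (intro fun_space.span_minimal) (use assms(2) in auto)
  then show ?thesis using assms(1) by blast
qed

lemma dim_coord_vectors: "fun_space.dim (coord_vectors 2) = 3"
proof -
  define u :: "nat \<Rightarrow> nat \<Rightarrow> complex" where "u = (\<lambda>i j. if i = j then 1 else 0)"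
  let ?B = "{u 0, u 1, u 2}"
  have ne: "u i \<noteq> u j" if "i \<noteq> j" for i j :: nat using that by (auto simp: u_def fun_eq_iff)
  show ?thesis
  proof (rule fun_space.dim_unique[of ?B])
    show "?B \<subseteq> coord_vectors 2" by (auto simp: u_def coord_vectors_def)
    show "coord_vectors 2 \<subseteq> fun_space.span ?B"
    proof
      fix v :: "nat \<Rightarrow> complex" assume "v \<in> coord_vectors 2"
      then have v: "v n = 0" if "n > 2" for n using that by (simp add: coord_vectors_def)
      have "v n = ((\<lambda>i. v 0 * u 0 i) + (\<lambda>i. v 1 * u 1 i) + (\<lambda>i. v 2 * u 2 i)) n" for n
      proof -
        consider "n = 0" | "n = 1" | "n = 2" | "n > 2" by linarith
        then show ?thesis by cases (simp_all add: u_def v)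
      qed
      then have "v = (\<lambda>i. v 0 * u 0 i) + (\<lambda>i. v 1 * u 1 i) + (\<lambda>i. v 2 * u 2 i)" by (rule ext)
      moreover have "(\<lambda>i. v 0 * u 0 i) + (\<lambda>i. v 1 * u 1 i) + (\<lambda>i. v 2 * u 2 i) \<in> fun_space.span ?B"
        by (intro fun_space.span_add fun_space.span_scale fun_space.span_base) auto
      ultimately show "v \<in> fun_space.span ?B" by simp
    qed
    have notin: "u i \<notin> fun_space.span S" if "\<And>x. x \<in> S \<Longrightarrow> x i = 0" for i S
    proof
      assume "u i \<in> fun_space.span S"
      then have "u i i = 0" by (rule coordinate_in_span) (rule that)
      then show False by (simp add: u_def)
    qed
    have "u 0 \<notin> fun_space.span {u 1, u 2}" by (rule notin) (auto simp: u_def)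
    moreover have "u 1 \<notin> fun_space.span {u 2}" by (rule notin) (auto simp: u_def)
    moreover have "u 2 \<notin> fun_space.span {}" by (rule notin) auto
    ultimately show "fun_space.independent ?B"
      using ne by (simp add: fun_space.independent_insert fun_space.independent_empty)
    show "card ?B = 3" using ne by simp
  qed
qed

lemma dim_hyperplane:
  fixes g :: "nat \<Rightarrow> complex"
  assumes ijk: "{..2} = {i, j, k}" "i \<noteq> j" "i \<noteq> k" "j \<noteq> k" and g: "g i \<noteq> 0"
  shows "fun_space.dim {v \<in> coord_vectors 2. (\<Sum>l\<le>2. g l * v l) = 0} = 2"
proof -
  let ?V = "{v \<in> coord_vectors 2. (\<Sum>l\<le>2. g l * v l) = 0}"
  define u where "u = (\<lambda>m l. if l = m then 1 else if l = i then - g m / g i else 0)"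
  have sum: "(\<Sum>l\<le>2. g l * v l) = g i * v i + g j * v j + g k * v k" for v
    unfolding ijk(1) using ijk(2-4) by (simp add: add_ac)
  have le: "l > 2 \<Longrightarrow> l \<noteq> i \<and> l \<noteq> j \<and> l \<noteq> k" for l
    using ijk(1) by (metis atMost_iff insertI1 insertI2 not_le)
  have uj: "u j j = 1" "u j k = 0" "u j i = - g j / g i" "u k j = 0" "u k k = 1" "u k i = - g k / g i"
    using ijk(2-4) by (auto simp: u_def)
  have ne: "u j \<noteq> u k" using uj by (metis zero_neq_one)
  show ?thesis
  proof (rule fun_space.dim_unique[of "{u j, u k}"])
    show "{u j, u k} \<subseteq> ?V" using g le by (auto simp: sum uj coord_vectors_def) (auto simp: u_def)
    show "?V \<subseteq> fun_space.span {u j, u k}"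
    proof
      fix v assume v: "v \<in> ?V"
      have vi: "v i = (- g j / g i) * v j + (- g k / g i) * v k"
      proof -
        have "g i * v i + g j * v j + g k * v k = 0" using v unfolding sum by blast
        then have "g i * v i = - g j * v j - g k * v k" by algebra
        moreover have "v i = g i * v i / g i" using g by simp
        ultimately show ?thesis by (simp add: diff_divide_distrib)
      qed
      have "v n = ((\<lambda>l. v j * u j l) + (\<lambda>l. v k * u k l)) n" for n
      proof (cases "n > 2")
        case True
        then show ?thesis using v le[OF True] by (simp add: u_def coord_vectors_def)
      next
        case False
        then have "n \<in> {i, j, k}" using ijk(1) by (metis atMost_iff not_le)
        then show ?thesis using vi by (auto simp: uj mult.commute)
      qed
      then have "v = (\<lambda>l. v j * u j l) + (\<lambda>l. v k * u k l)" by (rule ext)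
      moreover have "(\<lambda>l. v j * u j l) + (\<lambda>l. v k * u k l) \<in> fun_space.span {u j, u k}"
        by (intro fun_space.span_add fun_space.span_scale fun_space.span_base) auto
      ultimately show "v \<in> fun_space.span {u j, u k}" by simp
    qed
    have "u j \<notin> fun_space.span {u k}"
      using coordinate_in_span[of "u j" "{u k}" j] uj by auto
    moreover have "u k \<notin> fun_space.span {}"
      using coordinate_in_span[of "u k" "{}" k] uj by auto
    ultimately show "fun_space.independent {u j, u k}"
      using ne by (simp add: fun_space.independent_insert fun_space.independent_empty)
    show "card {u j, u k} = 2" using ne by simp
  qed
qed

text \<open>With one equation the tangent cone is the kernel of the gradient, of dimension 2 or,
  where the gradient vanishes, 3.\<close>

lemma smooth_curve_model:
  "smooth_curve 2 {model m} \<longleftrightarrow>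
    (\<forall>v. v \<noteq> 0 \<longrightarrow> model_fun m v = 0 \<longrightarrow> model_grad m v \<noteq> 0)"
proof -
  let ?f = "model m"
  have zeros: "common_zeros 2 {?f} = tf ` {v. v \<noteq> 0 \<and> model_fun m v = 0}"
    using common_zeros_tf[of ?f] by (simp add: mpoly_eval_model)
  have dim: "fun_space.dim (tangent_cone 2 {?f} (tf v)) = 2 \<longleftrightarrow> model_grad m v \<noteq> 0" for v
  proof -
    define g where "g = (\<lambda>i. mpoly_eval (mpoly_pderiv i ?f) (tf v))"
    have tc: "tangent_cone 2 {?f} (tf v) = {w \<in> coord_vectors 2. (\<Sum>l\<le>2. g l * w l) = 0}"
      by (simp add: tangent_cone_def g_def)
    have gi: "g 0 = model_grad m v $ 1" "g 1 = model_grad m v $ 2"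
      "g 2 = model_grad m v $ 3"
      by (simp_all add: g_def mpoly_pderiv_model)
    have grad: "model_grad m v = 0 \<longleftrightarrow> g 0 = 0 \<and> g 1 = 0 \<and> g 2 = 0"
      unfolding gi vec3_eq_iff by simp
    show ?thesis
    proof (cases "g 0 = 0 \<and> g 1 = 0 \<and> g 2 = 0")
      case True
      then have "tangent_cone 2 {?f} (tf v) = coord_vectors 2" unfolding tc by (simp add: atMost_2)
      then show ?thesis using True grad by (simp add: dim_coord_vectors)
    next
      case False
      then consider "g 0 \<noteq> 0" | "g 1 \<noteq> 0" | "g 2 \<noteq> 0" by blast
      then have "fun_space.dim (tangent_cone 2 {?f} (tf v)) = 2"
      proof cases
        case 1 then show ?thesis unfolding tc by (intro dim_hyperplane[of 0 1 2]) auto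
      next
        case 2 then show ?thesis unfolding tc by (intro dim_hyperplane[of 1 0 2]) auto
      next
        case 3 then show ?thesis unfolding tc by (intro dim_hyperplane[of 2 0 1]) auto
      qed
      then show ?thesis using False grad by simp
    qed
  qed
  show ?thesis
    unfolding smooth_curve_def zeros using is_form_model[of m] by (auto simp: dim)
qed

lemma smooth_quartic_iff: "smooth_curve 2 {quartic a b c} \<longleftrightarrow> smooth_quartic a b c"
  unfolding quartic_eq_model smooth_curve_model model_grad_quartic smooth_quartic_def
    model_fun_quartic by blast

section \<open>Linear changes of coordinates as isomorphisms\<close>

definition linear_forms :: "complex^3^3 \<Rightarrow> nat \<Rightarrow> complex mpoly" where
  "linear_forms L j = (let i = (if j = 0 then 1 else if j = 1 then 2 else 3) in
     mono3 1 0 0 (L $ i $ 1) + mono3 0 1 0 (L $ i $ 2) + mono3 0 0 1 (L $ i $ 3))"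

lemma is_form_linear_forms: "is_form 2 1 (linear_forms L j)"
  unfolding linear_forms_def Let_def by (intro is_form_add is_form_mono3) simp_all

lemma eval_linear_forms:
  "(\<lambda>j. if j \<le> 2 then mpoly_eval (linear_forms L j) (tf v) else 0) = tf (L *v v)"
proof
  fix j :: nat
  consider "j = 0" | "j = 1" | "j = 2" | "j > 2" by linarith
  then show "(if j \<le> 2 then mpoly_eval (linear_forms L j) (tf v) else 0) = tf (L *v v) j"
    by cases (simp_all add: linear_forms_def mpoly_eval_add mpoly_eval_mono3 matrix_vector_3 tf_def)
qed

lemma regular_map_linear:
  assumes L: "\<And>v. L *v v = 0 \<Longrightarrow> v = 0"
    and ff': "\<And>v. mpoly_eval f (tf v) = 0 \<Longrightarrow> mpoly_eval f' (tf (L *v v)) = 0"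
    and \<phi>: "\<And>v. \<phi> (pt v) = pt (L *v v)"
  shows "regular_map 2 {f} 2 {f'} \<phi>"
  unfolding regular_map_def
proof (intro conjI ballI)
  show "\<phi> ` proj_set 2 {f} \<subseteq> proj_set 2 {f'}"
    unfolding proj_set_pt using L ff' by (auto simp: \<phi>)
  fix P assume "P \<in> proj_set 2 {f}"
  then obtain v where v: "P = pt v" "v \<noteq> 0" unfolding proj_set_pt by blast
  show "\<exists>d g. (\<forall>j\<le>2. is_form 2 d (g j)) \<and> (\<exists>x\<in>P. \<exists>j\<le>2. mpoly_eval (g j) x \<noteq> 0) \<and>
     (\<forall>Q\<in>proj_set 2 {f}. \<forall>x\<in>Q. (\<exists>j\<le>2. mpoly_eval (g j) x \<noteq> 0) \<longrightarrow>
       \<phi> Q = proj_point (\<lambda>j. if j \<le> 2 then mpoly_eval (g j) x else 0))"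
  proof (rule exI[of _ "1::nat"], rule exI[of _ "linear_forms L"], intro conjI allI impI ballI)
    show "is_form 2 1 (linear_forms L j)" for j by (rule is_form_linear_forms)
    have "tf v \<in> P" unfolding v mem_pt by (rule exI[of _ 1]) simp
    moreover have "\<exists>j\<le>2. mpoly_eval (linear_forms L j) (tf v) \<noteq> 0"
    proof (rule ccontr)
      assume "\<not> ?thesis"
      then have "tf (L *v v) = (\<lambda>_. 0)" unfolding eval_linear_forms[symmetric] by auto
      then show False using tf_0 L v(2) by blast
    qed
    ultimately show "\<exists>x\<in>P. \<exists>j\<le>2. mpoly_eval (linear_forms L j) x \<noteq> 0" by blast
    fix Q x assume "Q \<in> proj_set 2 {f}" and x: "x \<in> Q"
    then obtain w where w: "Q = pt w" unfolding proj_set_pt by blast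
    then have "x \<in> pt w" using x by simp
    then obtain t where t: "t \<noteq> 0" "x = tf (t *s w)" unfolding mem_pt by blast
    have "pt (L *v w) = pt (L *v (t *s w))" unfolding pt_eq_iff vec.scale using t(1) by blast
    then show "\<phi> Q = proj_point (\<lambda>j. if j \<le> 2 then mpoly_eval (linear_forms L j) x else 0)"
      unfolding w t(2) \<phi> eval_linear_forms .
  qed
qed

lemma isomorphic_curves_linear:
  assumes KL: "K ** L = mat 1" and LK: "L ** K = mat 1"
    and ff': "\<And>v. mpoly_eval f' (tf (L *v v)) = mpoly_eval f (tf v)"
  shows "isomorphic_curves 2 {f} 2 {f'}"
proof -
  have KLv: "K *v (L *v v) = v" and LKv: "L *v (K *v v) = v" for v
    by (simp_all add: matrix_vector_mul_assoc KL LK)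
  \<comment> \<open>Acting on all coordinate vectors of a point at once avoids choosing a
    representative.\<close>
  define lin where "lin = (\<lambda>(M :: complex^3^3) P. (\<lambda>x. tf (M *v ft x)) ` P)"
  have lin: "lin M (pt v) = pt (M *v v)" for M v
  proof (rule set_eqI)
    fix x show "x \<in> lin M (pt v) \<longleftrightarrow> x \<in> pt (M *v v)"
      unfolding lin_def image_iff Bex_def mem_pt using vec.scale by (auto simp: vec.scale)
  qed
  show ?thesis unfolding isomorphic_curves_def
  proof (intro exI conjI ballI)
    show "regular_map 2 {f} 2 {f'} (lin L)"
    proof (rule regular_map_linear[OF _ _ lin])
      show "v = 0" if "L *v v = 0" for v using that KLv by (metis matrix_vector_mult_0_right)
    qed (simp add: ff')
    show "regular_map 2 {f'} 2 {f} (lin K)"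
    proof (rule regular_map_linear[OF _ _ lin])
      show "v = 0" if "K *v v = 0" for v using that LKv by (metis matrix_vector_mult_0_right)
      show "mpoly_eval f (tf (K *v v)) = 0" if "mpoly_eval f' (tf v) = 0" for v
        using ff'[of "K *v v"] LKv that by simp
    qed
    show "lin K (lin L P) = P" if "P \<in> proj_set 2 {f}" for P
      using that unfolding proj_set_pt by (auto simp: lin KLv)
    show "lin L (lin K P) = P" if "P \<in> proj_set 2 {f'}" for P
      using that unfolding proj_set_pt by (auto simp: lin LKv)
  qed
qed

section \<open>Real normal forms\<close>

definition has_real_model :: "complex \<Rightarrow> complex \<Rightarrow> complex \<Rightarrow> bool" where
  "has_real_model a b c \<longleftrightarrow> (\<exists>L K m. K ** L = mat 1 \<and> L ** K = mat 1 \<and>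
     model_real m \<and> (\<forall>v. model_fun m (L *v v) = qform a b c v))"

lemma field_of_definition_if_real_model:
  assumes "has_real_model a b c" "smooth_quartic a b c"
  shows "field_of_definition \<real> 2 {quartic a b c}"
proof -
  interpret smooth_quartic a b c by fact
  obtain L K m where "K ** L = mat 1 \<and> L ** K = mat 1 \<and>
     model_real m \<and> (\<forall>v. model_fun m (L *v v) = F v)"
    using assms(1) unfolding has_real_model_def by (elim exE)
  then have KL: "K ** L = mat 1" "L ** K = mat 1" and real: "model_real m"
    and eq: "model_fun m (L *v v) = F v" for v by simp_all
  let ?f = "model m"
  have "smooth_curve 2 {?f}"
    unfolding smooth_curve_model
  proof (intro allI impI notI)
    fix w assume w: "w \<noteq> 0" "model_fun m w = 0" "model_grad m w = 0"
    define v where "v = K *v w"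
    have Lv: "L *v v = w" by (simp add: v_def matrix_vector_mul_assoc KL)
    have "v \<noteq> 0" "F v = 0" using w Lv eq[of v] by auto
    then have "dF v \<noteq> 0" by (rule smooth)
    moreover have "dF v $ i = 0" for i
    proof -
      have "((\<lambda>z. F (v + z *s axis i 1)) has_field_derivative dot (dF (v + 0 *s axis i 1)) (axis i 1)) (at 0)"
        by (rule qform_deriv[OF curve_deriv_line])
      moreover have "((\<lambda>z. model_fun m (w + z *s (L *v axis i 1))) has_field_derivative
          dot (model_grad m (w + 0 *s (L *v axis i 1))) (L *v axis i 1)) (at 0)"
        by (rule model_deriv[OF curve_deriv_line])
      moreover have "w + z *s (L *v axis i 1) = L *v (v + z *s axis i 1)" for z
        by (simp add: vec.add vec.scale Lv)
      ultimately have "dot (dF v) (axis i 1) = dot 0 (L *v axis i 1)"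
        using w(3) eq by (simp add: DERIV_unique)
      then show ?thesis by (simp add: dot_axis) (simp add: dot_def)
    qed
    ultimately show False by (simp add: vec_eq_iff)
  qed
  moreover have "\<forall>f\<in>{?f}. \<forall>k. Poly_Mapping.lookup f k \<in> \<real>"
    using lookup_model_real real by simp
  moreover have "isomorphic_curves 2 {quartic a b c} 2 {?f}"
    by (rule isomorphic_curves_linear[OF KL]) (simp add: mpoly_eval_model mpoly_eval_quartic eq)
  moreover have "is_subfield (\<real> :: complex set)" by (auto simp: is_subfield_def)
  ultimately show ?thesis unfolding field_of_definition_def by blast
qed

lemma has_real_model_permute:
  assumes "has_real_model a' b' c'" "M ** N = mat 1" "N ** M = mat 1"
    and "\<And>v. qform a' b' c' (M *v v) = qform a b c v"
  shows "has_real_model a b c"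
proof -
  obtain L K m where "K ** L = mat 1 \<and> L ** K = mat 1 \<and>
     model_real m \<and> (\<forall>v. model_fun m (L *v v) = qform a' b' c' v)"
    using assms(1) unfolding has_real_model_def by (elim exE)
  then have KL: "K ** L = mat 1" "L ** K = mat 1" and real: "model_real m"
    and eq: "model_fun m (L *v v) = qform a' b' c' v" for v by simp_all
  have "(N ** K) ** (L ** M) = N ** (K ** L) ** M" "(L ** M) ** (N ** K) = L ** (M ** N) ** K"
    by (simp_all only: matrix_mul_assoc)
  then have "(N ** K) ** (L ** M) = mat 1" "(L ** M) ** (N ** K) = mat 1"
    by (simp_all add: assms(2,3) KL)
  moreover have "model_fun m ((L ** M) *v v) = qform a b c v" for v
    by (simp add: eq assms(4) flip: matrix_vector_mul_assoc)
  ultimately show ?thesis using real unfolding has_real_model_def by blast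
qed

definition perm_matrix :: "3 \<Rightarrow> 3 \<Rightarrow> 3 \<Rightarrow> complex^3^3" where
  "perm_matrix i j k = vector [axis i 1, axis j 1, axis k 1]"

lemma perm_matrix_vector: "perm_matrix i j k *v v = vector [v $ i, v $ j, v $ k]"
  using exhaust_3[of i] exhaust_3[of j] exhaust_3[of k]
  by (auto simp: perm_matrix_def vec3_eq_iff matrix_vector_3 axis_def)

text \<open>Exchanging the first two variables keeps the coefficient \<open>a\<close> and exchanges
  \<open>b\<close> and \<open>c\<close>.\<close>

lemma has_real_model_swap12: "has_real_model a c b \<Longrightarrow> has_real_model a b c"
  by (rule has_real_model_permute[of a c b "perm_matrix 2 1 3" "perm_matrix 2 1 3"])
    (auto simp: perm_matrix_vector matrix_eq vec3_eq_iff qform_explicit mult_ac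
      simp flip: matrix_vector_mul_assoc)

lemma has_real_model_rotate: "has_real_model b c a \<Longrightarrow> has_real_model a b c"
  by (rule has_real_model_permute[of b c a "perm_matrix 3 1 2" "perm_matrix 2 3 1"])
    (auto simp: perm_matrix_vector matrix_eq vec3_eq_iff qform_explicit mult_ac
      simp flip: matrix_vector_mul_assoc)

lemma has_real_modelI:
  assumes "\<And>x. K *v (L *v x) = x" "\<And>x. L *v (K *v x) = x"
    and "model_real m"
    and "\<And>w. qform a b c (K *v w) = model_fun m w"
  shows "has_real_model a b c"
proof -
  have "K ** L = mat 1" "L ** K = mat 1"
    using assms(1,2) by (simp_all add: matrix_eq matrix_vector_mul_assoc[symmetric] del: matrix_vector_mul_assoc)
  moreover have "model_fun m (L *v v) = qform a b c v" for v
    using assms(4)[of "L *v v"] assms(1) by simp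
  ultimately show ?thesis using assms(3) unfolding has_real_model_def by blast
qed

lemma has_real_model_real:
  assumes "a \<in> \<real>" "b \<in> \<real>" "c \<in> \<real>" shows "has_real_model a b c"
  by (rule has_real_modelI[of "mat 1" "mat 1" "(1, a, b, 0, 1, 1, c)"])
    (use assms in \<open>auto simp: model_fun.simps qform_explicit\<close>)

lemma has_real_model_imaginary:
  assumes "cnj a = - a" "cnj b = - b" "c \<in> \<real>" shows "has_real_model a b c"
proof -
  \<comment> \<open>Scaling the first variable by \<open>w\<close> multiplies the imaginary
    \<open>a\<close> and \<open>b\<close> by \<open>w\<^sup>2 = \<i>\<close>, which makes them real,
    and its fourth power by -1.\<close>
  define w where "w = csqrt \<i>"
  have w: "w\<^sup>2 = \<i>" by (simp add: w_def del: csqrt_ii)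
  have w0: "w \<noteq> 0" using w by auto
  define K L :: "complex^3^3" where
    "K = vector [vector [w, 0, 0], vector [0, 1, 0], vector [0, 0, 1]]" and
    "L = vector [vector [1 / w, 0, 0], vector [0, 1, 0], vector [0, 0, 1]]"
  have K: "K *v x = vector [w * x $ 1, x $ 2, x $ 3]" for x
    by (simp add: K_def vec3_eq_iff matrix_vector_3)
  have L: "L *v x = vector [x $ 1 / w, x $ 2, x $ 3]" for x
    by (simp add: L_def vec3_eq_iff matrix_vector_3)
  show ?thesis
  proof (rule has_real_modelI[of K L "(-1, \<i> * a, \<i> * b, 0, 1, 1, c)"])
    show "K *v (L *v x) = x" "L *v (K *v x) = x" for x using w0 by (simp_all add: K L vec3_eq_iff)
    show "model_real (-1, \<i> * a, \<i> * b, 0, 1, 1, c)"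
      using assms by (simp add: Reals_cnj_iff)
    have w4: "w ^ 4 = -1"
    proof -
      have "w ^ 4 = (w\<^sup>2)\<^sup>2" by simp
      then show ?thesis unfolding w by simp
    qed
    show "qform a b c (K *v x) = model_fun (-1, \<i> * a, \<i> * b, 0, 1, 1, c) x" for x
      by (simp add: K qform_explicit model_fun.simps power_mult_distrib w w4 algebra_simps)
  qed
qed

text \<open>Conjugation exchanges the roles of the second and third variable, so these are replaced
  by the conjugate pair \<open>y + \<i> z\<close> and \<open>y - \<i> z\<close>. For
  \<open>s = -1\<close> the first variable is also scaled, to absorb the sign.\<close>

lemma has_real_model_conjugate_pair:
  assumes ab: "cnj a = s * b" "cnj b = s * a" and c: "c \<in> \<real>" and s: "s = 1 \<or> s = -1"
  shows "has_real_model a b c"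
proof -
  define u where "u = (if s = 1 then 1 else \<i>)"
  have u: "u\<^sup>2 = s" using s by (auto simp: u_def)
  define w where "w = csqrt u"
  have w: "w\<^sup>2 = u" by (simp add: w_def)
  have w0: "w \<noteq> 0" using w u s by auto
  define K L :: "complex^3^3" where
    "K = vector [vector [w, 0, 0], vector [0, 1, \<i>], vector [0, 1, - \<i>]]" and
    "L = vector [vector [1 / w, 0, 0], vector [0, 1 / 2, 1 / 2], vector [0, - \<i> / 2, \<i> / 2]]"
  have K: "K *v x = vector [w * x $ 1, x $ 2 + \<i> * x $ 3, x $ 2 - \<i> * x $ 3]" for x
    by (simp add: K_def vec3_eq_iff matrix_vector_3)
  have L: "L *v x = vector [x $ 1 / w, (x $ 2 + x $ 3) / 2, \<i> * (x $ 3 - x $ 2) / 2]" for x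
    by (simp add: L_def vec3_eq_iff matrix_vector_3 field_simps)
  \<comment> \<open>Here \<open>u\<close> is \<open>w\<^sup>2\<close> and \<open>s\<close> is
    \<open>w ^ 4\<close>. At \<open>y ^ 4\<close>, \<open>y\<^sup>2 z\<^sup>2\<close> and
    \<open>z ^ 4\<close> the two fourth powers contribute 2, -12, 2 and the term of \<open>c\<close>
    contributes \<open>c\<close>, \<open>2 c\<close>, \<open>c\<close>.\<close>
  let ?m = "(s, u * (a + b), - (u * (a + b)), 2 * \<i> * u * (a - b), 2 + c, 2 + c, 2 * c - 12)"
  show ?thesis
  proof (rule has_real_modelI[of K L ?m])
    show "K *v (L *v x) = x" "L *v (K *v x) = x" for x
      using w0 by (simp_all add: K L vec3_eq_iff field_simps)
    have "cnj (u * (a + b)) = u * (a + b)" "cnj (2 * \<i> * u * (a - b)) = 2 * \<i> * u * (a - b)"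
      using s by (auto simp: u_def ab algebra_simps)
    moreover have "s \<in> \<real>" using s by auto
    ultimately show "model_real ?m"
      using c by (simp add: Reals_cnj_iff)
    have w4: "w ^ 4 = s"
    proof -
      have "w ^ 4 = (w\<^sup>2)\<^sup>2" by simp
      then show ?thesis unfolding w u .
    qed
    have i2: "\<i> * \<i> = -1" by simp
    show "qform a b c (K *v x) = model_fun ?m x" for x
    proof -
      have "qform a b c (K *v x) = s * x$1 ^ 4 + (x$2 + \<i> * x$3) ^ 4 + (x$2 - \<i> * x$3) ^ 4
          + a * (u * (x$1)\<^sup>2) * (x$2 + \<i> * x$3)\<^sup>2 + b * (u * (x$1)\<^sup>2) * (x$2 - \<i> * x$3)\<^sup>2
          + c * (x$2 + \<i> * x$3)\<^sup>2 * (x$2 - \<i> * x$3)\<^sup>2"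
        by (simp add: K qform_explicit power_mult_distrib w w4)
      also have "\<dots> = model_fun ?m x"
        unfolding model_fun.simps using i2 by algebra
      finally show ?thesis .
    qed
  qed
qed

text \<open>Conjugating twice gives back \<open>a\<close>. So a 3-cycle would equate two of the
  squares, and a transposition has equal signs on the exchanged pair, which makes the third sign 1.
  For the identity the sign condition leaves all three coefficients real, or one real and two
  imaginary.\<close>

lemma has_real_model_if_conjugate:
  assumes dist: "a\<^sup>2 \<noteq> b\<^sup>2" "a\<^sup>2 \<noteq> c\<^sup>2" "b\<^sup>2 \<noteq> c\<^sup>2"
    and eq: "cnj a = s1 * p" "cnj b = s2 * q" "cnj c = s3 * r"
    and s: "s1\<^sup>2 = 1" "s2\<^sup>2 = 1" "s3\<^sup>2 = 1" "s1 * s2 * s3 = 1"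
    and perm: "(p, q, r) \<in> {(a, b, c), (a, c, b), (b, a, c), (b, c, a), (c, a, b), (c, b, a)}"
  shows "has_real_model a b c"
proof -
  have s': "s1 = 1 \<or> s1 = -1" "s2 = 1 \<or> s2 = -1" "s3 = 1 \<or> s3 = -1"
    using s(1-3) by (simp_all add: power2_eq_1_iff)
  have cs: "cnj s1 = s1" "cnj s2 = s2" "cnj s3 = s3" using s' by auto
  have real: "x \<in> \<real>" if "cnj x = x" for x using that by (simp add: Reals_cnj_iff)
  have pair: "s = t" if "cnj x = s * y" "cnj y = t * x" "x\<^sup>2 \<noteq> y\<^sup>2"
      "s = 1 \<or> s = -1" "t = 1 \<or> t = -1" for x y s t
  proof -
    have "cnj (cnj x) = s * (t * x)" unfolding that(1) complex_cnj_mult that(2) using that(4) by auto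
    then have "(s * t - 1) * x = 0" by (simp add: algebra_simps)
    moreover have "x \<noteq> 0" using that(1,3,4) by auto
    ultimately show ?thesis using that(4,5) by auto
  qed
  from perm consider "(p, q, r) = (a, b, c)" | "(p, q, r) = (a, c, b)" | "(p, q, r) = (b, a, c)"
    | "(p, q, r) = (b, c, a)" | "(p, q, r) = (c, a, b)" | "(p, q, r) = (c, b, a)" by blast
  then show ?thesis
  proof cases
    case 1
    then have e: "cnj a = s1 * a" "cnj b = s2 * b" "cnj c = s3 * c" using eq by simp_all
    consider "s1 = 1" "s2 = 1" "s3 = 1" | "s1 = 1" "s2 = -1" "s3 = -1"
      | "s1 = -1" "s2 = 1" "s3 = -1" | "s1 = -1" "s2 = -1" "s3 = 1"
      using s' s(4) by auto
    then show ?thesis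
    proof cases
      case 1
      then show ?thesis using e by (intro has_real_model_real real) simp_all
    next
      case 2
      then show ?thesis using e
        by - (rule has_real_model_rotate, intro has_real_model_imaginary real, simp_all)
    next
      case 3
      then show ?thesis using e
        by - (rule has_real_model_swap12, intro has_real_model_imaginary real, simp_all)
    next
      case 4
      then show ?thesis using e by (intro has_real_model_imaginary real) simp_all
    qed
  next
    case 2
    then have e: "cnj a = s1 * a" "cnj b = s2 * c" "cnj c = s3 * b" using eq by simp_all
    have "s2 = s3" using pair[OF e(2,3) dist(3) s'(2,3)] .
    moreover from this have "s1 = 1" using s' s(4) by auto
    ultimately show ?thesis using e s'
      by - (rule has_real_model_rotate, intro has_real_model_conjugate_pair[of b s2 c] real, simp_all)
  next
    case 3
    then have e: "cnj a = s1 * b" "cnj b = s2 * a" "cnj c = s3 * c" using eq by simp_all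
    have "s1 = s2" using pair[OF e(1,2) dist(1) s'(1,2)] .
    moreover from this have "s3 = 1" using s' s(4) by auto
    ultimately show ?thesis using e s'
      by (intro has_real_model_conjugate_pair[of a s1 b] real) simp_all
  next
    case 4
    then have e: "cnj a = s1 * b" "cnj b = s2 * c" using eq by simp_all
    have "cnj (cnj a) = s1 * (s2 * c)" unfolding e(1) complex_cnj_mult e(2) cs ..
    then have "a\<^sup>2 = c\<^sup>2" using s by (simp add: power_mult_distrib)
    then show ?thesis using dist by simp
  next
    case 5
    then have e: "cnj a = s1 * c" "cnj c = s3 * b" using eq by simp_all
    have "cnj (cnj a) = s1 * (s3 * b)" unfolding e(1) complex_cnj_mult e(2) cs ..
    then have "a\<^sup>2 = b\<^sup>2" using s by (simp add: power_mult_distrib)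
    then show ?thesis using dist by simp
  next
    case 6
    then have e: "cnj a = s1 * c" "cnj b = s2 * b" "cnj c = s3 * a" using eq by simp_all
    have "s1 = s3" using pair[OF e(1,3) dist(2) s'(1,3)] .
    moreover from this have "s2 = 1" using s' s(4) by auto
    ultimately show ?thesis using e s'
      by - (rule has_real_model_swap12, intro has_real_model_conjugate_pair[of a s1 c] real, simp_all)
  qed
qed

section \<open>Descent from the field of moduli\<close>

lemma real_automorphism:
  assumes "\<sigma> \<in> field_automorphisms (\<real> :: complex set)"
  shows "\<sigma> = (\<lambda>x. x) \<or> \<sigma> = cnj"
proof -
  have add: "\<sigma> (x + y) = \<sigma> x + \<sigma> y" and mult: "\<sigma> (x * y) = \<sigma> x * \<sigma> y" for x y
    using assms by (simp_all add: field_automorphisms_def)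
  have fix_real: "\<sigma> (of_real r) = of_real r" for r
    using assms by (simp add: field_automorphisms_def)
  have eq: "\<sigma> x = of_real (Re x) + \<sigma> \<i> * of_real (Im x)" for x
  proof -
    have "\<sigma> x = \<sigma> (of_real (Re x) + \<i> * of_real (Im x))" by (simp flip: complex_eq)
    then show ?thesis by (simp only: add mult fix_real)
  qed
  have "\<sigma> \<i> * \<sigma> \<i> = -1" using mult[of \<i> \<i>] fix_real[of "-1"] by simp
  then have "(\<sigma> \<i> - \<i>) * (\<sigma> \<i> + \<i>) = 0" by (simp add: algebra_simps)
  then consider "\<sigma> \<i> = \<i>" | "\<sigma> \<i> = - \<i>" by (auto simp: add_eq_0_iff2)
  then show ?thesis
  proof cases
    case 1
    then have "\<sigma> x = x" for x using eq[of x] by (simp flip: complex_eq)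
    then show ?thesis by blast
  next
    case 2
    then have "\<sigma> x = cnj x" for x using eq[of x] by (simp add: complex_eq_iff)
    then show ?thesis by blast
  qed
qed

text \<open>Otherwise conjugation, the only nontrivial automorphism over the reals, imposes no
  condition, and \<open>\<i>\<close> would lie in the field of moduli.\<close>

lemma isomorphic_conjugate_if_field_of_moduli:
  assumes "field_of_moduli \<real> n S = (\<real> :: complex set)"
  shows "isomorphic_curves n S n (conjugate_curve cnj S)"
proof (rule ccontr)
  assume neg: "\<not> ?thesis"
  have "\<i> \<in> field_of_moduli \<real> n S"
    unfolding field_of_moduli_def using real_automorphism neg by blast
  then show False unfolding assms by (simp add: complex_is_Real_iff)
qed

theorem corollary4p5:
  fixes a b c :: complex
  assumes "a\<^sup>2 \<noteq> b\<^sup>2" and "a\<^sup>2 \<noteq> c\<^sup>2" and "b\<^sup>2 \<noteq> c\<^sup>2"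
    and "smooth_curve 2 {quartic a b c}"
    and "field_of_moduli \<real> 2 {quartic a b c} = \<real>"
  shows "field_of_definition \<real> 2 {quartic a b c}"
proof -
  have X: "smooth_quartic a b c" using assms(4) smooth_quartic_iff by blast
  have Y: "smooth_quartic (cnj a) (cnj b) (cnj c)"
  proof
    fix x :: "complex^3" assume x: "x \<noteq> 0" "qform (cnj a) (cnj b) (cnj c) x = 0"
    define y where "y = (\<chi> i. cnj (x $ i))"
    have "qform (cnj a) (cnj b) (cnj c) x = cnj (qform a b c y)"
      by (simp add: y_def qform_explicit)
    moreover have "qgrad (cnj a) (cnj b) (cnj c) x $ i = cnj (qgrad a b c y $ i)" for i
      using exhaust_3[of i] by (auto simp: y_def qgrad_def)
    moreover have "y \<noteq> 0" using x(1) by (auto simp: y_def vec_eq_iff)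
    ultimately show "qgrad (cnj a) (cnj b) (cnj c) x \<noteq> 0"
      using smooth_quartic.smooth[OF X, of y] x(2) by (auto simp: vec_eq_iff)
  qed
  have "isomorphic_curves 2 {quartic a b c} 2 {quartic (cnj a) (cnj b) (cnj c)}"
    using isomorphic_conjugate_if_field_of_moduli[OF assms(5)]
    by (simp add: conjugate_curve_def map_cnj_quartic)
  from isomorphic_quartics_linear[OF X Y mpoly_eval_quartic mpoly_eval_quartic this]
  obtain A B k where AB: "B ** A = mat 1"
    and eq: "\<And>x. qform (cnj a) (cnj b) (cnj c) (A *v x) = k * qform a b c x" by blast
  have AB': "A ** B = mat 1" using AB matrix_left_right_inverse by blast
  \<comment> \<open>The target form has the value 1 at \<open>axis 1 1\<close>, a vector in the
    image of \<open>A\<close>.\<close>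
  have "k \<noteq> 0"
  proof
    assume "k = 0"
    then have "qform (cnj a) (cnj b) (cnj c) (A *v (B *v axis 1 1)) = 0" using eq by simp
    then show False by (simp add: matrix_vector_mul_assoc AB' qform_explicit axis_def)
  qed
  moreover have "(cnj x)\<^sup>2 \<noteq> (cnj y)\<^sup>2" if "x\<^sup>2 \<noteq> y\<^sup>2" for x y
    using that by (metis complex_cnj_cancel_iff complex_cnj_power)
  ultimately interpret linear_equiv a b c "cnj a" "cnj b" "cnj c" A B k
    using X Y AB AB' eq assms(1-3)
    by (simp add: linear_equiv_def distinct_quartic_def distinct_quartic_axioms_def linear_equiv_axioms_def)
  obtain A' B' k' where "linear_equiv a b c (cnj a) (cnj b) (cnj c) A' B' k'" "linear_equiv.monomial A'"
    using exists_monomial by blast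
  from linear_equiv.monomial_coefficients[OF this] obtain p q r s1 s2 s3 where
    "cnj a = s1 * p" "cnj b = s2 * q" "cnj c = s3 * r"
    "s1\<^sup>2 = 1" "s2\<^sup>2 = 1" "s3\<^sup>2 = 1" "s1 * s2 * s3 = 1"
    "(p, q, r) \<in> {(a, b, c), (a, c, b), (b, a, c), (b, c, a), (c, a, b), (c, b, a)}"
    by blast
  from has_real_model_if_conjugate[OF assms(1-3) this]
  show ?thesis using field_of_definition_if_real_model X by blast
qed

end
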